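(* Let $a,b>0$ with $a^{\frac{N-4s}{2s}}b>L_{N,s}$. There exist $\delta>0$ and $r>0$ such that for any $\lambda\in(\overline{\lambda}_0^s-\delta,\overline{\lambda}_0^s)$ the value $$\hat{\iota}_\lambda^s:=\inf\{\mathcal{I}_{a,b}^\lambda(u)\mid u\in X_0^s(\Omega),\ \|u\|\ge r\}$$ is attained at a function $w_\lambda^s\in X_0^s(\Omega)$ satisfying $\|w_\lambda^s\|>r$.
   Context: Throughout, $s\in(0,1)$, $N$ is a positive integer with $N>4s$, $\Omega\subset\mathbb{R}^N$ is a bounded domain with Lipschitz boundary, and $2^*_s:=\frac{2N}{N-2s}$. Put $\mathcal{Q}:=\mathbb{R}^{2N}\setminus(\Omega^c\times\Omega^c)$, where $\Omega^c=\mathbb{R}^N\setminus\Omega$. $X_0^s(\Omega)$ is the space of (measurable) functions $u\colon\mathbb{R}^N\to\mathbb{R}$ with $u|_\Omega\in L^2(\Omega)$, $\int_{\mathcal{Q}}\frac{|u(x)-u(y)|^2}{|x-y|^{N+2s}}\,dx\,dy<\infty$ and $u=0$ a.e. in $\mathbb{R}^N\setminus\Omega$; it is a Hilbert space with norm $\|u\|=\left(\int_{\mathcal{Q}}\frac{|u(x)-u(y)|^2}{|x-y|^{N+2s}}\,dx\,dy\right)^{1/2}$. $\|\cdot\|_q$ is the norm of $L^q(\Omega)$. $S_{N,s}:=\inf_{u\in X_0^s(\Omega)\setminus\{0\}}\frac{\|u\|^2}{\|u\|_{2^*_s}^2}$ and $L_{N,s}:=\frac{4s(N-4s)^{\frac{N-4s}{2s}}}{N^{\frac{N-2s}{2s}}S_{N,s}^{\frac{N}{2s}}}$.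 Standing assumptions on $g$: (H1) $g\colon\Omega\times\mathbb{R}\to\mathbb{R}$ is a Carathéodory function with $g(x,0)=0$ for a.e. $x\in\Omega$; (H2) for a.e. $x\in\Omega$, $g(x,t)>0$ for every $t>0$ and $g(x,t)<0$ for every $t<0$; moreover there are $\mu>0$ and a nonempty open interval $I\subset(0,\infty)$ with $g(x,t)\ge\mu$ for a.e. $x\in\Omega$ and every $t\in I$; (H3) there are $c>0$ and $p\in(2,2^*_s)$ with $|g(x,t)|\le c(1+|t|^{p-1})$ for a.e. $x\in\Omega$ and all $t\in\mathbb{R}$; (H4) $\lim_{t\to0}g(x,t)/|t|=0$ uniformly with respect to $x\in\Omega$. Put $G(x,t)=\int_0^tg(x,\tau)\,d\tau$ and $\mathcal{I}_{a,b}^\lambda(u):=\frac a2\|u\|^2+\frac b4\|u\|^4-\frac1{2^*_s}\|u\|_{2^*_s}^{2^*_s}-\lambda\int_\Omega G(x,u)\,dx$ for $u\in X_0^s(\Omega)$. For $\lambda\ge0$ and $u\in X_0^s(\Omega)\setminus\{0\}$ let $\mathcal{J}_{a,b}^{\lambda,u}(\zeta):=\mathcal{I}_{a,b}^\lambda(\zeta u)$, $\zeta>0$. When $a^{\frac{N-4s}{2s}}b\ge L_{N,s}$, for each $u\in X_0^s(\Omega)\setminus\{0\}$ there is a unique $\lambda=\lambda_0^s(u)\ge0$ for which some $\zeta>0$ satisfies $\mathcal{J}_{a,b}^{\lambda,u}(\zeta)=0$, $(\mathcal{J}_{a,b}^{\lambda,u})'(\zeta)=0$ and $\mathcal{J}_{a,b}^{\lambda,u}(\zeta)=\inf_{\varrho>0}\mathcal{J}_{a,b}^{\lambda,u}(\varrho)$.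 Define $\overline{\lambda}_0^s:=\inf_{u\in X_0^s(\Omega)\setminus\{0\}}\lambda_0^s(u)$. *)

theory Defs
  imports "HOL-Analysis.Analysis"
begin

text \<open>
  The space R^N is \<^typ>\<open>real^'n\<close> with N = CARD('n), and measurable means Lebesgue measurable.
  Elements of function spaces are represented by functions rather than by classes modulo equality
  almost everywhere; accordingly \<open>u \<noteq> 0\<close> is rendered as ``u is not almost everywhere zero''.
\<close>

text \<open>
  Near each boundary point the set is, in suitable orthonormal coordinates with last axis \<open>e\<close>,
  the strict epigraph of a Lipschitz function. The hyperplane orthogonal to \<open>e\<close> plays the
  role of R^(N-1), and \<open>x - (x \<bullet> e) *\<^sub>R e\<close> is the projection of \<open>x\<close> onto it.
\<close>

definition lipschitz_boundary :: "(real^'n) set \<Rightarrow> bool" where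
  "lipschitz_boundary \<Omega> \<longleftrightarrow>
    (\<forall>p\<in>frontier \<Omega>. \<exists>r>0. \<exists>e \<phi> L. norm e = 1 \<and> L-lipschitz_on {v. v \<bullet> e = 0} \<phi> \<and>
       \<Omega> \<inter> ball p r = {x \<in> ball p r. x \<bullet> e > \<phi> (x - (x \<bullet> e) *\<^sub>R e)})"

definition caratheodory :: "(real^'n) set \<Rightarrow> (real^'n \<Rightarrow> real \<Rightarrow> real) \<Rightarrow> bool" where
  "caratheodory \<Omega> g \<longleftrightarrow>
    (\<forall>t. (\<lambda>x. g x t) \<in> borel_measurable (lebesgue_on \<Omega>)) \<and>
    (AE x\<in>\<Omega> in lebesgue. continuous_on UNIV (g x))"

definition crit_exp :: "real \<Rightarrow> real \<Rightarrow> real" where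
  "crit_exp N s = 2 * N / (N - 2 * s)"

definition Q_set :: "(real^'n) set \<Rightarrow> ((real^'n) \<times> (real^'n)) set" where
  "Q_set \<Omega> = UNIV - ((- \<Omega>) \<times> (- \<Omega>))"

definition gagliardo :: "real \<Rightarrow> (real^'n \<Rightarrow> real) \<Rightarrow> (real^'n) \<times> (real^'n) \<Rightarrow> real" where
  "gagliardo s u = (\<lambda>(x, y). \<bar>u x - u y\<bar>^2 / norm (x - y) powr (real CARD('n) + 2 * s))"

definition X0 :: "(real^'n) set \<Rightarrow> real \<Rightarrow> (real^'n \<Rightarrow> real) set" where
  "X0 \<Omega> s = {u. u \<in> borel_measurable lebesgue \<and>
     set_integrable lebesgue \<Omega> (\<lambda>x. (u x)^2) \<and>
     set_integrable lebesgue (Q_set \<Omega>) (gagliardo s u) \<and>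
     (AE x in lebesgue. x \<notin> \<Omega> \<longrightarrow> u x = 0)}"

definition X0_nonzero :: "(real^'n) set \<Rightarrow> real \<Rightarrow> (real^'n \<Rightarrow> real) set" where
  "X0_nonzero \<Omega> s = {u \<in> X0 \<Omega> s. \<not> (AE x in lebesgue. u x = 0)}"

definition X0_norm :: "(real^'n) set \<Rightarrow> real \<Rightarrow> (real^'n \<Rightarrow> real) \<Rightarrow> real" where
  "X0_norm \<Omega> s u = sqrt (LINT z:Q_set \<Omega>|lebesgue. gagliardo s u z)"

definition Lq_norm :: "(real^'n) set \<Rightarrow> real \<Rightarrow> (real^'n \<Rightarrow> real) \<Rightarrow> real" where
  "Lq_norm \<Omega> q u = (LINT x:\<Omega>|lebesgue. \<bar>u x\<bar> powr q) powr (1 / q)"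

definition S_const :: "(real^'n) set \<Rightarrow> real \<Rightarrow> real" where
  "S_const \<Omega> s =
    (INF u\<in>X0_nonzero \<Omega> s. (X0_norm \<Omega> s u)^2 / (Lq_norm \<Omega> (crit_exp (real CARD('n)) s) u)^2)"

definition L_const :: "(real^'n) set \<Rightarrow> real \<Rightarrow> real" where
  "L_const \<Omega> s = (let N = real CARD('n) in
     4 * s * (N - 4 * s) powr ((N - 4 * s) / (2 * s)) /
     (N powr ((N - 2 * s) / (2 * s)) * S_const \<Omega> s powr (N / (2 * s))))"

text \<open>The integral from 0 to \<open>t\<close> is oriented: it changes sign for negative \<open>t\<close>.\<close>

definition primitive :: "(real^'n \<Rightarrow> real \<Rightarrow> real) \<Rightarrow> real^'n \<Rightarrow> real \<Rightarrow> real" where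
  "primitive g x t = (LBINT \<tau>=ereal 0..ereal t. g x \<tau>)"

definition energy ::
  "(real^'n) set \<Rightarrow> real \<Rightarrow> (real^'n \<Rightarrow> real \<Rightarrow> real) \<Rightarrow> real \<Rightarrow> real \<Rightarrow> real \<Rightarrow> (real^'n \<Rightarrow> real) \<Rightarrow> real"
  where
  "energy \<Omega> s g a b l u = (let q = crit_exp (real CARD('n)) s in
     a / 2 * (X0_norm \<Omega> s u)^2 + b / 4 * (X0_norm \<Omega> s u)^4
       - 1 / q * Lq_norm \<Omega> q u powr q
       - l * (LINT x:\<Omega>|lebesgue. primitive g x (u x)))"

definition fiber ::
  "(real^'n) set \<Rightarrow> real \<Rightarrow> (real^'n \<Rightarrow> real \<Rightarrow> real) \<Rightarrow> real \<Rightarrow> real \<Rightarrow> real \<Rightarrow> (real^'n \<Rightarrow> real) \<Rightarrow> real \<Rightarrow> real"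
  where
  "fiber \<Omega> s g a b l u \<zeta> = energy \<Omega> s g a b l (\<lambda>x. \<zeta> * u x)"

text \<open>
  Infima of the energy are taken in \<^typ>\<open>ereal\<close>, so that they are meaningful without knowing
  beforehand that the energy is bounded below. The parameter described in \<open>lambda0\<close> exists and
  is unique for nonzero \<open>u\<close> under the hypotheses on \<open>g\<close> and \<open>a powr ((N - 4 * s) / (2 * s)) * b \<ge> L_const \<Omega> s\<close>.
\<close>

definition lambda0 ::
  "(real^'n) set \<Rightarrow> real \<Rightarrow> (real^'n \<Rightarrow> real \<Rightarrow> real) \<Rightarrow> real \<Rightarrow> real \<Rightarrow> (real^'n \<Rightarrow> real) \<Rightarrow> real"
  where
  "lambda0 \<Omega> s g a b u = (THE l. l \<ge> 0 \<and> (\<exists>\<zeta>>0.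
     fiber \<Omega> s g a b l u \<zeta> = 0 \<and>
     (fiber \<Omega> s g a b l u has_real_derivative 0) (at \<zeta>) \<and>
     ereal (fiber \<Omega> s g a b l u \<zeta>) = (INF \<rho>\<in>{0<..}. ereal (fiber \<Omega> s g a b l u \<rho>))))"

definition lambda0_bar ::
  "(real^'n) set \<Rightarrow> real \<Rightarrow> (real^'n \<Rightarrow> real \<Rightarrow> real) \<Rightarrow> real \<Rightarrow> real \<Rightarrow> real"
  where
  "lambda0_bar \<Omega> s g a b = (INF u\<in>X0_nonzero \<Omega> s. lambda0 \<Omega> s g a b u)"

definition iota_hat ::
  "(real^'n) set \<Rightarrow> real \<Rightarrow> (real^'n \<Rightarrow> real \<Rightarrow> real) \<Rightarrow> real \<Rightarrow> real \<Rightarrow> real \<Rightarrow> real \<Rightarrow> ereal"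
  where
  "iota_hat \<Omega> s g a b r l = (INF u\<in>{u \<in> X0 \<Omega> s. X0_norm \<Omega> s u \<ge> r}. ereal (energy \<Omega> s g a b l u))"

end

theory Submission
  imports Defs "HOL-Complex_Analysis.Great_Picard"
begin

text \<open>
  Write \<open>\<Phi>\<close> for the energy at \<open>\<lambda> = 0\<close> and \<open>\<Gamma> u = \<integral> G(x, u)\<close>. On each ray \<open>\<lambda>\<^sub>0\<close> is the minimum of \<open>\<Phi>/\<Gamma>\<close>, so
  its infimum is that of the quotient \<open>\<Phi>/\<Gamma>\<close> over all nonzero functions. The strict inequality for
  \<open>a\<close> and \<open>b\<close> says that \<open>a/2 t\<^sup>2 + b/4 t\<^sup>4 - t\<^sup>q/(q S\<^sup>q\<^sup>/\<^sup>2)\<close> dominates \<open>\<eta> (t\<^sup>2 + t\<^sup>4)\<close> for some \<open>\<eta> > 0\<close>. Bounded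
  sequences have almost everywhere convergent subsequences, and the Brezis-Lieb lemma, applied both to
  \<open>\<bar>u\<bar>\<^sup>q\<close> and to the difference quotients in the Gagliardo integral, splits the energy of \<open>u\<^sub>n\<close> into that of
  the limit and that of the remainder \<open>v\<^sub>n\<close>; hence the energy drops in the limit by at least
  \<open>\<eta> \<parallel>v\<^sub>n\<parallel>\<^sup>2\<close>. So the quotient has a minimizer \<open>u\<^sub>0\<close>. For small \<open>r\<close> the energy
  is at least \<open>\<eta>/2 \<parallel>u\<parallel>\<^sup>2\<close> on the ball of radius \<open>r\<close>, while at \<open>u\<^sub>0\<close> it is below \<open>\<eta>/2 r\<^sup>2\<close> for \<open>\<lambda>\<close> close to
  the infimum; a minimizing sequence over \<open>\<parallel>u\<parallel> \<ge> r\<close> whose limit fell into the ball would have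
  energy at least \<open>\<eta>/2 r\<^sup>2\<close>.
\<close>

section \<open>Brezis-Lieb lemma and the sharp quartic inequality\<close>

text \<open>The obstacle is the critical exponent \<open>q\<close>: a bounded sequence may lose norm
  by concentration, and the critical term enters the energy with a negative sign, so lower
  semicontinuity is not automatic. The strict inequality for \<open>a\<close> and \<open>b\<close>
  restores it, because the lost part obeys the same Sobolev inequality with constant
  \<open>S_const\<close> and therefore pays a positive energy; the quartic term only helps, since (x
  + y)^2 >= x^2 + y^2 for x, y >= 0. The remaining hypotheses act at the two ends of a ray. By (H4)
  the potential is o(||u||^2) at zero, so minimizers of the quotient cannot collapse to zero; N > 4s
  means q < 4, so the quartic term controls the critical term and the potential at infinity. The
  constraint ||u|| >= r is not preserved by the limit. It is recovered by an energy count: a limit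
  inside the ball still pays \<eta>/2 times its squared norm, the lost part pays at least as much
  per unit of squared norm, and the two squared norms add up to at least r^2 in the limit.\<close>

text \<open>A dominating function independent of n exists only after an arbitrarily small multiple
  of \<open>k n\<close> has been removed, and boundedness of \<open>k n\<close> in L^1 suffices to
  neglect that multiple. This serves both the Brezis-Lieb lemma and the subcritical
  potential.\<close>

lemma tendsto_integral_zero_truncated_dominated:
  fixes f k :: "nat \<Rightarrow> 'a \<Rightarrow> real"
  assumes meas [measurable]: "\<And>n. f n \<in> borel_measurable M"
    and nonneg: "\<And>n x. f n x \<ge> 0"
    and lim: "AE x in M. (\<lambda>n. f n x) \<longlonglongrightarrow> 0"
    and k: "\<And>n. integrable M (k n)" "\<And>n x. k n x \<ge> 0" "\<And>n. (\<integral>x. k n x \<partial>M) \<le> K"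
    and dom: "\<And>e. e > 0 \<Longrightarrow> \<exists>C. integrable M C \<and> (\<forall>n. AE x in M. f n x \<le> e * k n x + C x)"
  shows "\<And>n. integrable M (f n)" "(\<lambda>n. \<integral>x. f n x \<partial>M) \<longlonglongrightarrow> 0"
proof -
  note [measurable] = borel_measurable_integrable[OF k(1)]
  obtain C1 where C1: "integrable M C1" "\<And>n. AE x in M. f n x \<le> 1 * k n x + C1 x"
    using dom[of 1] by auto
  show int: "integrable M (f n)" for n
  proof (rule Bochner_Integration.integrable_bound)
    show "integrable M (\<lambda>x. k n x + C1 x)" using k C1 by auto
    show "AE x in M. norm (f n x) \<le> norm (k n x + C1 x)"
      using C1(2)[of n] by eventually_elim (use nonneg[of n] in auto)
  qed simp
  have K: "K \<ge> 0"
    using k(3)[of 0] Bochner_Integration.integral_nonneg[of M "k 0"] k(2) by fastforce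
  show "(\<lambda>n. \<integral>x. f n x \<partial>M) \<longlonglongrightarrow> 0"
  proof (rule LIMSEQ_I)
    fix r :: real assume r: "r > 0"
    define e where "e = r / (2 * (K + 1))"
    have e: "e > 0" using r K by (simp add: e_def)
    have eK: "e * K \<le> r / 2" using r K by (simp add: e_def field_simps)
    obtain C where C: "integrable M C" "\<And>n. AE x in M. f n x \<le> e * k n x + C x"
      using dom[OF e] by auto
    have [measurable]: "C \<in> borel_measurable M" using C by auto
    \<comment> \<open>The excess of \<open>f n\<close> over \<open>e * k n\<close> is dominated by
      \<open>\<bar>C\<bar>\<close>, so its integral tends to zero; the part cut off has integral at
      most \<open>e * K\<close>, which is at most r/2.\<close>
    define W where "W = (\<lambda>n x. max 0 (f n x - e * k n x))"
    have [measurable]: "W n \<in> borel_measurable M" for n unfolding W_def by measurable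
    have Wb: "W n x \<le> f n x" "0 \<le> W n x" for n x
      using nonneg[of n x] e k(2)[of n x] by (auto simp: W_def)
    have Wint: "integrable M (W n)" for n
      by (rule Bochner_Integration.integrable_bound[OF int[of n]]) (use Wb nonneg in auto)
    have "(\<lambda>n. \<integral>x. W n x \<partial>M) \<longlonglongrightarrow> (\<integral>x. 0 \<partial>M)"
    proof (rule integral_dominated_convergence)
      show "integrable M (\<lambda>x. \<bar>C x\<bar>)" using C by auto
      show "AE x in M. norm (W n x) \<le> \<bar>C x\<bar>" for n
        using C(2)[of n] by eventually_elim (auto simp: W_def)
      show "AE x in M. (\<lambda>n. W n x) \<longlonglongrightarrow> 0"
        using lim
      proof eventually_elim
        case (elim x)
        show ?case
          by (rule tendsto_sandwich[OF _ _ tendsto_const elim]) (use Wb in auto)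
      qed
    qed auto
    then obtain N where N: "\<And>n. n \<ge> N \<Longrightarrow> \<bar>\<integral>x. W n x \<partial>M\<bar> < r / 2"
      using LIMSEQ_D[of "\<lambda>n. \<integral>x. W n x \<partial>M" 0 "r/2"] r
      by (metis diff_zero half_gt_zero integral_zero real_norm_def)
    have "norm ((\<integral>x. f n x \<partial>M) - 0) < r" if "n \<ge> N" for n
    proof -
      have "(\<integral>x. f n x \<partial>M) \<le> (\<integral>x. W n x + e * k n x \<partial>M)"
        by (rule integral_mono) (use int Wint k in \<open>auto simp: W_def\<close>)
      also have "\<dots> = (\<integral>x. W n x \<partial>M) + e * (\<integral>x. k n x \<partial>M)"
        using Wint k by simp
      also have "\<dots> \<le> (\<integral>x. W n x \<partial>M) + e * K" using k(3)[of n] e by simp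
      also have "\<dots> < r" using N[OF that] eK by simp
      finally have "(\<integral>x. f n x \<partial>M) < r" .
      moreover have "(\<integral>x. f n x \<partial>M) \<ge> 0" using nonneg by simp
      ultimately show ?thesis by simp
    qed
    then show "\<exists>N. \<forall>n\<ge>N. norm ((\<integral>x. f n x \<partial>M) - 0) < r" by blast
  qed
qed

text \<open>Fatou's lemma. Working in \<open>ennreal\<close> makes integrability of the limit a
  consequence instead of a hypothesis.\<close>

lemma nn_integral_limit_le:
  fixes f :: "nat \<Rightarrow> 'a \<Rightarrow> real"
  assumes [measurable]: "\<And>n. f n \<in> borel_measurable M"
    and lim: "AE x in M. (\<lambda>n. f n x) \<longlonglongrightarrow> h x"
    and bd: "\<And>n. (\<integral>\<^sup>+x. ennreal (f n x) \<partial>M) \<le> K"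
  shows "(\<integral>\<^sup>+x. ennreal (h x) \<partial>M) \<le> K"
proof -
  have "(\<integral>\<^sup>+x. ennreal (h x) \<partial>M) = (\<integral>\<^sup>+x. liminf (\<lambda>n. ennreal (f n x)) \<partial>M)"
  proof (rule nn_integral_cong_AE)
    show "AE x in M. ennreal (h x) = liminf (\<lambda>n. ennreal (f n x))"
      using lim
    proof eventually_elim
      case (elim x)
      then have "(\<lambda>n. ennreal (f n x)) \<longlonglongrightarrow> ennreal (h x)" by auto
      from lim_imp_Liminf[OF _ this] show ?case by simp
    qed
  qed
  also have "\<dots> \<le> liminf (\<lambda>n. \<integral>\<^sup>+x. ennreal (f n x) \<partial>M)"
    by (rule nn_integral_liminf) measurable
  also have "\<dots> \<le> K" by (rule Liminf_le) (use bd in auto)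
  finally show ?thesis .
qed

lemma integrableI_nn_integral_le:
  fixes f :: "'a \<Rightarrow> real"
  assumes "f \<in> borel_measurable M" "\<And>x. f x \<ge> 0" "(\<integral>\<^sup>+x. ennreal (f x) \<partial>M) \<le> ennreal K"
  shows "integrable M f"
  using assms by (intro integrableI_nonneg) (auto simp: top_unique less_top intro: le_less_trans)

lemma powr_abs_add_le:
  fixes q x y :: real
  assumes "q > 0"
  shows "\<bar>x + y\<bar> powr q \<le> 2 powr q * (\<bar>x\<bar> powr q + \<bar>y\<bar> powr q)"
proof -
  have "\<bar>x + y\<bar> powr q \<le> (2 * max \<bar>x\<bar> \<bar>y\<bar>) powr q"
    using assms by (intro powr_mono2) auto
  also have "\<dots> = 2 powr q * max \<bar>x\<bar> \<bar>y\<bar> powr q" by (simp add: powr_mult)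
  also have "\<dots> \<le> 2 powr q * (\<bar>x\<bar> powr q + \<bar>y\<bar> powr q)"
    by (intro mult_left_mono) (auto simp: max_def)
  finally show ?thesis .
qed

text \<open>By homogeneity this is continuity of |1 + t|^q at t = 0: divide by x when |y| < d|x|. In
  the other case |x| <= |y|/d, and both powers are multiples of |y|^q, whose factors add up to
  \<open>C\<close>.\<close>

lemma powr_abs_perturbation:
  fixes q e :: real
  assumes q: "q > 0" and e: "e > 0"
  obtains C where "C \<ge> 0"
    "\<And>x y. \<bar>\<bar>x + y\<bar> powr q - \<bar>x\<bar> powr q\<bar> \<le> e * \<bar>x\<bar> powr q + C * \<bar>y\<bar> powr q"
proof -
  have "isCont (\<lambda>t::real. \<bar>1 + t\<bar> powr q) 0" by (intro continuous_intros) auto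
  then obtain d where d: "d > 0" "\<And>t. \<bar>t\<bar> < d \<Longrightarrow> \<bar>\<bar>1 + t\<bar> powr q - 1\<bar> < e"
    using e unfolding isCont_def LIM_def by (auto simp: dist_real_def) (metis abs_zero zero_less_abs_iff diff_self add.right_neutral abs_one powr_one_eq_one)
  define C where "C = (1 + 1 / d) powr q + (1 / d) powr q"
  show ?thesis
  proof (rule that)
    show "C \<ge> 0" by (simp add: C_def)
    fix x y :: real
    show "\<bar>\<bar>x + y\<bar> powr q - \<bar>x\<bar> powr q\<bar> \<le> e * \<bar>x\<bar> powr q + C * \<bar>y\<bar> powr q"
    proof (cases "\<bar>y\<bar> < d * \<bar>x\<bar>")
      case True
      then have x: "x \<noteq> 0" by auto
      have "\<bar>y / x\<bar> < d" using True x by (simp add: field_simps)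
      from d(2)[OF this] have *: "\<bar>\<bar>1 + y / x\<bar> powr q - 1\<bar> \<le> e" by simp
      have "x + y = x * (1 + y / x)" using x by (simp add: field_simps)
      then have "\<bar>x + y\<bar> powr q = \<bar>x\<bar> powr q * \<bar>1 + y / x\<bar> powr q"
        by (simp add: abs_mult powr_mult)
      then have "\<bar>\<bar>x + y\<bar> powr q - \<bar>x\<bar> powr q\<bar> = \<bar>x\<bar> powr q * \<bar>\<bar>1 + y / x\<bar> powr q - 1\<bar>"
        by (metis abs_mult abs_of_nonneg mult.right_neutral powr_ge_zero right_diff_distrib)

      also have "\<dots> \<le> \<bar>x\<bar> powr q * e" using * by (intro mult_left_mono) auto
      also have "\<dots> \<le> e * \<bar>x\<bar> powr q + C * \<bar>y\<bar> powr q" by (simp add: C_def)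
      finally show ?thesis .
    next
      case False
      then have xy: "\<bar>x\<bar> \<le> 1 / d * \<bar>y\<bar>" using d(1) by (simp add: field_simps)
      have "\<bar>x\<bar> powr q \<le> (1 / d * \<bar>y\<bar>) powr q" using xy q by (intro powr_mono2) auto
      also have "\<dots> = (1 / d) powr q * \<bar>y\<bar> powr q" using d by (simp add: powr_mult powr_divide)
      finally have 1: "\<bar>x\<bar> powr q \<le> (1 / d) powr q * \<bar>y\<bar> powr q" .
      have "\<bar>x + y\<bar> powr q \<le> ((1 + 1 / d) * \<bar>y\<bar>) powr q"
        using xy q d(1) by (intro powr_mono2) (auto simp: algebra_simps)
      also have "\<dots> = (1 + 1 / d) powr q * \<bar>y\<bar> powr q" using d by (simp add: powr_mult)
      finally have 2: "\<bar>x + y\<bar> powr q \<le> (1 + 1 / d) powr q * \<bar>y\<bar> powr q" .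
      have "\<bar>\<bar>x + y\<bar> powr q - \<bar>x\<bar> powr q\<bar> \<le> \<bar>x + y\<bar> powr q + \<bar>x\<bar> powr q"
        by (simp add: abs_if)
      also have "\<dots> \<le> C * \<bar>y\<bar> powr q" using 1 2 by (simp add: C_def algebra_simps)
      finally show ?thesis using e by (simp add: add_increasing)
    qed
  qed
qed

text \<open>Fatou puts \<open>v\<close> into L^q. The defect \<open>f\<close> tends to zero
  pointwise, and \<open>powr_abs_perturbation\<close> with x = u n - v and y = v bounds it by e|u n
  - v|^q + (C + 1)|v|^q, the 1 paying for the separate term |v|^q. The exponent is left general
  because both \<open>q\<close> and 2 occur.\<close>

lemma brezis_lieb:
  fixes u :: "nat \<Rightarrow> 'a \<Rightarrow> real" and v :: "'a \<Rightarrow> real"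
  assumes q: "q > 0"
    and meas [measurable]: "\<And>n. u n \<in> borel_measurable M" "v \<in> borel_measurable M"
    and lim: "AE x in M. (\<lambda>n. u n x) \<longlonglongrightarrow> v x"
    and int: "\<And>n. integrable M (\<lambda>x. \<bar>u n x\<bar> powr q)"
    and bd: "\<And>n. (\<integral>x. \<bar>u n x\<bar> powr q \<partial>M) \<le> K"
  shows "integrable M (\<lambda>x. \<bar>v x\<bar> powr q)"
    and "\<And>n. integrable M (\<lambda>x. \<bar>u n x - v x\<bar> powr q)"
    and "(\<lambda>n. (\<integral>x. \<bar>u n x\<bar> powr q \<partial>M) - (\<integral>x. \<bar>u n x - v x\<bar> powr q \<partial>M))
           \<longlonglongrightarrow> (\<integral>x. \<bar>v x\<bar> powr q \<partial>M)"
proof -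
  have nn: "(\<integral>\<^sup>+ x. ennreal (\<bar>u n x\<bar> powr q) \<partial>M) \<le> ennreal K" for n
    using int[of n] bd[of n] by (subst nn_integral_eq_integral) (auto intro: ennreal_leI)
  have limq: "AE x in M. (\<lambda>n. \<bar>u n x\<bar> powr q) \<longlonglongrightarrow> \<bar>v x\<bar> powr q"
    using lim by eventually_elim (use q in \<open>auto intro!: tendsto_powr' tendsto_rabs\<close>)
  have vle: "(\<integral>\<^sup>+ x. ennreal (\<bar>v x\<bar> powr q) \<partial>M) \<le> ennreal K"
    by (rule nn_integral_limit_le[OF _ limq nn]) measurable
  show vint: "integrable M (\<lambda>x. \<bar>v x\<bar> powr q)"
    by (rule integrableI_nn_integral_le[OF _ _ vle]) auto
  have diffle: "\<bar>u n x - v x\<bar> powr q \<le> 2 powr q * (\<bar>u n x\<bar> powr q + \<bar>v x\<bar> powr q)" for n x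
    using powr_abs_add_le[OF q, of "u n x" "- v x"] by simp
  show dint: "integrable M (\<lambda>x. \<bar>u n x - v x\<bar> powr q)" for n
    by (rule Bochner_Integration.integrable_bound
        [where f = "\<lambda>x. 2 powr q * (\<bar>u n x\<bar> powr q + \<bar>v x\<bar> powr q)"])
       (use int vint diffle in auto)
  define f where "f = (\<lambda>n x. \<bar>\<bar>u n x\<bar> powr q - \<bar>u n x - v x\<bar> powr q - \<bar>v x\<bar> powr q\<bar>)"
  have f0: "(\<lambda>n. \<integral>x. f n x \<partial>M) \<longlonglongrightarrow> 0"
  proof (rule tendsto_integral_zero_truncated_dominated
      [where k = "\<lambda>n x. \<bar>u n x - v x\<bar> powr q"
         and K = "2 powr q * (K + (\<integral>x. \<bar>v x\<bar> powr q \<partial>M))"])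
    show "AE x in M. (\<lambda>n. f n x) \<longlonglongrightarrow> 0"
      using lim limq
    proof eventually_elim
      case (elim x)
      have "(\<lambda>n. \<bar>u n x - v x\<bar> powr q) \<longlonglongrightarrow> \<bar>v x - v x\<bar> powr q"
        using elim q by (intro tendsto_powr' tendsto_rabs tendsto_diff) auto
      then have "(\<lambda>n. f n x) \<longlonglongrightarrow> \<bar>\<bar>v x\<bar> powr q - \<bar>v x - v x\<bar> powr q - \<bar>v x\<bar> powr q\<bar>"
        unfolding f_def using elim by (intro tendsto_rabs tendsto_diff tendsto_const) auto
      then show ?case by simp
    qed
    show "(\<integral>x. \<bar>u n x - v x\<bar> powr q \<partial>M) \<le> 2 powr q * (K + (\<integral>x. \<bar>v x\<bar> powr q \<partial>M))" for n
    proof -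
      have "(\<integral>x. \<bar>u n x - v x\<bar> powr q \<partial>M) \<le> (\<integral>x. 2 powr q * (\<bar>u n x\<bar> powr q + \<bar>v x\<bar> powr q) \<partial>M)"
        by (rule integral_mono) (use int dint vint diffle in auto)
      also have "\<dots> = 2 powr q * ((\<integral>x. \<bar>u n x\<bar> powr q \<partial>M) + (\<integral>x. \<bar>v x\<bar> powr q \<partial>M))"
        using int vint by simp
      also have "\<dots> \<le> 2 powr q * (K + (\<integral>x. \<bar>v x\<bar> powr q \<partial>M))" using bd[of n] by simp
      finally show ?thesis .
    qed
    fix e :: real assume e: "e > 0"
    obtain C where C: "C \<ge> 0"
      "\<And>x y. \<bar>\<bar>x + y\<bar> powr q - \<bar>x\<bar> powr q\<bar> \<le> e * \<bar>x\<bar> powr q + C * \<bar>y\<bar> powr q"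
      using powr_abs_perturbation[OF q e] by blast
    have "f n x \<le> e * \<bar>u n x - v x\<bar> powr q + (C + 1) * \<bar>v x\<bar> powr q" for n x
      using C(2)[of "u n x - v x" "v x"] by (simp add: f_def algebra_simps abs_le_iff) (smt (verit) powr_ge_zero)
    then show "\<exists>C. integrable M C \<and> (\<forall>n. AE x in M. f n x \<le> e * \<bar>u n x - v x\<bar> powr q + C x)"
      by (intro exI[of _ "\<lambda>x. (C + 1) * \<bar>v x\<bar> powr q"]) (use vint in auto)
  qed (auto simp: f_def dint)
  have "(\<lambda>n. \<integral>x. \<bar>u n x\<bar> powr q - \<bar>u n x - v x\<bar> powr q - \<bar>v x\<bar> powr q \<partial>M) \<longlonglongrightarrow> 0"
  proof (rule tendsto_rabs_zero_cancel, rule tendsto_sandwich[OF _ _ tendsto_const f0])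
    show "\<forall>\<^sub>F n in sequentially. \<bar>\<integral>x. \<bar>u n x\<bar> powr q - \<bar>u n x - v x\<bar> powr q - \<bar>v x\<bar> powr q \<partial>M\<bar> \<le> (\<integral>x. f n x \<partial>M)"
      unfolding f_def by (intro always_eventually allI integral_abs_bound)
  qed auto
  moreover have "(\<integral>x. \<bar>u n x\<bar> powr q - \<bar>u n x - v x\<bar> powr q - \<bar>v x\<bar> powr q \<partial>M) =
      ((\<integral>x. \<bar>u n x\<bar> powr q \<partial>M) - (\<integral>x. \<bar>u n x - v x\<bar> powr q \<partial>M)) - (\<integral>x. \<bar>v x\<bar> powr q \<partial>M)" for n
    using int dint vint by simp
  ultimately show "(\<lambda>n. (\<integral>x. \<bar>u n x\<bar> powr q \<partial>M) - (\<integral>x. \<bar>u n x - v x\<bar> powr q \<partial>M))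
           \<longlonglongrightarrow> (\<integral>x. \<bar>v x\<bar> powr q \<partial>M)"
    by (simp add: LIM_zero_iff)
qed


section \<open>The quartic inequality behind the constant \<open>L_const\<close>\<close>

text \<open>Young's inequality with weights 1 - t and t. Dividing \<open>a\<close> and
  \<open>b * \<tau>\<close> by their weights makes the weighted mean equal to a + b\<tau>, and
  equality holds when the two quotients agree, so no constant is wasted.\<close>

lemma weighted_quadratic_lower_bound:
  fixes a b t \<tau> :: real
  assumes t: "0 < t" "t < 1" and ab: "a > 0" "b > 0" and \<tau>: "\<tau> \<ge> 0"
  shows "(a / (1 - t)) powr (1 - t) * (b / t) powr t * \<tau> powr t \<le> a + b * \<tau>"
proof (cases "\<tau> = 0")
  case True then show ?thesis using ab t by simp
next
  case False
  then have \<tau>: "\<tau> > 0" using \<tau> by simp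
  have "(a / (1 - t)) powr (1 - t) * (b * \<tau> / t) powr t \<le> (1 - t) * (a / (1 - t)) + t * (b * \<tau> / t)"
    by (rule Youngs_inequality_0) (use t ab \<tau> in auto)
  also have "\<dots> = a + b * \<tau>" using t by simp
  also have "(b * \<tau> / t) powr t = (b / t) powr t * \<tau> powr t"
    using t ab \<tau> by (simp add: powr_mult[symmetric])
  finally show ?thesis by (simp add: mult.assoc)
qed

text \<open>The relevant \<open>\<theta>\<close> is \<open>2s/(N - 2s)\<close>, so that \<open>1 + \<theta> = q/2\<close>; raising the weighted
  AM-GM inequality to the power \<open>1/\<theta>\<close> produces the constant \<open>L\<close>.\<close>

lemma critical_quartic_nonneg:
  fixes a b S N s \<alpha> \<beta> :: real
  defines "q \<equiv> crit_exp N s"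
  assumes s: "s > 0" and N: "N > 4 * s" and ab: "a > 0" "b > 0" and S: "S > 0"
    and L: "4 * s * (N - 4 * s) powr ((N - 4 * s) / (2 * s)) /
       (N powr ((N - 2 * s) / (2 * s)) * S powr (N / (2 * s))) \<le> a powr ((N - 4 * s) / (2 * s)) * b"
    and \<alpha>: "\<alpha> \<ge> 0" and \<beta>: "\<beta> \<le> (\<alpha> / S) powr (q / 2)"
  shows "0 \<le> a / 2 * \<alpha> + b / 4 * \<alpha>^2 - \<beta> / q"
proof -
  define t where "t = 2 * s / (N - 2 * s)"
  define P where "P = (N - 4 * s) / (2 * s)"
  have Np: "N - 2 * s > 0" "N > 0" "N - 4 * s > 0" using s N by auto
  have t: "0 < t" "t < 1" using s N by (auto simp: t_def field_simps)
  have q: "q / 2 = 1 + t" using s N by (simp add: q_def crit_exp_def t_def field_simps)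
  have q0: "q > 0" using q t by simp
  have t1: "(1 - t) / t = P" "1 / t = P + 1" "1 - t = (N - 4 * s) / (N - 2 * s)"
    using s N by (simp_all add: t_def P_def field_simps)
  have Pe: "(N - 2 * s) / (2 * s) = P + 1" "N / (2 * s) = P + 2"
    using s by (simp_all add: P_def field_simps)
  have qt: "(1 + t) / t = P + 2" using t1(2) t by (simp add: field_simps)
  have qv: "q = 2 * N / (N - 2 * s)" by (simp add: q_def crit_exp_def)
  \<comment> \<open>The optimal factor in a/2 + (b/4)\<alpha> >= X \<alpha>^t. Since q/2 = 1 + t,
    division by \<alpha> reduces the claim to 1/(q S^(q/2)) <= X.\<close>
  define X where "X = (a / 2 / (1 - t)) powr (1 - t) * (b / 4 / t) powr t"
  have X0: "X > 0" using ab t by (simp add: X_def)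
  have Xp: "X powr (1 / t) = (a / 2 / (1 - t)) powr P * (b / 4 / t)"
    using ab t by (simp add: X_def powr_mult powr_powr t1(1))
  have Yp: "(1 / (q * S powr (q / 2))) powr (1 / t) = 1 / (q powr (P + 1) * S powr (P + 2))"
    using q0 S t by (simp add: powr_divide powr_mult powr_powr q qt t1(2)[symmetric])
  \<comment> \<open>After raising to the power 1/t, both sides contain the same positive factor in N
    and s; cancelling it leaves exactly the hypothesis \<open>L\<close>.\<close>
  have "1 / (q powr (P + 1) * S powr (P + 2)) \<le> (a / 2 / (1 - t)) powr P * (b / 4 / t)"
  proof -
    define Z where "Z = N - 2 * s"
    define W where "W = N - 4 * s"
    have ZW: "Z > 0" "W > 0" using Np by (auto simp: Z_def W_def)
    have R: "(a / 2 / (1 - t)) powr P * (b / 4 / t) = a powr P * b * (Z powr P * Z / (2 powr P * W powr P * 8 * s))"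
      using ab s ZW unfolding t1(3) unfolding t_def Z_def[symmetric] W_def[symmetric]
      by (simp add: powr_divide powr_mult field_simps)
    have Lq: "1 / (q powr (P + 1) * S powr (P + 2)) =
       4 * s * W powr P / (N powr (P + 1) * S powr (P + 2)) * (Z powr P * Z / (2 powr P * W powr P * 8 * s))"
      using s ZW Np S unfolding qv Z_def[symmetric]
      by (simp add: powr_divide powr_mult powr_add field_simps)
    show ?thesis unfolding R Lq
      by (rule mult_right_mono)
         (use L ZW s in \<open>auto simp: Pe P_def[symmetric] W_def\<close>)
  qed
  then have "(1 / (q * S powr (q / 2))) powr (1 / t) \<le> X powr (1 / t)"
    unfolding Xp Yp .
  then have XY: "1 / (q * S powr (q / 2)) \<le> X"
    using X0 q0 S t by (meson less_eq_real_def not_le powr_less_mono2 zero_less_divide_1_iff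
        divide_nonneg_nonneg zero_le_one mult_nonneg_nonneg powr_ge_zero)
  have "\<beta> / q \<le> (\<alpha> / S) powr (q / 2) / q" using \<beta> q0 by (simp add: divide_right_mono)
  also have "\<dots> = \<alpha> * (1 / (q * S powr (q / 2)) * \<alpha> powr t)"
    using \<alpha> S by (simp add: powr_divide q powr_add field_simps)
  also have "\<dots> \<le> \<alpha> * (X * \<alpha> powr t)"
    using XY \<alpha> by (intro mult_left_mono mult_right_mono) auto
  also have "\<dots> \<le> \<alpha> * (a / 2 + b / 4 * \<alpha>)"
    using weighted_quadratic_lower_bound[OF t, of "a/2" "b/4" \<alpha>] ab \<alpha> unfolding X_def
    by (intro mult_left_mono) auto
  finally show ?thesis by (simp add: power2_eq_square algebra_simps)
qed

text \<open>Strictness leaves room to replace \<open>a\<close> and \<open>b\<close> by k a and k b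
  with k < 1 such that the pair satisfies the threshold condition with equality. The nonnegative
  case applies to that pair, and the fraction 1 - k of both terms is left over as
  \<open>\<eta>\<close>.\<close>

lemma critical_quartic_coercive:
  fixes a b S N s :: real
  defines "q \<equiv> crit_exp N s"
  assumes s: "s > 0" and N: "N > 4 * s" and ab: "a > 0" "b > 0" and S: "S > 0"
    and L: "4 * s * (N - 4 * s) powr ((N - 4 * s) / (2 * s)) /
       (N powr ((N - 2 * s) / (2 * s)) * S powr (N / (2 * s))) < a powr ((N - 4 * s) / (2 * s)) * b"
  obtains \<eta> where "\<eta> > 0"
    "\<And>\<alpha> \<beta>. \<alpha> \<ge> 0 \<Longrightarrow> \<beta> \<le> (\<alpha> / S) powr (q / 2) \<Longrightarrow>
       \<eta> * (\<alpha> + \<alpha>^2) \<le> a / 2 * \<alpha> + b / 4 * \<alpha>^2 - \<beta> / q"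
proof -
  define P where "P = (N - 4 * s) / (2 * s)"
  define l where "l = 4 * s * (N - 4 * s) powr P / (N powr ((N - 2 * s) / (2 * s)) * S powr (N / (2 * s)))"
  have P: "P > 0" using s N by (simp add: P_def)
  have l: "l > 0" using s N S by (simp add: l_def)
  have aP: "a powr P > 0" using ab by simp
  \<comment> \<open>The exponent undoes (k a)^P (k b) = k^(P + 1) a^P b.\<close>
  define k where "k = (l / (a powr P * b)) powr (1 / (P + 1))"
  have k0: "k > 0" using l ab by (simp add: k_def)
  have lt: "l / (a powr P * b) < 1"
    using L ab aP by (subst divide_less_eq_1_pos) (auto simp: l_def P_def)
  have "k < 1 powr (1 / (P + 1))" unfolding k_def
    by (rule powr_less_mono2) (use lt l ab P in auto)
  then have k1: "k < 1" by simp
  have kl: "(k * a) powr P * (k * b) = l"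
  proof -
    have "(k * a) powr P * (k * b) = k powr (P + 1) * (a powr P * b)"
      using k0 ab by (simp add: powr_mult powr_add)
    also have "k powr (P + 1) = l / (a powr P * b)"
      using l ab P by (simp add: k_def powr_powr)
    finally show ?thesis using ab aP by simp
  qed
  define \<eta> where "\<eta> = (1 - k) * min (a / 2) (b / 4)"
  show ?thesis
  proof (rule that)
    show "\<eta> > 0" using k1 ab by (simp add: \<eta>_def)
    fix \<alpha> \<beta> :: real assume \<alpha>: "\<alpha> \<ge> 0" and \<beta>: "\<beta> \<le> (\<alpha> / S) powr (q / 2)"
    have "0 \<le> (k * a) / 2 * \<alpha> + (k * b) / 4 * \<alpha>^2 - \<beta> / q"
      unfolding q_def
      by (rule critical_quartic_nonneg[OF s N _ _ S])
         (use k0 ab \<alpha> \<beta> kl in \<open>auto simp: q_def l_def P_def\<close>)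
    moreover have "\<eta> * \<alpha> \<le> (1 - k) * (a / 2) * \<alpha>" "\<eta> * \<alpha>^2 \<le> (1 - k) * (b / 4) * \<alpha>^2"
      using k1 \<alpha> unfolding \<eta>_def by (intro mult_right_mono mult_left_mono; simp)+
    ultimately show "\<eta> * (\<alpha> + \<alpha>^2) \<le> a / 2 * \<alpha> + b / 4 * \<alpha>^2 - \<beta> / q"
      by (simp add: algebra_simps)
  qed
qed

section \<open>Minimization over the exterior of a ball\<close>

text \<open>The bound by the infimum plus 1 holds at every index, so that coercivity bounds the
  whole sequence.\<close>

lemma minimizing_sequence:
  fixes f :: "'a \<Rightarrow> real"
  assumes V: "V \<noteq> {}" and bdd: "bdd_below (f ` V)"
  obtains v where "\<And>n. v n \<in> V" "\<And>n::nat. f (v n) \<le> (INF u\<in>V. f u) + 1"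
    "(\<lambda>n. f (v n)) \<longlonglongrightarrow> (INF u\<in>V. f u)"
proof -
  define m where "m = (INF u\<in>V. f u)"
  have "\<exists>u\<in>V. f u < m + inverse (real (Suc n))" for n
    using cINF_less_iff[OF V bdd, of "m + inverse (real (Suc n))"] by (simp add: m_def[symmetric])
  then obtain v where v: "\<And>n. v n \<in> V" "\<And>n. f (v n) < m + inverse (real (Suc n))" by metis
  have "f (v n) \<le> m + 1" for n
    using v(2)[of n] le_imp_inverse_le[of 1 "real (Suc n)"] by simp
  moreover have "(\<lambda>n. f (v n)) \<longlonglongrightarrow> m"
  proof (rule tendsto_sandwich[OF _ _ tendsto_const])
    show "(\<lambda>n. m + inverse (real (Suc n))) \<longlonglongrightarrow> m"
      using tendsto_add[OF tendsto_const LIMSEQ_inverse_real_of_nat, of m] by simp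
    show "\<forall>\<^sub>F n in sequentially. m \<le> f (v n)"
      unfolding m_def using cINF_lower[OF bdd v(1)] by simp
  qed (use v(2) less_imp_le in \<open>auto intro!: always_eventually\<close>)
  ultimately show ?thesis using that[of v] v(1) unfolding m_def by blast
qed

text \<open>In the application \<open>A u = \<parallel>u\<parallel>\<^sup>2\<close>, and \<open>\<alpha> n\<close> is the squared norm of the part of \<open>v (r n)\<close>
  lost in the weak limit \<open>w\<close>.\<close>

locale constrained_minimization =
  fixes Y :: "'y set" and A \<Phi> \<Gamma> :: "'y \<Rightarrow> real" and \<eta> :: real
  assumes A_nonneg: "u \<in> Y \<Longrightarrow> A u \<ge> 0"
    and eta: "\<eta> > 0"
    and lower: "u \<in> Y \<Longrightarrow> \<eta> * A u \<le> \<Phi> u"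
    and Gamma_pos: "u \<in> Y \<Longrightarrow> A u > 0 \<Longrightarrow> \<Gamma> u > 0"
    and nontrivial: "\<exists>u\<in>Y. A u > 0"
    and small: "e > 0 \<Longrightarrow> \<exists>\<rho>>0. \<forall>u\<in>Y. A u \<le> \<rho> \<longrightarrow> \<bar>\<Gamma> u\<bar> \<le> e * A u"
    and coercive: "\<exists>B. \<forall>u\<in>Y. \<Phi> u \<le> L * \<bar>\<Gamma> u\<bar> + K \<longrightarrow> A u \<le> B"
    and compactness: "(\<And>n::nat. v n \<in> Y) \<Longrightarrow> (\<And>n. A (v n) \<le> B) \<Longrightarrow>
      \<exists>(r :: nat \<Rightarrow> nat) w \<alpha> e. strict_mono r \<and> w \<in> Y \<and> (\<forall>n. \<alpha> n \<ge> 0) \<and>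
        (\<lambda>n. A (v (r n)) - \<alpha> n) \<longlonglongrightarrow> A w \<and> (\<lambda>n. \<Gamma> (v (r n))) \<longlonglongrightarrow> \<Gamma> w \<and>
        e \<longlonglongrightarrow> (0::real) \<and> (\<forall>n. \<Phi> (v (r n)) \<ge> \<Phi> w + \<eta> * \<alpha> n + e n)"
begin

lemma Gamma_zero:
  assumes "u \<in> Y" "A u = 0"
  shows "\<Gamma> u = 0"
  using small[of 1] assms by fastforce

lemma Gamma_nonneg:
  assumes "u \<in> Y"
  shows "\<Gamma> u \<ge> 0"
  using Gamma_zero[OF assms] Gamma_pos[OF assms] A_nonneg[OF assms] by fastforce

text \<open>The lost part has nonnegative energy, so the limit \<open>w\<close> of a minimizing
  sequence satisfies \<Phi> w <= m \<Gamma> w. What has to be excluded is A w = 0: then \<Gamma> and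
  hence \<Phi> tend to zero along the sequence, so its members have small norm, where \<Gamma> is
  too small for a bounded quotient.\<close>

lemma rayleigh_minimizer:
  obtains u0 where "u0 \<in> Y" "A u0 > 0"
    "\<And>u. u \<in> Y \<Longrightarrow> A u > 0 \<Longrightarrow> \<Phi> u0 / \<Gamma> u0 \<le> \<Phi> u / \<Gamma> u"
proof -
  define V where "V = {u \<in> Y. A u > 0}"
  define R where "R = (\<lambda>u. \<Phi> u / \<Gamma> u)"
  define m where "m = (INF u\<in>V. R u)"
  have V: "V \<noteq> {}" using nontrivial by (auto simp: V_def)
  have Rnn: "R u \<ge> 0" if "u \<in> V" for u
    using that lower[of u] Gamma_pos[of u] eta by (simp add: V_def R_def) (smt (verit) divide_nonneg_pos mult_pos_pos)
  have bdd: "bdd_below (R ` V)" using Rnn by (intro bdd_belowI2[of _ 0])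
  have m0: "m \<ge> 0" unfolding m_def by (rule cINF_greatest[OF V]) (rule Rnn)
  obtain v where v: "\<And>n. v n \<in> V" "\<And>n. R (v n) \<le> m + 1" and Rlim: "(\<lambda>n. R (v n)) \<longlonglongrightarrow> m"
    by (rule minimizing_sequence[OF V bdd, folded m_def]) (rule that)
  have vY: "v n \<in> Y" "A (v n) > 0" "\<Gamma> (v n) > 0" for n
    using v(1)[of n] Gamma_pos by (auto simp: V_def)
  have Phi: "\<Phi> (v n) = R (v n) * \<Gamma> (v n)" for n using vY(3)[of n] by (simp add: R_def)
  have Phile: "\<Phi> (v n) \<le> (m + 1) * \<bar>\<Gamma> (v n)\<bar>" for n
  proof -
    show ?thesis using v(2)[of n] vY(3)[of n] by (simp add: Phi)
  qed
  obtain B where "\<forall>u\<in>Y. \<Phi> u \<le> (m + 1) * \<bar>\<Gamma> u\<bar> + 0 \<longrightarrow> A u \<le> B" using coercive by blast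
  then have AB: "A (v n) \<le> B" for n using Phile vY by simp
  obtain r w \<alpha> e where *: "strict_mono r" "w \<in> Y" "\<And>n. \<alpha> n \<ge> 0"
    "(\<lambda>n. A (v (r n)) - \<alpha> n) \<longlonglongrightarrow> A w" "(\<lambda>n. \<Gamma> (v (r n))) \<longlonglongrightarrow> \<Gamma> w"
    "e \<longlonglongrightarrow> (0::real)" "\<And>n. \<Phi> (v (r n)) \<ge> \<Phi> w + \<eta> * \<alpha> n + e n"
    using compactness[of v B, OF vY(1) AB] by blast
  have Rl: "(\<lambda>n. R (v (r n))) \<longlonglongrightarrow> m"
    using LIMSEQ_subseq_LIMSEQ[OF Rlim *(1)] by (simp add: o_def)
  have Pl: "(\<lambda>n. \<Phi> (v (r n))) \<longlonglongrightarrow> m * \<Gamma> w"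
    unfolding Phi by (intro tendsto_mult Rl *(5))
  have Aw: "A w > 0"
  proof (rule ccontr)
    assume "\<not> A w > 0"
    then have "A w = 0" using A_nonneg[OF *(2)] by simp
    then have "(\<lambda>n. \<Phi> (v (r n))) \<longlonglongrightarrow> 0" using Pl Gamma_zero[OF *(2)] by simp
    \<comment> \<open>The quotient is at most m + 1 along the sequence, so this \<open>e\<close>
      would give \<eta> A <= \<Phi> <= (m + 1) \<Gamma> <= (\<eta>/2) A with A > 0.\<close>
    moreover define e where "e = \<eta> / (2 * (m + 1))"
    have e: "e > 0" using eta m0 by (simp add: e_def)
    obtain \<rho> where \<rho>: "\<rho> > 0" "\<And>u. u \<in> Y \<Longrightarrow> A u \<le> \<rho> \<Longrightarrow> \<bar>\<Gamma> u\<bar> \<le> e * A u"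
      using small[OF e] by blast
    ultimately have "\<forall>\<^sub>F n in sequentially. \<Phi> (v (r n)) < \<eta> * \<rho>"
      using eta by (intro order_tendstoD) auto
    then obtain n where n: "\<Phi> (v (r n)) < \<eta> * \<rho>" by (auto simp: eventually_sequentially)
    have "\<eta> * A (v (r n)) < \<eta> * \<rho>" using lower[OF vY(1)[of "r n"]] n by simp
    then have "A (v (r n)) \<le> \<rho>" using eta by simp
    from \<rho>(2)[OF vY(1) this] have "(m + 1) * \<bar>\<Gamma> (v (r n))\<bar> \<le> (m + 1) * (e * A (v (r n)))"
      using m0 by (intro mult_left_mono) auto
    also have "\<dots> = \<eta> / 2 * A (v (r n))" using m0 by (simp add: e_def field_simps)
    finally have "\<eta> * A (v (r n)) \<le> \<eta> / 2 * A (v (r n))"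
      using Phile[of "r n"] lower[OF vY(1)[of "r n"]] by linarith
    then show False using eta vY(2)[of "r n"] by simp
  qed
  have "(\<lambda>n. \<Phi> w + e n) \<longlonglongrightarrow> \<Phi> w + 0" by (intro tendsto_add tendsto_const *(6))
  moreover have "\<Phi> w + e n \<le> \<Phi> (v (r n))" for n
    using *(7)[of n] *(3)[of n] eta by (smt (verit) mult_nonneg_nonneg)
  ultimately have "\<Phi> w + 0 \<le> m * \<Gamma> w" by (intro LIMSEQ_le[OF _ Pl]) auto
  then have "R w \<le> m" using Gamma_pos[OF *(2) Aw] by (simp add: R_def field_simps)
  moreover have "m \<le> R u" if "u \<in> Y" "A u > 0" for u
    unfolding m_def by (rule cINF_lower[OF bdd]) (use that in \<open>auto simp: V_def\<close>)
  ultimately show ?thesis using that[OF *(2) Aw] by (force simp: R_def)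
qed

lemma local_minimizer_away_from_zero:
  assumes u0: "u0 \<in> Y" "A u0 > 0"
    and u0_min: "\<And>u. u \<in> Y \<Longrightarrow> A u > 0 \<Longrightarrow> \<Phi> u0 / \<Gamma> u0 \<le> \<Phi> u / \<Gamma> u"
  defines "lb \<equiv> \<Phi> u0 / \<Gamma> u0"
  shows "\<exists>\<delta>>0. \<exists>t>0. \<forall>l. lb - \<delta> < l \<and> l < lb \<longrightarrow>
    (\<exists>w\<in>Y. A w > t \<and> (\<forall>u\<in>Y. A u \<ge> t \<longrightarrow> \<Phi> w - l * \<Gamma> w \<le> \<Phi> u - l * \<Gamma> u))"
proof -
  have G0: "\<Gamma> u0 > 0" using u0 Gamma_pos by simp
  have lb: "lb > 0"
    using lower[OF u0(1)] u0(2) eta G0 unfolding lb_def by (smt (verit) divide_pos_pos mult_pos_pos)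
  \<comment> \<open>With this \<open>e\<close>, the term l \<Gamma> for 0 < l < lb consumes at most
    half of \<eta> A near zero; the other half is the bound \<open>near\<close>.\<close>
  define e where "e = \<eta> / (2 * lb)"
  have e: "e > 0" using eta lb by (simp add: e_def)
  obtain \<rho> where \<rho>: "\<rho> > 0" "\<And>u. u \<in> Y \<Longrightarrow> A u \<le> \<rho> \<Longrightarrow> \<bar>\<Gamma> u\<bar> \<le> e * A u"
    using small[OF e] by blast
  \<comment> \<open>Below \<rho> the estimate near zero holds, and t < A u0 makes \<open>u0\<close>
    a competitor.\<close>
  define t where "t = min \<rho> (A u0 / 2)"
  have t: "t > 0" "t \<le> \<rho>" "t < A u0" using \<rho> u0 by (auto simp: t_def)
  define \<kappa> where "\<kappa> = \<eta> / 2 * t"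
  have \<kappa>: "\<kappa> > 0" using eta t by (simp add: \<kappa>_def)
  \<comment> \<open>The first entry keeps \<open>l\<close> positive; the second makes (lb - l)
    \<Gamma> u0, the energy of \<open>u0\<close>, smaller than \<kappa>.\<close>
  define \<delta> where "\<delta> = min lb (\<kappa> / \<Gamma> u0)"
  have \<delta>: "\<delta> > 0" using lb \<kappa> G0 by (simp add: \<delta>_def)
  show ?thesis
  proof (rule exI[of _ \<delta>], intro conjI \<delta>, rule exI[of _ t], intro conjI t allI impI)
    fix l assume l: "lb - \<delta> < l \<and> l < lb"
    then have l0: "0 < l" "l < lb" by (auto simp: \<delta>_def)
    define I where "I = (\<lambda>u. \<Phi> u - l * \<Gamma> u)"
    have near: "I u \<ge> \<eta> / 2 * A u" if u: "u \<in> Y" "A u \<le> t" for u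
    proof -
      have "l * \<Gamma> u \<le> lb * \<bar>\<Gamma> u\<bar>"
        using l0 Gamma_nonneg[OF u(1)] by (intro mult_mono) auto
      also have "\<dots> \<le> lb * (e * A u)" using \<rho>(2)[of u] u t lb by (intro mult_left_mono) auto
      also have "\<dots> = \<eta> / 2 * A u" using lb by (simp add: e_def)
      finally show ?thesis using lower[OF u(1)] by (simp add: I_def)
    qed
    define V where "V = {u \<in> Y. A u \<ge> t}"
    have u0V: "u0 \<in> V" using u0 t by (simp add: V_def)
    have Inn: "I u \<ge> 0" if "u \<in> V" for u
    proof -
      have u: "u \<in> Y" "A u > 0" using that t by (auto simp: V_def)
      have "lb * \<Gamma> u \<le> \<Phi> u"
        using u0_min[OF u] Gamma_pos[OF u] by (simp add: lb_def field_simps)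
      moreover have "l * \<Gamma> u \<le> lb * \<Gamma> u" using l0 Gamma_pos[OF u] by simp
      ultimately show ?thesis by (simp add: I_def)
    qed
    define m where "m = (INF u\<in>V. I u)"
    have V: "V \<noteq> {}" using u0V by auto
    have bdd: "bdd_below (I ` V)" using Inn by (intro bdd_belowI2[of _ 0])
    have mI: "m \<le> I u" if "u \<in> V" for u unfolding m_def by (rule cINF_lower[OF bdd that])
    have "I u0 = (lb - l) * \<Gamma> u0" using G0 by (simp add: I_def lb_def field_simps)
    also have "\<dots> < \<kappa> / \<Gamma> u0 * \<Gamma> u0"
      using l G0 by (intro mult_strict_right_mono) (auto simp: \<delta>_def)
    finally have Iu0: "I u0 < \<kappa>" using G0 by simp
    have m\<kappa>: "m < \<kappa>" using mI[OF u0V] Iu0 by simp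
    obtain v where v: "\<And>n. v n \<in> V" "\<And>n. I (v n) \<le> m + 1" and Ilim: "(\<lambda>n. I (v n)) \<longlonglongrightarrow> m"
      by (rule minimizing_sequence[OF V bdd, folded m_def]) (rule that)
    have vY: "v n \<in> Y" "A (v n) \<ge> t" for n using v(1)[of n] by (auto simp: V_def)
    have Phile: "\<Phi> (v n) \<le> l * \<bar>\<Gamma> (v n)\<bar> + (m + 1)" for n
    proof -
      have "I (v n) \<le> m + 1" by (rule v(2))
      moreover have "l * \<Gamma> (v n) \<le> l * \<bar>\<Gamma> (v n)\<bar>" using l0 by simp
      ultimately show ?thesis by (simp add: I_def)
    qed
    obtain B where "\<forall>u\<in>Y. \<Phi> u \<le> l * \<bar>\<Gamma> u\<bar> + (m + 1) \<longrightarrow> A u \<le> B" using coercive by blast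
    then have AB: "A (v n) \<le> B" for n using Phile vY by simp
    obtain r w \<alpha> e where *: "strict_mono r" "w \<in> Y" "\<And>n. \<alpha> n \<ge> 0"
      "(\<lambda>n. A (v (r n)) - \<alpha> n) \<longlonglongrightarrow> A w" "(\<lambda>n. \<Gamma> (v (r n))) \<longlonglongrightarrow> \<Gamma> w"
      "e \<longlonglongrightarrow> (0::real)" "\<And>n. \<Phi> (v (r n)) \<ge> \<Phi> w + \<eta> * \<alpha> n + e n"
      using compactness[of v B, OF vY(1) AB] by blast
    have Il: "(\<lambda>n. I (v (r n))) \<longlonglongrightarrow> m"
      using LIMSEQ_subseq_LIMSEQ[OF Ilim *(1)] by (simp add: o_def)
    have "(\<lambda>n. \<Phi> w + e n - l * \<Gamma> (v (r n))) \<longlonglongrightarrow> \<Phi> w + 0 - l * \<Gamma> w"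
      by (intro tendsto_intros *)
    moreover have "\<Phi> w + e n - l * \<Gamma> (v (r n)) \<le> I (v (r n))" for n
      using *(7)[of n] *(3)[of n] eta unfolding I_def by (smt (verit) mult_nonneg_nonneg)
    ultimately have "\<Phi> w + 0 - l * \<Gamma> w \<le> m" by (intro LIMSEQ_le[OF _ Il]) auto
    then have Iw: "I w \<le> m" by (simp add: I_def)
    have "A w > t"
    proof (rule ccontr)
      assume "\<not> A w > t"
      then have Aw: "I w \<ge> \<eta> / 2 * A w" using near[OF *(2)] by simp
      \<comment> \<open>Half of \<eta> is paid by the limit through \<open>Aw\<close> and half by
        the lost part \<alpha> n. Up to an error tending to zero they account for (\<eta>/2) A (v (r
        n)), which is at least \<kappa> by the constraint.\<close>
      have "\<kappa> + (I w - \<eta> / 2 * A w) + (e n - l * (\<Gamma> (v (r n)) - \<Gamma> w) - \<eta> / 2 * (A (v (r n)) - \<alpha> n - A w))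
              \<le> I (v (r n))" for n
      proof -
        have "I w + \<eta> * \<alpha> n + e n - l * (\<Gamma> (v (r n)) - \<Gamma> w) \<le> I (v (r n))"
          using *(7)[of n] unfolding I_def by (simp add: algebra_simps)
        moreover have "\<eta> / 2 * A (v (r n)) \<ge> \<kappa>"
          using vY(2)[of "r n"] eta by (simp add: \<kappa>_def)
        moreover have "\<eta> * \<alpha> n \<ge> \<eta> / 2 * \<alpha> n" using *(3)[of n] eta by simp
        ultimately show ?thesis unfolding right_diff_distrib by linarith
      qed
      moreover have "(\<lambda>n. \<kappa> + (I w - \<eta> / 2 * A w) +
          (e n - l * (\<Gamma> (v (r n)) - \<Gamma> w) - \<eta> / 2 * (A (v (r n)) - \<alpha> n - A w)))
          \<longlonglongrightarrow> \<kappa> + (I w - \<eta> / 2 * A w) + (0 - l * (\<Gamma> w - \<Gamma> w) - \<eta> / 2 * (A w - A w))"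
        by (intro tendsto_intros *)
      ultimately have "\<kappa> + (I w - \<eta> / 2 * A w) + (0 - l * (\<Gamma> w - \<Gamma> w) - \<eta> / 2 * (A w - A w)) \<le> m"
        by (intro LIMSEQ_le[OF _ Il]) auto
      then show False using Aw m\<kappa> by simp
    qed
    moreover have "I w \<le> I u" if "u \<in> Y" "A u \<ge> t" for u
      using Iw mI[of u] that by (simp add: V_def)
    ultimately show "\<exists>w\<in>Y. A w > t \<and> (\<forall>u\<in>Y. A u \<ge> t \<longrightarrow> \<Phi> w - l * \<Gamma> w \<le> \<Phi> u - l * \<Gamma> u)"
      using *(2) by (auto simp: I_def)
  qed
qed

end

section \<open>Fractional Sobolev inequality\<close>

lemma gagliardo_nonneg: "gagliardo s u z \<ge> 0"
  by (cases z) (simp add: gagliardo_def)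

lemma gagliardo_apply:
  fixes u :: "real^'n \<Rightarrow> real"
  shows "gagliardo s u (x, y) = (u x - u y)^2 / norm (x - y) powr (real CARD('n) + 2 * s)"
  by (simp add: gagliardo_def)

lemma gagliardo_measurable [measurable]:
  fixes u :: "real^'n \<Rightarrow> real"
  assumes [measurable]: "u \<in> borel_measurable borel"
  shows "gagliardo s u \<in> borel_measurable borel"
proof -
  have "gagliardo s u = (\<lambda>z. \<bar>u (fst z) - u (snd z)\<bar>^2 / norm (fst z - snd z) powr (real CARD('n) + 2 * s))"
    by (auto simp: gagliardo_def fun_eq_iff)
  also have "\<dots> \<in> borel_measurable (borel \<Otimes>\<^sub>M borel)" by measurable
  finally show ?thesis by (simp add: borel_prod)
qed

text \<open>The integral runs over the whole space, which agrees with \<open>Q_set\<close> for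
  functions vanishing off \<Omega>. Values in \<open>ennreal\<close> allow Tonelli and Fatou before
  finiteness is known.\<close>

definition gag_nn :: "real \<Rightarrow> (real^'n \<Rightarrow> real) \<Rightarrow> ennreal" where
  "gag_nn s u = (\<integral>\<^sup>+z. ennreal (gagliardo s u z) \<partial>lborel)"

lemma nn_integral_lborel_pair:
  fixes f :: "'a::euclidean_space \<times> 'b::euclidean_space \<Rightarrow> ennreal"
  assumes "f \<in> borel_measurable borel"
  shows "(\<integral>\<^sup>+z. f z \<partial>lborel) = (\<integral>\<^sup>+x. \<integral>\<^sup>+y. f (x, y) \<partial>lborel \<partial>lborel)"
  using lborel.nn_integral_fst[of f lborel] assms by (simp add: lborel_prod)

lemma borel_measurable_nn_integral_lborel_pair:
  fixes f :: "'a::euclidean_space \<times> 'b::euclidean_space \<Rightarrow> ennreal"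
  assumes "f \<in> borel_measurable borel"
  shows "(\<lambda>x. \<integral>\<^sup>+y. f (x, y) \<partial>lborel) \<in> borel_measurable borel"
  using lborel.borel_measurable_nn_integral_fst[of f lborel] assms by (simp add: lborel_prod)

text \<open>On a ball around \<open>x\<close> whose volume is twice the Chebyshev bound for \<open>{y. \<bar>v y\<bar> > \<bar>v x\<bar>/2}\<close>,
  half of the points satisfy \<open>\<bar>v x - v y\<bar> \<ge> \<bar>v x\<bar>/2\<close>, which bounds the inner Gagliardo integral from below.\<close>

lemma sobolev_pointwise:
  fixes v :: "real^'n \<Rightarrow> real" and s :: real
  defines "q \<equiv> crit_exp (real CARD('n)) s" and "N \<equiv> real CARD('n)"
  assumes s: "0 < s" and N: "N > 2 * s"
    and v [measurable]: "v \<in> borel_measurable borel"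
    and int: "integrable lborel (\<lambda>x. \<bar>v x\<bar> powr q)"
    and Z: "Z = (\<integral>x. \<bar>v x\<bar> powr q \<partial>lborel)" "Z > 0"
  shows "ennreal (\<bar>v x\<bar> powr q) \<le>
    ennreal (8 / unit_ball_vol N * (2 powr (q + 1) / unit_ball_vol N) powr (2 * s / N) * Z powr (2 * s / N)) *
    (\<integral>\<^sup>+y. ennreal (gagliardo s v (x, y)) \<partial>lborel)"
proof (cases "v x = 0")
  case True then show ?thesis by simp
next
  case False
  define k where "k = unit_ball_vol N"
  define m where "m = \<bar>v x\<bar>"
  have m: "m > 0" using False by (simp add: m_def)
  have Np: "N > 0" using N s by simp
  have k: "k > 0" using Np by (simp add: k_def)
  have qv: "q = 2 * N / (N - 2 * s)" by (simp add: q_def N_def crit_exp_def)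
  have q: "q > 0" using N s by (simp add: qv)
  \<comment> \<open>This identity singles out the critical exponent: m^2 comes from the squared
    difference, and m^(2sq/N) from the radius, which depends on m through the Chebyshev
    bound.\<close>
  have q2: "2 + q * (2 * s / N) = q" using N s Np by (simp add: qv divide_simps)
  define X where "X = 2 powr (q + 1) * Z / (k * m powr q)"
  have X: "X > 0" using Z k m by (simp add: X_def)
  define r where "r = X powr (1 / N)"
  have r: "r > 0" using X by (simp add: r_def)
  have rN: "r ^ CARD('n) = X" using X Np
    by (simp add: r_def N_def powr_powr flip: powr_realpow)
  have kX: "k * X = 2 * (Z * 2 powr q / m powr q)" using k by (simp add: X_def powr_add)
  define Bd where "Bd = {y \<in> ball x r. \<bar>v y\<bar> > m / 2}"
  define H where "H = {y \<in> ball x r. \<bar>v y\<bar> \<le> m / 2}"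
  have [measurable]: "Bd \<in> sets borel" "H \<in> sets borel" unfolding Bd_def H_def by measurable
  have ball: "emeasure lborel (ball x r) = ennreal (k * X)"
    using r rN by (simp add: emeasure_ball k_def N_def)
  have "ennreal ((m / 2) powr q) * emeasure lborel Bd = (\<integral>\<^sup>+y. ennreal ((m / 2) powr q) * indicator Bd y \<partial>lborel)"
    by (simp add: nn_integral_cmult_indicator)
  also have "\<dots> \<le> (\<integral>\<^sup>+y. ennreal (\<bar>v y\<bar> powr q) \<partial>lborel)"
    by (intro nn_integral_mono)
       (auto simp: Bd_def indicator_def intro!: ennreal_leI powr_mono2 less_imp_le[OF q] m[THEN less_imp_le])
  also have "\<dots> = ennreal Z" unfolding Z(1) by (rule nn_integral_eq_integral[OF int]) simp
  finally have markov: "ennreal ((m / 2) powr q) * emeasure lborel Bd \<le> ennreal Z" .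
  have finBd: "emeasure lborel Bd < \<infinity>" "emeasure lborel H < \<infinity>"
    by (rule le_less_trans[OF emeasure_mono[of _ "ball x r"]]; use ball in \<open>auto simp: Bd_def H_def\<close>)+
  have "(m / 2) powr q * measure lborel Bd \<le> Z"
    using markov finBd Z(2) by (simp add: emeasure_eq_ennreal_measure ennreal_mult''[symmetric])
  then have "measure lborel Bd \<le> Z * 2 powr q / m powr q"
    using m by (simp add: powr_divide field_simps)
  then have Bdm: "measure lborel Bd \<le> k * X / 2" using kX by simp
  have "measure lborel (ball x r) = measure lborel Bd + measure lborel H"
  proof -
    have "ball x r = Bd \<union> H" "Bd \<inter> H = {}" by (auto simp: Bd_def H_def)
    then show ?thesis using finBd by (simp add: measure_Un_AE less_top measure_Union)
  qed
  moreover have "measure lborel (ball x r) = k * X" using ball k X by (simp add: measure_def)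
  ultimately have Hm: "measure lborel H \<ge> k * X / 2" using Bdm by simp
  define c where "c = (m / 2)^2 / r powr (N + 2 * s)"
  have c: "c > 0" using m r by (simp add: c_def)
  have le: "ennreal c * indicator H y \<le> ennreal (gagliardo s v (x, y))" for y
  proof (cases "y \<in> H")
    case True
    then have y: "norm (x - y) < r" "\<bar>v y\<bar> \<le> m / 2" by (auto simp: H_def dist_norm)
    have "x \<noteq> y" using y(2) m by (auto simp: m_def)
    then have xy: "norm (x - y) > 0" by simp
    have "m / 2 \<le> \<bar>v x - v y\<bar>" using y(2) unfolding m_def by linarith
    then have "(m / 2)^2 \<le> (v x - v y)^2"
      using m by (intro abs_le_square_iff[THEN iffD1]) auto
    moreover have "norm (x - y) powr (N + 2 * s) \<le> r powr (N + 2 * s)"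
      using y xy s Np by (intro powr_mono2) auto
    ultimately have "c \<le> gagliardo s v (x, y)"
      unfolding c_def gagliardo_apply N_def[symmetric] using xy by (intro frac_le) auto
    then show ?thesis using True by (simp add: ennreal_leI)
  qed simp
  have "ennreal (c * (k * X / 2)) \<le> ennreal (c * measure lborel H)"
    using Hm c by (intro ennreal_leI mult_left_mono) auto
  also have "\<dots> = ennreal c * emeasure lborel H"
    using c finBd by (simp add: emeasure_eq_ennreal_measure ennreal_mult)
  also have "\<dots> = (\<integral>\<^sup>+y. ennreal c * indicator H y \<partial>lborel)" by (simp add: nn_integral_cmult_indicator)
  also have "\<dots> \<le> (\<integral>\<^sup>+y. ennreal (gagliardo s v (x, y)) \<partial>lborel)" by (intro nn_integral_mono le)
  finally have W: "ennreal (c * (k * X / 2)) \<le> (\<integral>\<^sup>+y. ennreal (gagliardo s v (x, y)) \<partial>lborel)" .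
  define C where "C = 8 / k * (2 powr (q + 1) / k) powr (2 * s / N) * Z powr (2 * s / N)"
  have C: "C > 0" using k Z by (simp add: C_def)
  have "r powr (N + 2 * s) = X * X powr (2 * s / N)"
    using r rN X Np by (simp add: powr_add r_def N_def powr_powr flip: powr_realpow)
  then have "C * (c * (k * X / 2)) = C * (m^2 * k / 8) / X powr (2 * s / N)"
    using X by (simp add: c_def power_divide field_simps)
  also have "X powr (2 * s / N) = (2 powr (q + 1) / k) powr (2 * s / N) * Z powr (2 * s / N) / m powr (q * (2 * s / N))"
    using Z k m by (simp add: X_def powr_divide powr_mult powr_powr)
  also have "C * (m^2 * k / 8) / \<dots> = m^2 * m powr (q * (2 * s / N))"
    using Z k m by (simp add: C_def field_simps)
  also have "\<dots> = m powr (2 + q * (2 * s / N))" using m by (simp add: powr_add powr_numeral)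
  finally have "C * (c * (k * X / 2)) = m powr q" unfolding q2 .
  then have "ennreal (m powr q) = ennreal C * ennreal (c * (k * X / 2))"
    using C c k X by (simp add: ennreal_mult[symmetric])
  also have "\<dots> \<le> ennreal C * (\<integral>\<^sup>+y. ennreal (gagliardo s v (x, y)) \<partial>lborel)"
    by (intro mult_left_mono W) auto
  finally show ?thesis by (simp add: C_def k_def m_def)
qed

text \<open>Integrating the pointwise bound over x gives Z <= C0 Z^(2s/N) E. Dividing by Z^(2s/N)
  yields Z^(2/q) <= C0 E, because 1 - 2s/N = 2/q. The division is legitimate only for finite Z,
  which is where integrability enters.\<close>

lemma sobolev_integrable:
  fixes s :: real
  defines "q \<equiv> crit_exp (real CARD('n)) s"
  assumes s: "0 < s" and N: "real CARD('n) > 2 * s"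
  obtains C where "C > 0"
    "\<And>(v :: real^'n \<Rightarrow> real) E. v \<in> borel_measurable borel \<Longrightarrow> integrable lborel (\<lambda>x. \<bar>v x\<bar> powr q) \<Longrightarrow>
       gag_nn s v \<le> ennreal E \<Longrightarrow> E \<ge> 0 \<Longrightarrow> (\<integral>x. \<bar>v x\<bar> powr q \<partial>lborel) \<le> C * E powr (q / 2)"
proof -
  define N where "N = real CARD('n)"
  have Np: "N > 2 * s" "N > 0" using N s by (auto simp: N_def)
  have qv: "q = 2 * N / (N - 2 * s)" by (simp add: q_def N_def crit_exp_def)
  have q: "q > 0" using Np by (simp add: qv)
  define C0 where "C0 = 8 / unit_ball_vol N * (2 powr (q + 1) / unit_ball_vol N) powr (2 * s / N)"
  have C0: "C0 > 0" using Np unit_ball_vol_pos[of N] by (simp add: C0_def del: unit_ball_vol_pos)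
  have ex: "(1 - 2 * s / N) * (q / 2) = 1" "(1 - 2 * s / N) * q / 2 = 1"
    using Np by (simp_all add: qv field_simps)
  show ?thesis
  proof (rule that)
    show "C0 powr (q / 2) > 0" using C0 by simp
    fix v :: "real^'n \<Rightarrow> real" and E :: real
    assume v [measurable]: "v \<in> borel_measurable borel" and int: "integrable lborel (\<lambda>x. \<bar>v x\<bar> powr q)"
      and E: "gag_nn s v \<le> ennreal E" "E \<ge> 0"
    define Z where "Z = (\<integral>x. \<bar>v x\<bar> powr q \<partial>lborel)"
    have Z0: "Z \<ge> 0" by (simp add: Z_def)
    show "(\<integral>x. \<bar>v x\<bar> powr q \<partial>lborel) \<le> C0 powr (q / 2) * E powr (q / 2)"
    proof (cases "Z = 0")
      case True then show ?thesis by (simp add: Z_def)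
    next
      case False
      then have Z: "Z > 0" using Z0 by simp
      have "ennreal Z = (\<integral>\<^sup>+x. ennreal (\<bar>v x\<bar> powr q) \<partial>lborel)"
        unfolding Z_def by (rule nn_integral_eq_integral[symmetric, OF int]) simp
      also have "\<dots> \<le> (\<integral>\<^sup>+x. ennreal (C0 * Z powr (2 * s / N)) *
          (\<integral>\<^sup>+y. ennreal (gagliardo s v (x, y)) \<partial>lborel) \<partial>lborel)"
        using sobolev_pointwise[where v = v and s = s and Z = Z] s N int Z
        by (intro nn_integral_mono) (auto simp: C0_def N_def q_def Z_def)
      also have "\<dots> = ennreal (C0 * Z powr (2 * s / N)) * gag_nn s v"
        unfolding gag_nn_def by (subst nn_integral_cmult)
          (auto simp: nn_integral_lborel_pair intro!: borel_measurable_nn_integral_lborel_pair)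
      also have "\<dots> \<le> ennreal (C0 * Z powr (2 * s / N)) * ennreal E"
        using E by (intro mult_left_mono) auto
      also have "\<dots> = ennreal (C0 * Z powr (2 * s / N) * E)"
        using C0 E by (intro ennreal_mult[symmetric]) auto
      finally have "Z \<le> C0 * Z powr (2 * s / N) * E"
        using C0 E by (subst (asm) ennreal_le_iff) auto
      moreover have "Z = Z powr (1 - 2 * s / N) * Z powr (2 * s / N)"
        using Z by (simp add: powr_add[symmetric])
      ultimately have "Z powr (1 - 2 * s / N) * Z powr (2 * s / N) \<le> (C0 * E) * Z powr (2 * s / N)"
        by (simp add: mult_ac)
      then have "Z powr (1 - 2 * s / N) \<le> C0 * E" using Z by simp
      then have "(Z powr (1 - 2 * s / N)) powr (q / 2) \<le> (C0 * E) powr (q / 2)"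
        using q by (intro powr_mono2) auto
      then show ?thesis using Z C0 E by (simp add: powr_powr ex powr_mult Z_def[symmetric])
    qed
  qed
qed

text \<open>The truncations \<open>T k\<close> are bounded with bounded support, hence q-integrable.
  Truncation is 1-Lipschitz and cannot raise the Gagliardo energy, so the bound for them is uniform
  in k and Fatou carries it to v.\<close>

lemma sobolev:
  fixes s :: real
  defines "q \<equiv> crit_exp (real CARD('n)) s"
  assumes s: "0 < s" and N: "real CARD('n) > 2 * s"
  obtains C where "C > 0"
    "\<And>(v :: real^'n \<Rightarrow> real) E. v \<in> borel_measurable borel \<Longrightarrow> bounded {x. v x \<noteq> 0} \<Longrightarrow>
       gag_nn s v \<le> ennreal E \<Longrightarrow> E \<ge> 0 \<Longrightarrow>
       integrable lborel (\<lambda>x. \<bar>v x\<bar> powr q) \<and> (\<integral>x. \<bar>v x\<bar> powr q \<partial>lborel) \<le> C * E powr (q / 2)"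
proof -
  have q: "q > 0" using s N by (simp add: q_def crit_exp_def)
  obtain C where C: "C > 0"
    "\<And>(v :: real^'n \<Rightarrow> real) E. v \<in> borel_measurable borel \<Longrightarrow> integrable lborel (\<lambda>x. \<bar>v x\<bar> powr q) \<Longrightarrow>
       gag_nn s v \<le> ennreal E \<Longrightarrow> E \<ge> 0 \<Longrightarrow> (\<integral>x. \<bar>v x\<bar> powr q \<partial>lborel) \<le> C * E powr (q / 2)"
    using sobolev_integrable[OF s N] unfolding q_def by blast
  show ?thesis
  proof (rule that[OF C(1)])
    fix v :: "real^'n \<Rightarrow> real" and E :: real
    assume v [measurable]: "v \<in> borel_measurable borel" and bdd: "bounded {x. v x \<noteq> 0}"
      and E: "gag_nn s v \<le> ennreal E" "E \<ge> 0"
    define T where "T = (\<lambda>k x. max (- real k) (min (real k) (v x)))"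
    have [measurable]: "T k \<in> borel_measurable borel" for k unfolding T_def by measurable
    obtain R where R: "{x. v x \<noteq> 0} \<subseteq> ball 0 R" using bounded_subset_ballD[OF bdd] by auto
    have intT: "integrable lborel (\<lambda>x. \<bar>T k x\<bar> powr q)" for k
    proof (rule Bochner_Integration.integrable_bound[where f = "\<lambda>x. real k powr q * indicator (ball 0 R) x"])
      show "integrable lborel (\<lambda>x::real^'n. real k powr q * indicator (ball 0 R) x)"
        using emeasure_bounded_finite[of "ball (0::real^'n) R"]
        by (intro integrable_mult_right integrable_real_indicator) auto
      have "\<bar>T k x\<bar> powr q \<le> real k powr q * indicator (ball 0 R) x" for x
      proof (cases "v x = 0")
        case False
        then have "x \<in> ball 0 R" using R by auto
        then show ?thesis using q by (auto simp: T_def intro!: powr_mono2)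
      qed (simp add: T_def)
      then show "AE x in lborel. norm (\<bar>T k x\<bar> powr q) \<le> norm (real k powr q * indicator (ball 0 R) x)"
        by simp
    qed simp
    have "gag_nn s (T k) \<le> gag_nn s v" for k unfolding gag_nn_def
    proof (intro nn_integral_mono ennreal_leI)
      fix z :: "(real^'n) \<times> (real^'n)"
      have "\<bar>T k (fst z) - T k (snd z)\<bar> \<le> \<bar>v (fst z) - v (snd z)\<bar>"
        unfolding T_def by (simp add: max_def min_def)
      then have "\<bar>T k (fst z) - T k (snd z)\<bar>^2 \<le> \<bar>v (fst z) - v (snd z)\<bar>^2"
        by (intro power_mono) auto
      then show "gagliardo s (T k) z \<le> gagliardo s v z"
        by (simp add: gagliardo_def split_beta divide_right_mono del: power2_abs)
    qed
    then have b: "(\<integral>x. \<bar>T k x\<bar> powr q \<partial>lborel) \<le> C * E powr (q / 2)" for k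
      using C(2)[of "T k" E] intT E by (meson \<open>\<And>k. T k \<in> borel_measurable borel\<close> order_trans)
    have le: "(\<integral>\<^sup>+x. ennreal (\<bar>v x\<bar> powr q) \<partial>lborel) \<le> ennreal (C * E powr (q / 2))"
    proof (rule nn_integral_limit_le)
      show "AE x in lborel. (\<lambda>k. \<bar>T k x\<bar> powr q) \<longlonglongrightarrow> \<bar>v x\<bar> powr q"
      proof (rule AE_I2)
        fix x
        obtain k0 where "\<bar>v x\<bar> \<le> real k0" using real_arch_simple by blast
        then have "\<forall>k\<ge>k0. T k x = v x" by (auto simp: T_def)
        then show "(\<lambda>k. \<bar>T k x\<bar> powr q) \<longlonglongrightarrow> \<bar>v x\<bar> powr q"
          by (intro tendsto_eventually) (auto simp: eventually_sequentially intro!: exI[of _ k0])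
      qed
      show "(\<integral>\<^sup>+x. ennreal (\<bar>T k x\<bar> powr q) \<partial>lborel) \<le> ennreal (C * E powr (q / 2))" for k
        using b[of k] intT[of k] by (subst nn_integral_eq_integral) (auto intro!: ennreal_leI)
    qed measurable
    have int: "integrable lborel (\<lambda>x. \<bar>v x\<bar> powr q)"
      by (rule integrableI_nn_integral_le[OF _ _ le]) auto
    then show "integrable lborel (\<lambda>x. \<bar>v x\<bar> powr q) \<and> (\<integral>x. \<bar>v x\<bar> powr q \<partial>lborel) \<le> C * E powr (q / 2)"
      using C(2)[OF v int E] by simp
  qed
qed

section \<open>Compactness by dyadic averages\<close>

definition dyadic_index :: "nat \<Rightarrow> real^'n \<Rightarrow> int^'n" where
  "dyadic_index j x = (\<chi> i. \<lfloor>2 ^ j * x $ i\<rfloor>)"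

definition dyadic_cube :: "nat \<Rightarrow> int^'n \<Rightarrow> (real^'n) set" where
  "dyadic_cube j k = {x. dyadic_index j x = k}"

text \<open>The mean over the cube of side 2^(-j) containing x; the prefactor is the reciprocal of
  the volume. For all j together it depends on v through countably many integrals only, which
  permits a diagonal argument.\<close>

definition dyadic_average :: "nat \<Rightarrow> (real^'n \<Rightarrow> real) \<Rightarrow> real^'n \<Rightarrow> real" where
  "dyadic_average j v x =
    (2 ^ j) ^ CARD('n) * (\<integral>y. indicator (dyadic_cube j (dyadic_index j x)) y * v y \<partial>lborel)"

lemma dyadic_cube_iff:
  "x \<in> dyadic_cube j k \<longleftrightarrow> (\<forall>i. of_int (k $ i) \<le> 2 ^ j * x $ i \<and> 2 ^ j * x $ i < of_int (k $ i) + 1)"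
  by (simp add: dyadic_cube_def dyadic_index_def vec_eq_iff floor_eq_iff)

lemma dyadic_cube_borel [measurable]: "dyadic_cube j k \<in> sets borel"
proof -
  have "dyadic_cube j k = {x. \<forall>i. of_int (k $ i) \<le> 2 ^ j * x $ i \<and> 2 ^ j * x $ i < of_int (k $ i) + 1}"
    by (auto simp: dyadic_cube_iff)
  also have "\<dots> = (\<Inter>i. {x. of_int (k $ i) \<le> 2 ^ j * x $ i} \<inter> {x. 2 ^ j * x $ i < of_int (k $ i) + 1})"
    by auto
  also have "\<dots> \<in> sets borel"
    by (intro sets.countable_INT'' sets.Int borel_closed borel_open closed_Collect_le open_Collect_less continuous_intros)
       auto
  finally show ?thesis .
qed

lemma emeasure_dyadic_cube:
  fixes k :: "int^'n"
  shows "emeasure lborel (dyadic_cube j k) = ennreal ((1 / 2 ^ j) ^ CARD('n))"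
proof -
  define l :: "real^'n" where "l = (\<chi> i. of_int (k $ i) / 2 ^ j)"
  define u :: "real^'n" where "u = (\<chi> i. (of_int (k $ i) + 1) / 2 ^ j)"
  have d: "(u - l) \<bullet> b = 1 / 2 ^ j" if "b \<in> Basis" for b
    using that by (auto simp: Basis_vec_def inner_axis l_def u_def diff_divide_distrib[symmetric])
  have ul: "l \<bullet> b \<le> u \<bullet> b" if "b \<in> Basis" for b
    using d[OF that] by (simp add: inner_diff_left) (smt (verit) zero_less_divide_1_iff zero_less_power)
  have P: "(\<Prod>b\<in>Basis. (u - l) \<bullet> b) = (1 / 2 ^ j) ^ CARD('n)" using d by simp
  have "box l u \<subseteq> dyadic_cube j k" "dyadic_cube j k \<subseteq> cbox l u"
    by (auto simp: dyadic_cube_iff mem_box_cart l_def u_def field_simps less_imp_le)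
  then have "emeasure lborel (box l u) \<le> emeasure lborel (dyadic_cube j k)"
    "emeasure lborel (dyadic_cube j k) \<le> emeasure lborel (cbox l u)"
    by (intro emeasure_mono; simp)+
  then show ?thesis using ul P by (simp add: emeasure_lborel_box emeasure_lborel_cbox)
qed

lemma dyadic_cube_diameter:
  fixes x y :: "real^'n"
  assumes "x \<in> dyadic_cube j k" "y \<in> dyadic_cube j k"
  shows "norm (x - y) \<le> real CARD('n) / 2 ^ j"
proof -
  have le: "\<bar>(x - y) $ i\<bar> \<le> 1 / 2 ^ j" for i
  proof -
    have "of_int (k $ i) \<le> 2 ^ j * x $ i" "2 ^ j * x $ i < of_int (k $ i) + 1"
      "of_int (k $ i) \<le> 2 ^ j * y $ i" "2 ^ j * y $ i < of_int (k $ i) + 1"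
      using assms by (auto simp: dyadic_cube_iff)
    then have "\<bar>2 ^ j * x $ i - 2 ^ j * y $ i\<bar> \<le> 1" by linarith
    then have "2 ^ j * \<bar>(x - y) $ i\<bar> \<le> 1"
      by (simp add: abs_mult flip: right_diff_distrib)
    then show ?thesis by (simp add: field_simps)
  qed
  have "norm (x - y) \<le> (\<Sum>i\<in>UNIV. \<bar>(x - y) $ i\<bar>)" by (rule norm_le_l1_cart)
  also have "\<dots> \<le> (\<Sum>i\<in>(UNIV :: 'n set). 1 / 2 ^ j)" by (intro sum_mono le)
  finally show ?thesis by simp
qed

lemma dyadic_index_measurable [measurable]:
  "dyadic_index j \<in> measurable borel (count_space (UNIV :: (int^'n) set))"
proof -
  have "dyadic_index j -` {k} = dyadic_cube j k" for k :: "int^'n" by (auto simp: dyadic_cube_def)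
  then show ?thesis by (simp add: measurable_count_space_eq2_countable)
qed

lemma dyadic_average_measurable [measurable]:
  fixes v :: "real^'n \<Rightarrow> real"
  shows "dyadic_average j v \<in> borel_measurable borel"
proof -
  have "(\<lambda>x. (\<lambda>k x. (2 ^ j) ^ CARD('n) * (\<integral>y. indicator (dyadic_cube j k) y * v y \<partial>lborel)) (dyadic_index j x) x)
      \<in> borel_measurable borel"
    by (rule measurable_compose_countable) measurable
  then show ?thesis by (simp add: dyadic_average_def[abs_def])
qed

text \<open>v x minus the average is the mean of v x - v y over the cube. With t = |v x - v y|, t <=
  \<tau>/2 + t^2/(2\<tau>) passes from the linear error to the quadratic energy, and t^2 is at most
  the Gagliardo quotient times the (N + 2s)-th power of a bound for the cube's diameter.\<close>

lemma dyadic_average_error_pointwise: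
  fixes v :: "real^'n \<Rightarrow> real"
  assumes v [measurable]: "v \<in> borel_measurable borel" and int: "integrable lborel v"
    and s: "s > 0" and \<tau>: "\<tau> > 0"
  shows "ennreal \<bar>v x - dyadic_average j v x\<bar> \<le> ennreal (\<tau> / 2) +
     ennreal ((2 ^ j) ^ CARD('n) * (real CARD('n) / 2 ^ j) powr (real CARD('n) + 2 * s) / (2 * \<tau>)) *
       (\<integral>\<^sup>+y. ennreal (gagliardo s v (x, y)) \<partial>lborel)"
proof -
  define D where "D = (2 ^ j :: real) ^ CARD('n)"
  define d where "d = real CARD('n) / 2 ^ j"
  define p where "p = real CARD('n) + 2 * s"
  define Q where "Q = dyadic_cube j (dyadic_index j x)"
  have [measurable]: "Q \<in> sets borel" by (simp add: Q_def)
  have D: "D > 0" by (simp add: D_def)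
  have d: "d > 0" by (simp add: d_def)
  have xQ: "x \<in> Q" by (simp add: Q_def dyadic_cube_def)
  have mQ: "emeasure lborel Q = ennreal (1 / D)"
    by (simp add: Q_def D_def emeasure_dyadic_cube power_one_over)
  have iQ: "integrable lborel (\<lambda>y. indicator Q y :: real)"
    using mQ by (intro integrable_real_indicator) auto
  have iv: "integrable lborel (\<lambda>y. indicator Q y * v y)"
    by (rule Bochner_Integration.integrable_bound[OF int]) (auto simp: indicator_def)
  have "v x = D * (\<integral>y. indicator Q y * v x \<partial>lborel)"
    using D mQ iQ by (simp add: measure_def)
  then have eq: "v x - dyadic_average j v x = D * (\<integral>y. indicator Q y * (v x - v y) \<partial>lborel)"
    using iv iQ by (simp add: dyadic_average_def Q_def[symmetric] D_def[symmetric] right_diff_distrib)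
  have iD: "integrable lborel (\<lambda>y. indicator Q y * (v x - v y))"
    using iv iQ by (simp add: right_diff_distrib)
  have le: "ennreal \<bar>indicator Q y * (v x - v y)\<bar> \<le>
     ennreal (\<tau> / 2) * indicator Q y + ennreal (d powr p / (2 * \<tau>)) * ennreal (gagliardo s v (x, y))" for y
  proof (cases "y \<in> Q")
    case True
    define t where "t = \<bar>v x - v y\<bar>"
    have t2: "t^2 \<le> d powr p * gagliardo s v (x, y)"
    proof (cases "x = y")
      case False
      then have n: "norm (x - y) > 0" by simp
      have "norm (x - y) powr p \<le> d powr p"
        using dyadic_cube_diameter[of x j _ y] xQ True n s unfolding Q_def d_def p_def
        by (intro powr_mono2) auto
      then have "norm (x - y) powr p * gagliardo s v (x, y) \<le> d powr p * gagliardo s v (x, y)"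
        by (intro mult_right_mono gagliardo_nonneg)
      moreover have "norm (x - y) powr p * gagliardo s v (x, y) = t^2"
        using n by (simp add: gagliardo_apply p_def t_def)
      ultimately show ?thesis by simp
    qed (simp add: t_def gagliardo_nonneg)
    have "0 \<le> (t - \<tau>)^2" by simp
    then have "t \<le> \<tau> / 2 + t^2 / (2 * \<tau>)"
      using \<tau> by (simp add: power2_eq_square field_simps)
    also have "\<dots> \<le> \<tau> / 2 + d powr p * gagliardo s v (x, y) / (2 * \<tau>)"
      using t2 \<tau> by (simp add: divide_right_mono)
    finally have "ennreal t \<le> ennreal (\<tau> / 2 + d powr p / (2 * \<tau>) * gagliardo s v (x, y))"
      by (intro ennreal_leI) simp
    also have "\<dots> = ennreal (\<tau> / 2) + ennreal (d powr p / (2 * \<tau>)) * ennreal (gagliardo s v (x, y))"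
      using \<tau> by (simp add: ennreal_mult[symmetric] ennreal_plus[symmetric] gagliardo_nonneg del: ennreal_plus)
    finally show ?thesis using True by (simp add: t_def)
  qed simp
  have gm: "(\<lambda>y. ennreal (gagliardo s v (x, y))) \<in> borel_measurable borel"
    by (simp add: gagliardo_apply)
  have "ennreal \<bar>v x - dyadic_average j v x\<bar> = ennreal D * ennreal (norm (\<integral>y. indicator Q y * (v x - v y) \<partial>lborel))"
    unfolding eq using D by (simp add: abs_mult ennreal_mult)
  also have "\<dots> \<le> ennreal D * (\<integral>\<^sup>+y. ennreal (norm (indicator Q y * (v x - v y))) \<partial>lborel)"
    by (intro mult_left_mono integral_norm_bound_ennreal iD) auto
  also have "\<dots> \<le> ennreal D * (\<integral>\<^sup>+y. ennreal (\<tau> / 2) * indicator Q y + ennreal (d powr p / (2 * \<tau>)) * ennreal (gagliardo s v (x, y)) \<partial>lborel)"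
    using le by (intro mult_left_mono nn_integral_mono) auto
  also have "\<dots> = ennreal D * (ennreal (\<tau> / 2) * ennreal (1 / D) + ennreal (d powr p / (2 * \<tau>)) * (\<integral>\<^sup>+y. ennreal (gagliardo s v (x, y)) \<partial>lborel))"
    using gm by (subst nn_integral_add) (auto simp: nn_integral_cmult nn_integral_cmult_indicator mQ)
  also have "\<dots> = ennreal (\<tau> / 2) + ennreal (D * d powr p / (2 * \<tau>)) * (\<integral>\<^sup>+y. ennreal (gagliardo s v (x, y)) \<partial>lborel)"
    using D \<tau> by (simp add: distrib_left ennreal_mult[symmetric] mult.assoc[symmetric])
  finally show ?thesis by (simp add: D_def d_def p_def)
qed

text \<open>For fixed \<tau> the second term decays like 2^(-2sj) and depends on v only through E;
  the first is small with \<tau> because \<Omega> has finite measure.\<close>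

lemma dyadic_average_error:
  fixes v :: "real^'n \<Rightarrow> real"
  assumes v [measurable]: "v \<in> borel_measurable borel" and int: "integrable lborel v"
    and s: "s > 0" and \<tau>: "\<tau> > 0" and E: "gag_nn s v \<le> ennreal E" "E \<ge> 0"
    and \<Omega> [measurable]: "\<Omega> \<in> sets borel" and fin: "emeasure lborel \<Omega> < \<infinity>"
  shows "integrable lborel (\<lambda>x. indicator \<Omega> x * \<bar>v x - dyadic_average j v x\<bar>)"
    and "(\<integral>x. indicator \<Omega> x * \<bar>v x - dyadic_average j v x\<bar> \<partial>lborel) \<le> \<tau> / 2 * measure lborel \<Omega> +
     (2 ^ j) ^ CARD('n) * (real CARD('n) / 2 ^ j) powr (real CARD('n) + 2 * s) / (2 * \<tau>) * E"
proof -
  define K where "K = (2 ^ j) ^ CARD('n) * (real CARD('n) / 2 ^ j) powr (real CARD('n) + 2 * s) / (2 * \<tau>)"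
  have K: "K \<ge> 0" using \<tau> by (simp add: K_def)
  have "(\<integral>\<^sup>+x. ennreal (indicator \<Omega> x * \<bar>v x - dyadic_average j v x\<bar>) \<partial>lborel) \<le>
    (\<integral>\<^sup>+x. ennreal (\<tau> / 2) * indicator \<Omega> x + ennreal K * (\<integral>\<^sup>+y. ennreal (gagliardo s v (x, y)) \<partial>lborel) \<partial>lborel)"
    using dyadic_average_error_pointwise[OF v int s \<tau>, of _ j]
    by (intro nn_integral_mono) (auto simp: indicator_def K_def)
  also have "\<dots> = ennreal (\<tau> / 2) * emeasure lborel \<Omega> + ennreal K * gag_nn s v"
    unfolding gag_nn_def
    by (subst nn_integral_add)
       (auto simp: nn_integral_cmult nn_integral_cmult_indicator nn_integral_lborel_pair
          borel_measurable_nn_integral_lborel_pair)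
  also have "\<dots> \<le> ennreal (\<tau> / 2) * emeasure lborel \<Omega> + ennreal K * ennreal E"
    using E by (intro add_left_mono mult_left_mono) auto
  also have "\<dots> = ennreal (\<tau> / 2 * measure lborel \<Omega> + K * E)"
    using \<tau> K E fin
    by (simp add: emeasure_eq_ennreal_measure ennreal_mult[symmetric] ennreal_plus[symmetric] del: ennreal_plus)
  finally have le: "(\<integral>\<^sup>+x. ennreal (indicator \<Omega> x * \<bar>v x - dyadic_average j v x\<bar>) \<partial>lborel) \<le>
    ennreal (\<tau> / 2 * measure lborel \<Omega> + K * E)" .
  show i: "integrable lborel (\<lambda>x. indicator \<Omega> x * \<bar>v x - dyadic_average j v x\<bar>)"
    by (rule integrableI_nn_integral_le[OF _ _ le]) auto
  have "0 \<le> \<tau> / 2 * measure lborel \<Omega> + K * E" using \<tau> K E by simp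
  with le i show "(\<integral>x. indicator \<Omega> x * \<bar>v x - dyadic_average j v x\<bar> \<partial>lborel) \<le> \<tau> / 2 * measure lborel \<Omega> +
     (2 ^ j) ^ CARD('n) * (real CARD('n) / 2 ^ j) powr (real CARD('n) + 2 * s) / (2 * \<tau>) * E"
    by (simp add: nn_integral_eq_integral K_def[symmetric])
qed

lemma AE_lborel_pair:
  assumes "AE x in (lborel :: 'a::euclidean_space measure). P x"
  shows "AE z in (lborel :: ('a \<times> 'a) measure). P (fst z) \<and> P (snd z)"
proof -
  obtain N :: "'a set" where N: "{x. \<not> P x} \<subseteq> N" "N \<in> null_sets lborel"
    using assms by (auto elim!: AE_E simp: null_sets_def)
  have Nb: "N \<in> sets borel" using N(2) by auto
  have "emeasure (lborel \<Otimes>\<^sub>M lborel) (N \<times> (UNIV :: 'a set)) = emeasure lborel N * emeasure lborel (UNIV :: 'a set)"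
    using Nb by (intro lborel.emeasure_pair_measure_Times) auto
  moreover have "emeasure (lborel \<Otimes>\<^sub>M lborel) ((UNIV :: 'a set) \<times> N) = emeasure lborel (UNIV :: 'a set) * emeasure lborel N"
    using Nb by (intro lborel.emeasure_pair_measure_Times) auto
  ultimately have "N \<times> (UNIV :: 'a set) \<in> null_sets (lborel \<Otimes>\<^sub>M lborel)"
    "(UNIV :: 'a set) \<times> N \<in> null_sets (lborel \<Otimes>\<^sub>M lborel)"
    using N(2) Nb by (auto simp: null_sets_def)
  then have "(N \<times> UNIV) \<union> (UNIV \<times> N) \<in> null_sets (lborel :: ('a \<times> 'a) measure)"
    unfolding lborel_prod[symmetric] by (rule null_sets.Un)
  then show ?thesis by (rule AE_I') (use N(1) in auto)
qed

lemma gag_nn_limit: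
  fixes v :: "nat \<Rightarrow> real^'n \<Rightarrow> real"
  assumes [measurable]: "\<And>n. v n \<in> borel_measurable borel" "w \<in> borel_measurable borel"
    and lim: "AE x in lborel. (\<lambda>n. v n x) \<longlonglongrightarrow> w x"
    and E: "\<And>n. gag_nn s (v n) \<le> ennreal E"
  shows "gag_nn s w \<le> ennreal E"
  unfolding gag_nn_def
proof (rule nn_integral_limit_le)
  show "AE z in lborel. (\<lambda>n. gagliardo s (v n) z) \<longlonglongrightarrow> gagliardo s w z"
    using AE_lborel_pair[OF lim]
  proof eventually_elim
    case (elim z)
    then show ?case
      unfolding gagliardo_def split_beta divide_inverse by (intro tendsto_intros) auto
  qed
qed (use E in \<open>auto simp: gag_nn_def\<close>)

text \<open>A Rellich argument. Along one subsequence the averages at every scale converge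
  pointwise. They approximate the functions in L^1(\<Omega>) uniformly in n, so the subsequence is
  Cauchy in L^1, and a further subsequence converges almost everywhere.\<close>

lemma gagliardo_compactness:
  fixes v :: "nat \<Rightarrow> real^'n \<Rightarrow> real"
  assumes s: "s > 0" and \<Omega> [measurable]: "\<Omega> \<in> sets borel" and fin: "emeasure lborel \<Omega> < \<infinity>"
    and v [measurable]: "\<And>n. v n \<in> borel_measurable borel"
    and supp: "\<And>n x. x \<notin> \<Omega> \<Longrightarrow> v n x = 0"
    and int: "\<And>n. integrable lborel (v n)" and L: "\<And>n. (\<integral>x. \<bar>v n x\<bar> \<partial>lborel) \<le> L"
    and E: "\<And>n. gag_nn s (v n) \<le> ennreal E" "E \<ge> 0"
  obtains r w where "strict_mono r" "w \<in> borel_measurable borel" "\<And>x. x \<notin> \<Omega> \<Longrightarrow> w x = 0"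
    "AE x in lborel. (\<lambda>n. v (r n) x) \<longlonglongrightarrow> w x" "gag_nn s w \<le> ennreal E"
proof -
  define N where "N = real CARD('n)"
  define m where "m = measure lborel \<Omega>"
  have m: "m \<ge> 0" by (simp add: m_def)
  have iQ: "integrable lborel (\<lambda>y. indicator (dyadic_cube j k) y * v n y)" for n j k
    by (rule Bochner_Integration.integrable_bound[OF int[of n]]) (auto simp: indicator_def)
  \<comment> \<open>All integrals over all cubes of all scales: a bounded sequence of functions on a
    countable set, to which diagonal extraction applies.\<close>
  define a where "a = (\<lambda>n (j, k). \<integral>y. indicator (dyadic_cube j k) y * v n y \<partial>lborel)"
  have aL: "norm (a n jk) \<le> L" for n jk
  proof (cases jk)
    case (Pair j k)
    have "norm (a n jk) \<le> (\<integral>y. norm (indicator (dyadic_cube j k) y * v n y) \<partial>lborel)"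
      unfolding a_def Pair prod.case by (rule integral_norm_bound)
    also have "\<dots> \<le> (\<integral>y. \<bar>v n y\<bar> \<partial>lborel)"
      by (rule integral_mono) (use iQ int in \<open>auto simp: indicator_def\<close>)
    finally show ?thesis using L[of n] by simp
  qed
  obtain r1 where r1: "strict_mono (r1::nat\<Rightarrow>nat)" "\<And>jk. \<exists>l. (\<lambda>n. a (r1 n) jk) \<longlonglongrightarrow> l"
    using function_convergent_subsequence[of "UNIV :: (nat \<times> (int^'n)) set" a L] aL by auto
  then obtain l where l: "\<And>jk. (\<lambda>n. a (r1 n) jk) \<longlonglongrightarrow> l jk" by metis
  define w where "w = (\<lambda>n. v (r1 n))"
  have w [measurable]: "w n \<in> borel_measurable borel" and wi: "integrable lborel (w n)" for n
    using int by (auto simp: w_def)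
  have avg: "dyadic_average j (w n) x = (2 ^ j) ^ CARD('n) * a (r1 n) (j, dyadic_index j x)" for j n x
    by (simp add: dyadic_average_def a_def w_def)
  have ind_fin: "integrable lborel (\<lambda>x. indicator \<Omega> x :: real)" using fin by simp
  have cauchy: "\<exists>M. \<forall>i\<ge>M. \<forall>i'\<ge>M. LINT x|lborel. norm (w i x - w i' x) < e" if e: "e > 0" for e
  proof -
    \<comment> \<open>Each of the two parts of the averaging error is at most e/16, so an average
      misses its function by at most e/8; two such errors and two distances below e/4 to the limit
      of the averages stay below e.\<close>
    define \<tau> where "\<tau> = e / (8 * (m + 1))"
    have \<tau>: "\<tau> > 0" using e m by (simp add: \<tau>_def)
    have \<tau>m: "\<tau> / 2 * m \<le> e / 16" using e m by (simp add: \<tau>_def field_simps)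
    have "(\<lambda>j. N powr (N + 2 * s) / (2 * \<tau>) * E * ((1 / 2) powr (2 * s)) ^ j) \<longlonglongrightarrow>
        N powr (N + 2 * s) / (2 * \<tau>) * E * 0"
      using s by (intro tendsto_intros LIMSEQ_realpow_zero) (auto simp: powr01_less_one)
    then have "\<forall>\<^sub>F j in sequentially. N powr (N + 2 * s) / (2 * \<tau>) * E * ((1 / 2) powr (2 * s)) ^ j < e / 16"
      using e by (intro order_tendstoD) auto
    then obtain j where j: "N powr (N + 2 * s) / (2 * \<tau>) * E * ((1 / 2) powr (2 * s)) ^ j < e / 16"
      by (auto simp: eventually_sequentially)
    define D where "D = (2 ^ j :: real) ^ CARD('n)"
    have DN: "D = (2 ^ j) powr N" by (simp add: D_def N_def powr_realpow)
    have "D * (N / 2 ^ j) powr (N + 2 * s) / (2 * \<tau>) * E = N powr (N + 2 * s) / (2 * \<tau>) * E * (1 / (2 ^ j) powr (2 * s))"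
      by (simp add: DN powr_divide powr_add N_def)
    also have "1 / (2 ^ j) powr (2 * s) = ((1 / 2) powr (2 * s)) ^ j"
      by (simp add: powr_divide power_one_over powr_realpow[symmetric] powr_powr mult.commute)
    finally have err2: "D * (N / 2 ^ j) powr (N + 2 * s) / (2 * \<tau>) * E < e / 16" using j by (simp only:)
    have err: "integrable lborel (\<lambda>x. indicator \<Omega> x * \<bar>w n x - dyadic_average j (w n) x\<bar>)"
       "(\<integral>x. indicator \<Omega> x * \<bar>w n x - dyadic_average j (w n) x\<bar> \<partial>lborel) \<le> e / 8" for n
    proof -
      have "gag_nn s (w n) \<le> ennreal E" using E by (simp add: w_def)
      note * = dyadic_average_error[OF w wi s \<tau> this E(2) \<Omega> fin, of j]
      show "integrable lborel (\<lambda>x. indicator \<Omega> x * \<bar>w n x - dyadic_average j (w n) x\<bar>)" by (rule *(1))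
      show "(\<integral>x. indicator \<Omega> x * \<bar>w n x - dyadic_average j (w n) x\<bar> \<partial>lborel) \<le> e / 8"
        using *(2) \<tau>m err2 unfolding m_def D_def N_def by linarith
    qed
    define h where "h = (\<lambda>x. D * l (j, dyadic_index j x))"
    have avg_lim: "(\<lambda>n. dyadic_average j (w n) x) \<longlonglongrightarrow> h x" for x
      unfolding avg h_def D_def by (intro tendsto_intros l)
    have hm [measurable]: "h \<in> borel_measurable borel"
      by (rule borel_measurable_LIMSEQ_real[OF avg_lim]) simp
    have avb: "\<bar>dyadic_average j (w n) x\<bar> \<le> D * L" for n x
      using aL[of "r1 n" "(j, dyadic_index j x)"] by (simp add: avg abs_mult D_def)
    have hb: "\<bar>h x\<bar> \<le> D * L" for x
      by (rule LIMSEQ_le_const2[OF tendsto_rabs[OF avg_lim]]) (use avb in auto)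
    define g where "g = (\<lambda>n x. indicator \<Omega> x * \<bar>dyadic_average j (w n) x - h x\<bar>)"
    have [measurable]: "g n \<in> borel_measurable borel" for n unfolding g_def by measurable
    have gb: "norm (g n x) \<le> 2 * (D * L) * indicator \<Omega> x" for n x
      using avb[of n x] hb[of x] by (auto simp: g_def indicator_def)
    have gi: "integrable lborel (g n)" for n
      by (rule Bochner_Integration.integrable_bound[where f = "\<lambda>x. 2 * (D * L) * indicator \<Omega> x"])
         (use ind_fin gb in \<open>auto intro!: AE_I2 order_trans[OF _ abs_ge_self]\<close>)
    have "(\<lambda>n. \<integral>x. g n x \<partial>lborel) \<longlonglongrightarrow> integral\<^sup>L lborel (\<lambda>x::real^'n. 0)"
    proof (rule integral_dominated_convergence)
      show "AE x in lborel. (\<lambda>n. g n x) \<longlonglongrightarrow> 0"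
      proof (rule AE_I2)
        fix x
        have "(\<lambda>n. g n x) \<longlonglongrightarrow> indicator \<Omega> x * \<bar>h x - h x\<bar>"
          unfolding g_def by (intro tendsto_intros avg_lim)
        then show "(\<lambda>n. g n x) \<longlonglongrightarrow> 0" by simp
      qed
      show "integrable lborel (\<lambda>x. 2 * (D * L) * indicator \<Omega> x)" using ind_fin by simp
    qed (use gb in auto)
    then have "\<forall>\<^sub>F n in sequentially. (\<integral>x. g n x \<partial>lborel) < e / 4"
      using e by (intro order_tendstoD) auto
    then obtain M where M: "\<And>n. n \<ge> M \<Longrightarrow> (\<integral>x. g n x \<partial>lborel) < e / 4"
      by (auto simp: eventually_sequentially)
    have "LINT x|lborel. norm (w i x - w i' x) < e" if "i \<ge> M" "i' \<ge> M" for i i'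
    proof -
      define A where "A = (\<lambda>n x. indicator \<Omega> x * \<bar>w n x - dyadic_average j (w n) x\<bar>)"
      have "LINT x|lborel. norm (w i x - w i' x) \<le> (\<integral>x. (A i x + A i' x) + (g i x + g i' x) \<partial>lborel)"
      proof (rule integral_mono)
        show "integrable lborel (\<lambda>x. A i x + A i' x + (g i x + g i' x))"
          using err(1) gi by (simp add: A_def)
        show "norm (w i x - w i' x) \<le> A i x + A i' x + (g i x + g i' x)" for x
          using supp[of x] by (cases "x \<in> \<Omega>") (auto simp: A_def g_def w_def)
      qed (use wi in auto)
      also have "\<dots> = ((\<integral>x. A i x \<partial>lborel) + (\<integral>x. A i' x \<partial>lborel)) + ((\<integral>x. g i x \<partial>lborel) + (\<integral>x. g i' x \<partial>lborel))"
        using err(1) gi by (simp add: A_def)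
      also have "\<dots> < e" using err(2)[of i] err(2)[of i'] M[OF that(1)] M[OF that(2)] e by (simp add: A_def)
      finally show ?thesis .
    qed
    then show ?thesis by blast
  qed
  obtain r2 where r2: "strict_mono r2" "AE x in lborel. Cauchy (\<lambda>i. w (r2 i) x)"
    using cauchy_L1_AE_cauchy_subseq[of lborel w] wi cauchy by blast
  define u where "u = (\<lambda>x. lim (\<lambda>n. v (r1 (r2 n)) x))"
  have um [measurable]: "u \<in> borel_measurable borel" unfolding u_def by (rule borel_measurable_lim_metric) simp
  have ul: "AE x in lborel. (\<lambda>n. v (r1 (r2 n)) x) \<longlonglongrightarrow> u x"
    using r2(2) by eventually_elim
      (auto simp: u_def w_def real_Cauchy_convergent convergent_LIMSEQ_iff[symmetric])
  show ?thesis
  proof (rule that)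
    show "strict_mono (\<lambda>n. r1 (r2 n))" using strict_mono_o[OF r1(1) r2(1)] by (simp add: o_def)
    show "u x = 0" if "x \<notin> \<Omega>" for x using supp[OF that] by (simp add: u_def)
    show "gag_nn s u \<le> ennreal E"
      by (rule gag_nn_limit[OF _ um ul E(1)]) simp
  qed (fact um ul)+
qed

section \<open>A bump function of finite Gagliardo energy\<close>

lemma ex_dyadic_bracket:
  fixes R :: real
  assumes "R \<ge> 1"
  obtains k :: nat where "2 ^ k \<le> R" "R < 2 ^ Suc k"
proof -
  define k where "k = nat \<lfloor>log 2 R\<rfloor>"
  have "log 2 R \<ge> 0" using assms by simp
  then have "real k \<le> log 2 R" "log 2 R < real k + 1" by (auto simp: k_def)
  then have "2 powr real k \<le> R" "R < 2 powr (real k + 1)"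
    using assms by (auto simp: le_log_iff log_less_iff)
  then show ?thesis using that[of k] by (simp add: powr_realpow powr_add)
qed

lemma ennreal_le_suminf:
  fixes f :: "nat \<Rightarrow> ennreal"
  shows "f k \<le> (\<Sum>k. f k)"
  using sum_le_suminf[of f "{k}"] by simp

text \<open>The function is dominated by the sum of \<open>c k\<close> times the indicator of the
  k-th ball, so the summability hypothesis on volumes replaces polar coordinates.\<close>

lemma dyadic_radial_integral_finite:
  fixes c \<rho> :: "nat \<Rightarrow> real"
  assumes "summable (\<lambda>k. c k * \<rho> k ^ CARD('n))" "\<And>k. c k \<ge> 0" "\<And>k. \<rho> k \<ge> 0"
    and h: "\<And>z :: real^'n. h z \<noteq> 0 \<Longrightarrow> \<exists>k. h z \<le> c k \<and> z \<in> ball 0 (\<rho> k)"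
  shows "(\<integral>\<^sup>+z. ennreal (h z) \<partial>lborel) < \<infinity>"
proof -
  define V where "V = unit_ball_vol (real CARD('n))"
  have V: "V \<ge> 0" by (simp add: V_def)
  have [measurable]: "ball (0::real^'n) r \<in> sets borel" for r by simp
  have "(\<integral>\<^sup>+z. ennreal (h z) \<partial>lborel) \<le> (\<integral>\<^sup>+z. (\<Sum>k. ennreal (c k) * indicator (ball (0::real^'n) (\<rho> k)) z) \<partial>lborel)"
  proof (rule nn_integral_mono)
    fix z :: "real^'n"
    show "ennreal (h z) \<le> (\<Sum>k. ennreal (c k) * indicator (ball 0 (\<rho> k)) z)"
    proof (cases "h z = 0")
      case False
      then obtain k where k: "h z \<le> c k" "z \<in> ball 0 (\<rho> k)" using h by blast
      have "ennreal (h z) \<le> ennreal (c k) * indicator (ball 0 (\<rho> k)) z"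
        using k by (simp add: ennreal_leI)
      also have "\<dots> \<le> (\<Sum>k. ennreal (c k) * indicator (ball 0 (\<rho> k)) z)"
        by (rule ennreal_le_suminf)
      finally show ?thesis .
    qed simp
  qed
  also have "\<dots> = (\<Sum>k. ennreal (c k) * emeasure lborel (ball (0::real^'n) (\<rho> k)))"
    by (subst nn_integral_suminf) (measurable, auto simp: nn_integral_cmult_indicator)
  also have "\<dots> = (\<Sum>k. ennreal (V * (c k * \<rho> k ^ CARD('n))))"
  proof (rule suminf_cong)
    fix k
    have "emeasure lborel (ball (0::real^'n) (\<rho> k)) = ennreal (V * \<rho> k ^ CARD('n))"
      using emeasure_ball[OF assms(3), of "0::real^'n"] by (simp add: V_def)
    then show "ennreal (c k) * emeasure lborel (ball (0::real^'n) (\<rho> k)) = ennreal (V * (c k * \<rho> k ^ CARD('n)))"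
      using assms(2,3) V by (simp add: ennreal_mult[symmetric] mult.left_commute)
  qed
  also have "\<dots> = ennreal (\<Sum>k. V * (c k * \<rho> k ^ CARD('n)))"
    by (rule suminf_ennreal2) (use assms(1-3) V in \<open>auto intro!: summable_mult\<close>)
  finally show ?thesis using ennreal_less_top le_less_trans unfolding infinity_ennreal_def by blast
qed

text \<open>With p = N + 2s the kernel is |z|^(2 - p) inside the unit ball, integrable because s <
  1, and |z|^(-p) outside, integrable because s > 0. Dyadic shells turn both into geometric
  series.\<close>

lemma gagliardo_kernel_integral_finite:
  fixes s :: real
  assumes s: "0 < s" "s < 1"
  shows "(\<integral>\<^sup>+z. ennreal (min 1 (norm z ^ 2) / norm z powr (real CARD('n) + 2 * s)) \<partial>(lborel :: (real^'n) measure)) < \<infinity>"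
proof -
  define N where "N = real CARD('n)"
  have N: "N \<ge> 1" by (simp add: N_def Suc_le_eq)
  define p where "p = N + 2 * s"
  \<comment> \<open>For N = 1 and s < 1/2 the exponent p - 2 is negative; the maximum with 0 keeps
    the power monotone in 1/|z|.\<close>
  define \<beta> where "\<beta> = max 0 (p - 2)"
  have \<beta>: "\<beta> \<ge> 0" "\<beta> < N" using s N by (auto simp: \<beta>_def p_def)
  define h where "h = (\<lambda>z :: real^'n. min 1 (norm z ^ 2) / norm z powr p)"
  define h1 where "h1 = (\<lambda>z :: real^'n. if norm z < 1 then h z else 0)"
  define h2 where "h2 = (\<lambda>z :: real^'n. if norm z < 1 then 0 else h z)"
  have [measurable]: "h \<in> borel_measurable borel" unfolding h_def by measurable
  have [measurable]: "h1 \<in> borel_measurable borel" "h2 \<in> borel_measurable borel"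
    unfolding h1_def h2_def by measurable
  have hnn: "h z \<ge> 0" for z by (simp add: h_def)
  have "(\<integral>\<^sup>+z. ennreal (h z) \<partial>lborel) = (\<integral>\<^sup>+z. ennreal (h1 z) + ennreal (h2 z) \<partial>lborel)"
    by (intro nn_integral_cong) (auto simp: h1_def h2_def)
  also have "\<dots> = (\<integral>\<^sup>+z. ennreal (h1 z) \<partial>lborel) + (\<integral>\<^sup>+z. ennreal (h2 z) \<partial>lborel)"
    by (subst nn_integral_add) auto
  also have "\<dots> < \<infinity>"
  proof -
    have "(\<integral>\<^sup>+z. ennreal (h1 z) \<partial>lborel) < \<infinity>"
    proof (rule dyadic_radial_integral_finite[where c = "\<lambda>k. (2 ^ Suc k) powr \<beta>" and \<rho> = "\<lambda>k. 2 * (1 / 2) ^ k"])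
      have "(2 ^ Suc k) powr \<beta> * (2 * (1 / 2) ^ k) ^ CARD('n) = 2 powr \<beta> * 2 powr N * ((1/2) powr (N - \<beta>)) ^ k" for k
      proof -
        have "(2 ^ Suc k) powr \<beta> = 2 powr \<beta> * 2 powr (real k * \<beta>)"
          by (simp add: powr_mult powr_realpow[symmetric] powr_powr)
        moreover have "(2 * (1 / 2) ^ k) ^ CARD('n) = 2 powr N * 2 powr (- (real k * N))"
        proof -
          have half: "((1 / 2 :: real) ^ k) = 2 powr (- real k)"
            by (simp add: powr_minus powr_realpow power_one_over inverse_eq_divide)
          have "(2 * (1 / 2) ^ k) ^ CARD('n) = (2 * 2 powr (- real k)) powr N"
            unfolding half by (simp add: N_def powr_realpow)
          then show ?thesis by (simp only: powr_mult powr_powr) simp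
        qed
        moreover have "((1/2) powr (N - \<beta>)) ^ k = 2 powr (- (real k * (N - \<beta>)))"
          by (simp add: powr_realpow[symmetric] powr_powr powr_divide powr_minus inverse_eq_divide mult.commute)
        ultimately show ?thesis
          by (simp add: powr_add[symmetric] algebra_simps)
      qed
      moreover have "summable (\<lambda>k. 2 powr \<beta> * 2 powr N * ((1/2) powr (N - \<beta>)) ^ k)"
        using \<beta> by (intro summable_mult summable_geometric) (auto simp: powr01_less_one)
      ultimately show "summable (\<lambda>k. (2 ^ Suc k) powr \<beta> * (2 * (1 / 2) ^ k) ^ CARD('n))" by simp
      fix z :: "real^'n" assume z: "h1 z \<noteq> 0"
      then have nz: "norm z > 0" "norm z < 1" by (auto simp: h1_def h_def split: if_splits)
      then obtain k where k: "2 ^ k \<le> 1 / norm z" "1 / norm z < 2 ^ Suc k"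
        using ex_dyadic_bracket[of "1 / norm z"] by auto
      have "h1 z = norm z powr (2 - p)"
        using nz power_le_one[of "norm z" 2] by (simp add: h1_def h_def min_absorb2 powr_diff)
      also have "\<dots> \<le> norm z powr (- \<beta>)"
        using nz by (intro powr_mono') (auto simp: \<beta>_def)
      also have "\<dots> = (1 / norm z) powr \<beta>" using nz by (simp add: powr_divide powr_minus inverse_eq_divide)
      also have "\<dots> \<le> (2 ^ Suc k) powr \<beta>" using k \<beta> nz by (intro powr_mono2) auto
      finally have 1: "h1 z \<le> (2 ^ Suc k) powr \<beta>" .
      \<comment> \<open>The bracket gives only |z| <= (1/2)^k; the factor 2 in the radius makes the
        inequality strict, as the open ball demands.\<close>
      have "norm z < 2 * (1 / 2) ^ k" using k(1) nz by (simp add: field_simps power_one_over)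
      with 1 show "\<exists>k. h1 z \<le> (2 ^ Suc k) powr \<beta> \<and> z \<in> ball 0 (2 * (1 / 2) ^ k)" by auto
    qed auto
    moreover have "(\<integral>\<^sup>+z. ennreal (h2 z) \<partial>lborel) < \<infinity>"
    proof (rule dyadic_radial_integral_finite[where c = "\<lambda>k. 1 / (2 ^ k) powr p" and \<rho> = "\<lambda>k. 2 ^ Suc k"])
      have "1 / (2 ^ k) powr p * (2 ^ Suc k) ^ CARD('n) = 2 powr N * ((1/2) powr (2 * s)) ^ k" for k
      proof -
        have "1 / (2 ^ k) powr p = 2 powr (- (real k * p))"
          by (simp add: powr_realpow[symmetric] powr_powr powr_minus inverse_eq_divide)
        moreover have "((2::real) ^ Suc k) ^ CARD('n) = 2 powr N * 2 powr (real k * N)"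
        proof -
          have "((2::real) ^ Suc k) ^ CARD('n) = (2 * 2 powr real k) powr N"
            by (simp add: N_def powr_realpow)
          then show ?thesis by (simp add: powr_mult powr_powr)
        qed
        moreover have "((1/2) powr (2 * s)) ^ k = 2 powr (- (real k * (2 * s)))"
          by (simp add: powr_realpow[symmetric] powr_powr powr_divide powr_minus inverse_eq_divide mult.commute)
        ultimately show ?thesis
          by (simp add: powr_add[symmetric] algebra_simps p_def)
      qed
      moreover have "summable (\<lambda>k. 2 powr N * ((1/2) powr (2 * s)) ^ k)"
        using s by (intro summable_mult summable_geometric) (auto simp: powr01_less_one)
      ultimately show "summable (\<lambda>k. 1 / (2 ^ k) powr p * (2 ^ Suc k) ^ CARD('n))" by simp
      fix z :: "real^'n" assume z: "h2 z \<noteq> 0"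
      then have nz: "norm z \<ge> 1" by (auto simp: h2_def split: if_splits)
      then obtain k where k: "2 ^ k \<le> norm z" "norm z < 2 ^ Suc k"
        using ex_dyadic_bracket[of "norm z"] by auto
      have "h2 z = 1 / norm z powr p"
        using nz by (simp add: h2_def h_def)
      also have "\<dots> \<le> 1 / (2 ^ k) powr p"
        using k nz s N by (intro divide_left_mono powr_mono2 mult_pos_pos) (auto simp: p_def)
      finally show "\<exists>k. h2 z \<le> 1 / (2 ^ k) powr p \<and> z \<in> ball 0 (2 ^ Suc k)" using k(2) by auto
    qed auto
    ultimately show ?thesis by simp
  qed
  finally show ?thesis by (simp add: h_def p_def N_def)
qed

text \<open>A tent function is 1-Lipschitz and oscillates by at most 1, so its difference quotient
  is at most the kernel h(x - y), and it vanishes unless x or y lies in the supporting ball B. By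
  translation invariance the energy is at most twice |B| times the integral of h.\<close>

lemma gagliardo_bump:
  fixes \<Omega> :: "(real^'n) set"
  assumes s: "0 < s" "s < 1" and \<Omega>: "open \<Omega>" "\<Omega> \<noteq> {}"
  obtains v :: "real^'n \<Rightarrow> real" where "v \<in> borel_measurable borel" "\<And>x. x \<notin> \<Omega> \<Longrightarrow> v x = 0"
    "gag_nn s v < \<infinity>" "\<not> (AE x in lborel. v x = 0)"
proof -
  obtain x0 e where e: "e > 0" "ball x0 e \<subseteq> \<Omega>" using \<Omega> by (metis ex_in_conv open_contains_ball)
  \<comment> \<open>The cap at 1 bounds the height of the tent and so matches the factor min 1 |z|^2
    in the kernel.\<close>
  define \<rho> where "\<rho> = min e 1"
  have \<rho>: "\<rho> > 0" "\<rho> \<le> 1" "ball x0 \<rho> \<subseteq> \<Omega>" using e by (auto simp: \<rho>_def)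
  define v where "v = (\<lambda>x :: real^'n. max 0 (\<rho> - norm (x - x0)))"
  have vm [measurable]: "v \<in> borel_measurable borel" unfolding v_def by measurable
  have off: "v x = 0" if "x \<notin> ball x0 \<rho>" for x using that by (auto simp: v_def dist_norm norm_minus_commute)
  have lip: "\<bar>v x - v y\<bar> \<le> norm (x - y)" "\<bar>v x - v y\<bar> \<le> 1" for x y
  proof -
    have "\<bar>norm (x - x0) - norm (y - x0)\<bar> \<le> norm (x - y)"
      using norm_triangle_ineq3[of "x - x0" "y - x0"] by simp
    then show "\<bar>v x - v y\<bar> \<le> norm (x - y)" unfolding v_def by linarith
    have "0 \<le> norm (x - x0)" "0 \<le> norm (y - x0)" by auto
    then show "\<bar>v x - v y\<bar> \<le> 1" using \<rho>(2) unfolding v_def by linarith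
  qed
  define B where "B = ball x0 \<rho>"
  have [measurable]: "B \<in> sets borel" by (simp add: B_def)
  define h where "h = (\<lambda>z :: real^'n. min 1 (norm z ^ 2) / norm z powr (real CARD('n) + 2 * s))"
  have [measurable]: "h \<in> borel_measurable borel" unfolding h_def by measurable
  have hnn: "h z \<ge> 0" for z by (simp add: h_def)
  have hsym: "h (x - y) = h (y - x)" for x y by (simp add: h_def norm_minus_commute)
  define K where "K = (\<integral>\<^sup>+z. ennreal (h z) \<partial>lborel)"
  have K: "K < \<infinity>" unfolding K_def h_def by (rule gagliardo_kernel_integral_finite[OF s])
  have shift: "(\<integral>\<^sup>+y. ennreal (h (y - x)) \<partial>lborel) = K" for x
  proof -
    have "K = (\<integral>\<^sup>+z. ennreal (h z) \<partial>(distr lborel borel ((+) (- x))))"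
      by (simp add: K_def lborel_distr_plus)
    also have "\<dots> = (\<integral>\<^sup>+y. ennreal (h (- x + y)) \<partial>lborel)" by (subst nn_integral_distr) auto
    finally show ?thesis by simp
  qed
  have le: "ennreal (gagliardo s v (x, y)) \<le>
    indicator B x * ennreal (h (y - x)) + indicator B y * ennreal (h (x - y))" for x y
  proof (cases "x \<in> B \<or> y \<in> B")
    case True
    have "(v x - v y)^2 \<le> min 1 (norm (x - y) ^ 2)"
    proof -
      have "\<bar>v x - v y\<bar>^2 \<le> 1^2" "\<bar>v x - v y\<bar>^2 \<le> norm (x - y)^2"
        using lip by (intro power_mono; simp)+
      then show ?thesis by simp
    qed
    then have "gagliardo s v (x, y) \<le> h (x - y)"
      unfolding gagliardo_apply h_def by (intro divide_right_mono) auto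
    then have *: "ennreal (gagliardo s v (x, y)) \<le> ennreal (h (x - y))" by (rule ennreal_leI)
    show ?thesis
    proof (cases "x \<in> B")
      case True
      then show ?thesis using * hsym[of x y] by (simp add: add_increasing2)
    next
      case False
      then show ?thesis using * \<open>x \<in> B \<or> y \<in> B\<close> by simp
    qed
  next
    case False
    then show ?thesis using off by (simp add: gagliardo_apply B_def)
  qed
  have B: "emeasure lborel B < \<infinity>" using emeasure_bounded_finite[of B] by (simp add: B_def)
  have "gag_nn s v = (\<integral>\<^sup>+x. \<integral>\<^sup>+y. ennreal (gagliardo s v (x, y)) \<partial>lborel \<partial>lborel)"
    unfolding gag_nn_def by (rule nn_integral_lborel_pair) simp
  also have "\<dots> \<le> (\<integral>\<^sup>+x. \<integral>\<^sup>+y. indicator B x * ennreal (h (y - x)) + indicator B y * ennreal (h (x - y)) \<partial>lborel \<partial>lborel)"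
    by (intro nn_integral_mono le)
  also have "\<dots> = (\<integral>\<^sup>+x. indicator B x * K + (\<integral>\<^sup>+y. indicator B y * ennreal (h (x - y)) \<partial>lborel) \<partial>lborel)"
    by (subst nn_integral_add) (auto simp: nn_integral_cmult shift)
  also have "\<dots> = (\<integral>\<^sup>+x. indicator B x * K \<partial>lborel) + (\<integral>\<^sup>+x. \<integral>\<^sup>+y. indicator B y * ennreal (h (x - y)) \<partial>lborel \<partial>lborel)"
    by (subst nn_integral_add) auto
  also have "(\<integral>\<^sup>+x. \<integral>\<^sup>+y. indicator B y * ennreal (h (x - y)) \<partial>lborel \<partial>lborel) =
      (\<integral>\<^sup>+y. \<integral>\<^sup>+x. indicator B y * ennreal (h (x - y)) \<partial>lborel \<partial>lborel)"
    by (rule lborel_pair.Fubini') measurable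
  also have "\<dots> = (\<integral>\<^sup>+y. indicator B y * K \<partial>lborel)"
    by (simp add: nn_integral_cmult shift)
  also have "(\<integral>\<^sup>+x. indicator B x * K \<partial>lborel) = emeasure lborel B * K"
    by (simp add: nn_integral_multc)
  finally have "gag_nn s v \<le> emeasure lborel B * K + emeasure lborel B * K" .
  also have "\<dots> < \<infinity>" using B K by (simp add: ennreal_mult_less_top)
  finally have fin: "gag_nn s v < \<infinity>" .
  have "\<not> (AE x in lborel. v x = 0)"
  proof
    assume "AE x in lborel. v x = 0"
    then have "AE x in lborel. x \<notin> B"
      by eventually_elim (auto simp: v_def B_def dist_norm norm_minus_commute)
    then have "emeasure lborel B = 0" by (subst (asm) AE_iff_measurable[of B]) auto
    then show False
      using \<rho>(1) unit_ball_vol_pos[of "real CARD('n)"] by (simp add: B_def emeasure_ball del: unit_ball_vol_pos)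
  qed
  moreover have "v x = 0" if "x \<notin> \<Omega>" for x using off[of x] \<rho>(3) that by blast
  ultimately show ?thesis using that[OF vm _ fin] by simp
qed

section \<open>The subcritical term\<close>

lemma (in complete_measure) borel_measurable_cong_AE_complete:
  fixes f h :: "'a \<Rightarrow> real"
  assumes f: "f \<in> borel_measurable M" and ae: "AE x in M. f x = h x"
  shows "h \<in> borel_measurable M"
proof (rule measurableI)
  fix A :: "real set" assume "A \<in> sets borel"
  then have "f -` A \<inter> space M \<in> sets M" using f by (rule measurable_sets[rotated])
  moreover have "AE x in M. x \<in> f -` A \<inter> space M \<longleftrightarrow> x \<in> h -` A \<inter> space M"
    using ae by eventually_elim auto
  ultimately show "h -` A \<inter> space M \<in> sets M" by (metis in_sets_AE inf_le2)
qed simp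

lemma complete_measure_lebesgue_on:
  assumes "S \<in> sets lebesgue"
  shows "complete_measure (lebesgue_on S)"
proof
  fix A B :: "'a set" assume BA: "B \<subseteq> A" and "A \<in> null_sets (lebesgue_on S)"
  then have "A \<subseteq> S" "A \<in> null_sets lebesgue" using assms by (auto simp: null_sets_restrict_space)
  then show "B \<in> sets (lebesgue_on S)"
    using BA completion.complete[of B A] assms by (auto simp: sets_restrict_space_iff)
qed

text \<open>Rounding t down to the grid of mesh 1/(n + 1) leaves countably many values of t, for
  which measurability in x suffices; continuity in t makes these step functions converge to
  h.\<close>

lemma caratheodory_joint_measurable:
  fixes h :: "'a \<Rightarrow> real \<Rightarrow> real"
  assumes [measurable]: "\<And>t. (\<lambda>x. h x t) \<in> borel_measurable M"
    and cont: "\<And>x. continuous_on UNIV (h x)"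
  shows "(\<lambda>(x, t). h x t) \<in> borel_measurable (M \<Otimes>\<^sub>M borel)"
proof -
  define a where "a = (\<lambda>n t. of_int \<lfloor>real (Suc n) * t\<rfloor> / real (Suc n))"
  have lim: "(\<lambda>n. h x (a n t)) \<longlonglongrightarrow> h x t" for x t
  proof -
    have "(\<lambda>n. a n t) \<longlonglongrightarrow> t"
    proof (rule tendsto_sandwich)
      show "(\<lambda>n. t - inverse (real (Suc n))) \<longlonglongrightarrow> t"
        using tendsto_diff[OF tendsto_const LIMSEQ_inverse_real_of_nat, of t] by simp
      have "t - inverse (real (Suc n)) \<le> a n t" for n
      proof -
        have "real (Suc n) * t - 1 \<le> of_int \<lfloor>real (Suc n) * t\<rfloor>" by linarith
        then have "(real (Suc n) * t - 1) / real (Suc n) \<le> a n t"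
          unfolding a_def by (intro divide_right_mono) auto
        then show ?thesis by (simp add: diff_divide_distrib inverse_eq_divide del: of_nat_Suc)
      qed
      then show "\<forall>\<^sub>F n in sequentially. t - inverse (real (Suc n)) \<le> a n t" by simp
      have "a n t \<le> t" for n
        unfolding a_def by (subst divide_le_eq) (auto simp: mult.commute simp del: of_nat_Suc)
      then show "\<forall>\<^sub>F n in sequentially. a n t \<le> t" by simp
    qed auto
    moreover have "isCont (h x) t" using cont[of x] by (simp add: continuous_on_eq_continuous_at)
    ultimately show ?thesis by (rule isCont_tendsto_compose[rotated])
  qed
  have "(\<lambda>z. h (fst z) (a n (snd z))) \<in> borel_measurable (M \<Otimes>\<^sub>M borel)" for n
  proof -
    have "(\<lambda>z. (\<lambda>i::int. \<lambda>z. h (fst z) (of_int i / real (Suc n))) \<lfloor>real (Suc n) * snd z\<rfloor> z) \<in> borel_measurable (M \<Otimes>\<^sub>M borel)"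
      by (rule measurable_compose_countable) measurable
    then show ?thesis by (simp add: a_def)
  qed
  then have "(\<lambda>z. h (fst z) (snd z)) \<in> borel_measurable (M \<Otimes>\<^sub>M borel)"
    by (rule borel_measurable_LIMSEQ_real[rotated]) (rule lim)
  then show ?thesis by (simp add: split_beta')
qed

section \<open>The primitive of the nonlinearity\<close>

lemma primitive_zero [simp]: "primitive g x 0 = 0"
  by (simp add: primitive_def)

lemma primitive_has_real_derivative:
  assumes "continuous_on UNIV (g x)"
  shows "(primitive g x has_real_derivative g x t) (at t)"
proof -
  define b where "b = \<bar>t\<bar> + 1"
  have "((\<lambda>u. LBINT y=0..u. g x y) has_vector_derivative (g x t)) (at t within {-b..b})"
    using interval_integral_FTC2[of "-b" 0 b "g x" t] continuous_on_subset[OF assms]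
    by (auto simp: b_def zero_ereal_def)
  moreover have "at t within {-b..b} = at t"
    by (rule at_within_interior) (auto simp: b_def)
  moreover have "(\<lambda>u. LBINT y=0..u. g x y) = primitive g x" by (auto simp: primitive_def zero_ereal_def)
  ultimately show ?thesis by (simp add: has_real_derivative_iff_has_vector_derivative)
qed

lemma primitive_increment:
  assumes "continuous_on UNIV (g x)" "t \<noteq> t'"
  obtains \<theta> where "primitive g x t' - primitive g x t = (t' - t) * g x \<theta>" "min t t' < \<theta>" "\<theta> < max t t'"
proof (cases "t < t'")
  case True
  then obtain z where "z > t" "z < t'" "primitive g x t' - primitive g x t = (t' - t) * g x z"
    using MVT2[of t t' "primitive g x" "g x"] primitive_has_real_derivative[of g x, OF assms(1)] by metis
  then show ?thesis using that[of z] True by auto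
next
  case False
  then have "t' < t" using assms(2) by simp
  then obtain z where "z > t'" "z < t" "primitive g x t - primitive g x t' = (t - t') * g x z"
    using MVT2[of t' t "primitive g x" "g x"] primitive_has_real_derivative[of g x, OF assms(1)] by metis
  then show ?thesis using that[of z] False by (auto simp: algebra_simps)
qed

lemma powr_subcritical_le:
  fixes e p' q :: real
  assumes e: "e > 0" and p': "0 < p'" "p' < q"
  obtains C where "C \<ge> 0" "\<And>t. \<bar>t\<bar> powr p' \<le> e * \<bar>t\<bar> powr q + C"
proof -
  \<comment> \<open>The solution of R^(p' - q) = e: beyond R the lower power is at most e times the
    higher one, and up to R it is at most R^p'.\<close>
  define R where "R = (1 / e) powr (1 / (q - p'))"
  have R: "R > 0" using e by (simp add: R_def)
  have Re: "R powr (p' - q) = e"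
  proof -
    have "1 / (q - p') * (p' - q) = - 1" using p' by (simp add: field_simps)
    then have "R powr (p' - q) = (1 / e) powr (- 1)" by (simp only: R_def powr_powr)
    then show ?thesis using e by (simp add: powr_minus_divide)
  qed
  show ?thesis
  proof (rule that)
    show "R powr p' \<ge> 0" by simp
    fix t :: real
    show "\<bar>t\<bar> powr p' \<le> e * \<bar>t\<bar> powr q + R powr p'"
    proof (cases "\<bar>t\<bar> \<le> R")
      case True
      then have "\<bar>t\<bar> powr p' \<le> R powr p'" using p' by (intro powr_mono2) auto
      then show ?thesis using e by (simp add: add_increasing)
    next
      case False
      then have t: "\<bar>t\<bar> > 0" using R by linarith
      have "\<bar>t\<bar> powr p' = \<bar>t\<bar> powr (p' - q) * \<bar>t\<bar> powr q" using t by (simp add: powr_add[symmetric])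
      also have "\<dots> \<le> R powr (p' - q) * \<bar>t\<bar> powr q"
        using False R p' by (intro mult_right_mono powr_mono2') auto
      finally show ?thesis using Re by (simp add: add_increasing2)
    qed
  qed
qed

text \<open>Completeness lets measurability pass from a modification of \<open>g\<close> on a null
  set back to \<open>g\<close>, whose sections are continuous only almost everywhere.\<close>

locale subcritical_nonlinearity = finite_measure M + complete_measure M
  for M :: "(real^'n) measure" +
  fixes g :: "real^'n \<Rightarrow> real \<Rightarrow> real" and c p q :: real
  assumes meas: "\<And>t. (\<lambda>x. g x t) \<in> borel_measurable M"
    and cont: "AE x in M. continuous_on UNIV (g x)"
    and sign: "AE x in M. (\<forall>t>0. g x t > 0) \<and> (\<forall>t<0. g x t < 0)"
    and growth: "AE x in M. \<forall>t. \<bar>g x t\<bar> \<le> c * (1 + \<bar>t\<bar> powr (p - 1))"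
    and c: "c > 0" and p: "2 < p" "p < q"
    and small: "\<And>e. e > 0 \<Longrightarrow> \<exists>d>0. AE x in M. \<forall>t. \<bar>t\<bar> < d \<longrightarrow> t \<noteq> 0 \<longrightarrow> \<bar>g x t\<bar> \<le> e * \<bar>t\<bar>"
begin

definition potential :: "(real^'n \<Rightarrow> real) \<Rightarrow> real" where
  "potential u = (\<integral>x. primitive g x (u x) \<partial>M)"

text \<open>Joint measurability asks for continuity of every section, so the nonlinearity is set to
  zero on a measurable null set containing all bad points.\<close>

lemma caratheodory_modification:
  obtains g' where "\<And>x. continuous_on UNIV (g' x)" "AE x in M. g' x = g x"
    "(\<lambda>(x, t). g' x t) \<in> borel_measurable (M \<Otimes>\<^sub>M borel)"
proof -
  obtain N where N: "{x \<in> space M. \<not> continuous_on UNIV (g x)} \<subseteq> N" "N \<in> null_sets M"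
    using cont by (auto elim!: AE_E simp: null_sets_def)
  have [measurable]: "N \<in> sets M" using N(2) by auto
  note [measurable] = meas
  define g' where "g' = (\<lambda>x t. if x \<in> N \<or> x \<notin> space M then 0 else g x t)"
  have 1: "continuous_on UNIV (g' x)" for x
    using N(1) by (cases "x \<in> N \<or> x \<notin> space M") (auto simp: g'_def)
  have "AE x in M. x \<notin> N" by (rule AE_not_in[OF N(2)])
  then have 2: "AE x in M. g' x = g x" using AE_space by eventually_elim (auto simp: g'_def)
  have "(\<lambda>x. g' x t) \<in> borel_measurable M" for t
  proof -
    have "(\<lambda>x. if x \<in> N then 0 else g x t) \<in> borel_measurable M" by measurable
    then show ?thesis by (rule measurable_cong[THEN iffD1, rotated]) (auto simp: g'_def)
  qed
  then show ?thesis using that[of g'] 1 2 caratheodory_joint_measurable[of g' M] by blast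
qed

lemma nemytskii_measurable:
  assumes u [measurable]: "u \<in> borel_measurable M"
  shows "(\<lambda>x. g x (u x)) \<in> borel_measurable M"
proof -
  obtain g' where g': "AE x in M. g' x = g x" and
    [measurable]: "(\<lambda>(x, t). g' x t) \<in> borel_measurable (M \<Otimes>\<^sub>M borel)"
    using caratheodory_modification by blast
  have "(\<lambda>x. g' x (u x)) \<in> borel_measurable M"
    using measurable_compose[of "\<lambda>x. (x, u x)" M "M \<Otimes>\<^sub>M borel" "\<lambda>(x, t). g' x t" borel] by simp
  then show ?thesis by (rule borel_measurable_cong_AE_complete) (use g' in eventually_elim, auto)
qed

lemma primitive_measurable:
  assumes u [measurable]: "u \<in> borel_measurable M"
  shows "(\<lambda>x. primitive g x (u x)) \<in> borel_measurable M"
proof -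
  obtain g' where g': "AE x in M. g' x = g x" and
    m [measurable]: "(\<lambda>(x, t). g' x t) \<in> borel_measurable (M \<Otimes>\<^sub>M borel)"
    using caratheodory_modification by blast
  \<comment> \<open>Written as integrals over the whole line, the primitives carry the moving
    endpoint \<open>u x\<close> in the integrand, so measurability in x follows from that of
    parameter integrals.\<close>
  have eq: "primitive g' x t = (if 0 \<le> t then \<integral>\<tau>. (if 0 < \<tau> \<and> \<tau> < t then g' x \<tau> else 0) \<partial>lborel
      else - (\<integral>\<tau>. (if t < \<tau> \<and> \<tau> < 0 then g' x \<tau> else 0) \<partial>lborel))" for x t
    unfolding primitive_def interval_lebesgue_integral_def set_lebesgue_integral_def einterval_eq
    by (auto intro!: arg_cong[where f = "integral\<^sup>L lborel"] simp: fun_eq_iff indicator_def)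
  have "(\<lambda>(x, \<tau>). if 0 < \<tau> \<and> \<tau> < u x then g' x \<tau> else 0) \<in> borel_measurable (M \<Otimes>\<^sub>M lborel)"
    "(\<lambda>(x, \<tau>). if u x < \<tau> \<and> \<tau> < 0 then g' x \<tau> else 0) \<in> borel_measurable (M \<Otimes>\<^sub>M lborel)"
    using m unfolding split_beta' by measurable
  then have [measurable]: "(\<lambda>x. \<integral>\<tau>. (if 0 < \<tau> \<and> \<tau> < u x then g' x \<tau> else 0) \<partial>lborel) \<in> borel_measurable M"
    "(\<lambda>x. \<integral>\<tau>. (if u x < \<tau> \<and> \<tau> < 0 then g' x \<tau> else 0) \<partial>lborel) \<in> borel_measurable M"
    by (auto intro!: lborel.borel_measurable_lebesgue_integral)
  have "(\<lambda>x. primitive g' x (u x)) \<in> borel_measurable M" unfolding eq by measurable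
  moreover have "AE x in M. primitive g' x (u x) = primitive g x (u x)"
    using g' by eventually_elim (simp add: primitive_def)
  ultimately show ?thesis by (rule borel_measurable_cong_AE_complete)
qed

lemma primitive_growth:
  "AE x in M. \<forall>t. \<bar>primitive g x t\<bar> \<le> c * (\<bar>t\<bar> + \<bar>t\<bar> powr p)"
  using cont growth
proof eventually_elim
  case (elim x)
  show ?case
  proof
    fix t
    show "\<bar>primitive g x t\<bar> \<le> c * (\<bar>t\<bar> + \<bar>t\<bar> powr p)"
    proof (cases "t = 0")
      case False
      obtain \<theta> where \<theta>: "primitive g x t - primitive g x 0 = (t - 0) * g x \<theta>" "min 0 t < \<theta>" "\<theta> < max 0 t"
        using primitive_increment[of g x 0 t, OF elim(1)] False by metis
      have "\<bar>\<theta>\<bar> \<le> \<bar>t\<bar>" using \<theta> by auto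
      then have "\<bar>\<theta>\<bar> powr (p - 1) \<le> \<bar>t\<bar> powr (p - 1)" using p by (intro powr_mono2) auto
      then have "\<bar>g x \<theta>\<bar> \<le> c * (1 + \<bar>t\<bar> powr (p - 1))"
        using elim(2) c by (smt (verit) mult_left_mono)
      then have "\<bar>t\<bar> * \<bar>g x \<theta>\<bar> \<le> \<bar>t\<bar> * (c * (1 + \<bar>t\<bar> powr (p - 1)))" by (intro mult_left_mono) auto
      also have "\<dots> = c * (\<bar>t\<bar> + \<bar>t\<bar> powr p)"
        using False by (simp add: powr_diff field_simps)
      finally show ?thesis using \<theta>(1) by (simp add: abs_mult)
    qed simp
  qed
qed

lemma primitive_pos: "AE x in M. \<forall>t. t \<noteq> 0 \<longrightarrow> primitive g x t > 0"
  using cont sign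
proof eventually_elim
  case (elim x)
  show ?case
  proof (intro allI impI)
    fix t :: real assume t: "t \<noteq> 0"
    obtain \<theta> where \<theta>: "primitive g x t - primitive g x 0 = (t - 0) * g x \<theta>" "min 0 t < \<theta>" "\<theta> < max 0 t"
      using primitive_increment[of g x 0 t, OF elim(1)] t by metis
    show "primitive g x t > 0"
    proof (cases "t > 0")
      case True
      then have "g x \<theta> > 0" using elim(2) \<theta> by auto
      then show ?thesis using \<theta>(1) True by simp
    next
      case False
      then have "g x \<theta> < 0" using elim(2) \<theta> t by auto
      then show ?thesis using \<theta>(1) False t by (simp add: mult_neg_neg)
    qed
  qed
qed

text \<open>For |t| < d the mean value theorem and \<open>small\<close> give e t^2. For |t| >= d
  both powers in the growth bound lie below q, so each is at most a power of d times |t|^q.\<close>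

lemma primitive_bound_zero:
  assumes e: "e > 0"
  obtains C where "C \<ge> 0" "AE x in M. \<forall>t. \<bar>primitive g x t\<bar> \<le> e * t^2 + C * \<bar>t\<bar> powr q"
proof -
  obtain d where d: "d > 0" "AE x in M. \<forall>t. \<bar>t\<bar> < d \<longrightarrow> t \<noteq> 0 \<longrightarrow> \<bar>g x t\<bar> \<le> e * \<bar>t\<bar>"
    using small[OF e] by blast
  define C where "C = c * (d powr (1 - q) + d powr (p - q))"
  have C: "C \<ge> 0" using c by (simp add: C_def)
  have "AE x in M. \<forall>t. \<bar>primitive g x t\<bar> \<le> e * t^2 + C * \<bar>t\<bar> powr q"
    using cont primitive_growth d(2)
  proof eventually_elim
    case (elim x)
    show ?case
    proof
      fix t :: real
      consider "t = 0" | "t \<noteq> 0" "\<bar>t\<bar> < d" | "\<bar>t\<bar> \<ge> d" by linarith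
      then show "\<bar>primitive g x t\<bar> \<le> e * t^2 + C * \<bar>t\<bar> powr q"
      proof cases
        case 2
        obtain \<theta> where \<theta>: "primitive g x t - primitive g x 0 = (t - 0) * g x \<theta>" "min 0 t < \<theta>" "\<theta> < max 0 t"
          using primitive_increment[of g x 0 t, OF elim(1)] 2 by metis
        have th: "\<bar>\<theta>\<bar> \<le> \<bar>t\<bar>" "\<theta> \<noteq> 0" using \<theta> by auto
        then have "\<bar>g x \<theta>\<bar> \<le> e * \<bar>\<theta>\<bar>" using elim(3) 2 by auto
        also have "\<dots> \<le> e * \<bar>t\<bar>" using th e by simp
        finally have "\<bar>t\<bar> * \<bar>g x \<theta>\<bar> \<le> \<bar>t\<bar> * (e * \<bar>t\<bar>)" by (intro mult_left_mono) auto
        also have "\<dots> = e * t^2" by (simp add: power2_eq_square)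
        finally show ?thesis using \<theta>(1) C by (simp add: abs_mult add_increasing2)
      next
        case 3
        then have t: "\<bar>t\<bar> > 0" using d by linarith
        have "\<bar>t\<bar> = \<bar>t\<bar> powr (1 - q) * \<bar>t\<bar> powr q" "\<bar>t\<bar> powr p = \<bar>t\<bar> powr (p - q) * \<bar>t\<bar> powr q"
          using t by (simp_all add: powr_add[symmetric])
        moreover have "\<bar>t\<bar> powr (1 - q) \<le> d powr (1 - q)" "\<bar>t\<bar> powr (p - q) \<le> d powr (p - q)"
          using 3 d p by (intro powr_mono2'; simp)+
        ultimately have "\<bar>t\<bar> \<le> d powr (1 - q) * \<bar>t\<bar> powr q" "\<bar>t\<bar> powr p \<le> d powr (p - q) * \<bar>t\<bar> powr q"
          by (metis mult_right_mono powr_ge_zero)+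
        then have "c * (\<bar>t\<bar> + \<bar>t\<bar> powr p) \<le> c * (d powr (1 - q) * \<bar>t\<bar> powr q + d powr (p - q) * \<bar>t\<bar> powr q)"
          using c by (intro mult_left_mono add_mono) auto
        also have "\<dots> = C * \<bar>t\<bar> powr q" by (simp add: C_def algebra_simps)
        finally have "\<bar>primitive g x t\<bar> \<le> C * \<bar>t\<bar> powr q" using elim(2) order_trans by blast
        then show ?thesis using e by (simp add: add_increasing)
      qed simp
    qed
  qed
  with C show ?thesis by (rule that)
qed

lemma primitive_bound_infinity:
  assumes e: "e > 0"
  obtains C where "C \<ge> 0" "AE x in M. \<forall>t. \<bar>primitive g x t\<bar> \<le> e * \<bar>t\<bar> powr q + C"
proof -
  define e' where "e' = e / (2 * c)"
  have e': "e' > 0" using e c by (simp add: e'_def)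
  obtain C1 where C1: "C1 \<ge> 0" "\<And>t. \<bar>t\<bar> powr 1 \<le> e' * \<bar>t\<bar> powr q + C1"
    using powr_subcritical_le[OF e', of 1 q] p by auto
  obtain C2 where C2: "C2 \<ge> 0" "\<And>t. \<bar>t\<bar> powr p \<le> e' * \<bar>t\<bar> powr q + C2"
    using powr_subcritical_le[OF e', of p q] p by auto
  show ?thesis
  proof (rule that)
    show "c * (C1 + C2) \<ge> 0" using c C1 C2 by simp
    show "AE x in M. \<forall>t. \<bar>primitive g x t\<bar> \<le> e * \<bar>t\<bar> powr q + c * (C1 + C2)"
      using primitive_growth
    proof eventually_elim
      case (elim x)
      show ?case
      proof
        fix t
        have "c * (\<bar>t\<bar> + \<bar>t\<bar> powr p) \<le> c * ((e' * \<bar>t\<bar> powr q + C1) + (e' * \<bar>t\<bar> powr q + C2))"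
          using C1(2)[of t] C2(2)[of t] c by (intro mult_left_mono add_mono) auto
        also have "\<dots> = e * \<bar>t\<bar> powr q + c * (C1 + C2)" using c by (simp add: e'_def field_simps)
        finally show "\<bar>primitive g x t\<bar> \<le> e * \<bar>t\<bar> powr q + c * (C1 + C2)" using elim order_trans by blast
      qed
    qed
  qed
qed

lemma primitive_integrable:
  assumes u [measurable]: "u \<in> borel_measurable M" and int: "integrable M (\<lambda>x. \<bar>u x\<bar> powr q)"
  shows "integrable M (\<lambda>x. primitive g x (u x))"
proof -
  obtain C where C: "C \<ge> 0" "AE x in M. \<forall>t. \<bar>primitive g x t\<bar> \<le> 1 * \<bar>t\<bar> powr q + C"
    using primitive_bound_infinity[of 1] by auto
  show ?thesis
  proof (rule Bochner_Integration.integrable_bound)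
    show "integrable M (\<lambda>x. \<bar>u x\<bar> powr q + C)" using int by simp
    show "AE x in M. norm (primitive g x (u x)) \<le> norm (\<bar>u x\<bar> powr q + C)"
      using C(2) by eventually_elim (use C(1) in auto)
  qed (rule primitive_measurable[OF u])
qed

lemma potential_bound_zero:
  assumes e: "e > 0"
  obtains C where "C \<ge> 0" "\<And>u. u \<in> borel_measurable M \<Longrightarrow> integrable M (\<lambda>x. \<bar>u x\<bar> powr q) \<Longrightarrow>
    integrable M (\<lambda>x. (u x)^2) \<Longrightarrow>
    \<bar>potential u\<bar> \<le> e * (\<integral>x. (u x)^2 \<partial>M) + C * (\<integral>x. \<bar>u x\<bar> powr q \<partial>M)"
proof -
  obtain C where C: "C \<ge> 0" "AE x in M. \<forall>t. \<bar>primitive g x t\<bar> \<le> e * t^2 + C * \<bar>t\<bar> powr q"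
    using primitive_bound_zero[OF e] by blast
  show ?thesis
  proof (rule that[OF C(1)])
    fix u :: "real^'n \<Rightarrow> real"
    assume u: "u \<in> borel_measurable M" "integrable M (\<lambda>x. \<bar>u x\<bar> powr q)" "integrable M (\<lambda>x. (u x)^2)"
    have "\<bar>potential u\<bar> \<le> (\<integral>x. \<bar>primitive g x (u x)\<bar> \<partial>M)"
      unfolding potential_def by (rule integral_abs_bound)
    also have "\<dots> \<le> (\<integral>x. e * (u x)^2 + C * \<bar>u x\<bar> powr q \<partial>M)"
    proof (rule integral_mono_AE)
      show "AE x in M. \<bar>primitive g x (u x)\<bar> \<le> e * (u x)^2 + C * \<bar>u x\<bar> powr q"
        using C(2) by eventually_elim auto
    qed (use primitive_integrable u in auto)
    also have "\<dots> = e * (\<integral>x. (u x)^2 \<partial>M) + C * (\<integral>x. \<bar>u x\<bar> powr q \<partial>M)" using u by simp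
    finally show "\<bar>potential u\<bar> \<le> \<dots>" .
  qed
qed

lemma potential_bound_infinity:
  assumes e: "e > 0"
  obtains C where "C \<ge> 0" "\<And>u. u \<in> borel_measurable M \<Longrightarrow> integrable M (\<lambda>x. \<bar>u x\<bar> powr q) \<Longrightarrow>
    \<bar>potential u\<bar> \<le> e * (\<integral>x. \<bar>u x\<bar> powr q \<partial>M) + C"
proof -
  obtain C where C: "C \<ge> 0" "AE x in M. \<forall>t. \<bar>primitive g x t\<bar> \<le> e * \<bar>t\<bar> powr q + C"
    using primitive_bound_infinity[OF e] by blast
  show ?thesis
  proof (rule that)
    show "C * measure M (space M) \<ge> 0" using C by simp
    fix u :: "real^'n \<Rightarrow> real"
    assume u: "u \<in> borel_measurable M" "integrable M (\<lambda>x. \<bar>u x\<bar> powr q)"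
    have "\<bar>potential u\<bar> \<le> (\<integral>x. \<bar>primitive g x (u x)\<bar> \<partial>M)"
      unfolding potential_def by (rule integral_abs_bound)
    also have "\<dots> \<le> (\<integral>x. e * \<bar>u x\<bar> powr q + C \<partial>M)"
    proof (rule integral_mono_AE)
      show "AE x in M. \<bar>primitive g x (u x)\<bar> \<le> e * \<bar>u x\<bar> powr q + C"
        using C(2) by eventually_elim auto
    qed (use primitive_integrable u in auto)
    also have "\<dots> = e * (\<integral>x. \<bar>u x\<bar> powr q \<partial>M) + C * measure M (space M)" using u by simp
    finally show "\<bar>potential u\<bar> \<le> \<dots>" .
  qed
qed

lemma potential_pos:
  assumes u: "u \<in> borel_measurable M" "integrable M (\<lambda>x. \<bar>u x\<bar> powr q)"
    and nz: "\<not> (AE x in M. u x = 0)"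
  shows "potential u > 0"
proof -
  have nn: "AE x in M. primitive g x (u x) \<ge> 0"
    using primitive_pos by eventually_elim (metis less_eq_real_def primitive_zero)
  then have "potential u \<ge> 0" unfolding potential_def by (rule integral_nonneg_AE)
  moreover have "potential u \<noteq> 0"
  proof
    assume "potential u = 0"
    then have "AE x in M. primitive g x (u x) = 0"
      using integral_nonneg_eq_0_iff_AE[OF primitive_integrable[OF u] nn] by (simp add: potential_def)
    then have "AE x in M. u x = 0"
      using primitive_pos by eventually_elim force
    then show False using nz by simp
  qed
  ultimately show ?thesis by simp
qed

text \<open>Boundedness in L^q does not let the critical integral pass to the limit, but subcritical
  growth does so for the potential: for every e the integrand is at most e|u n|^q plus a constant,
  and constants are integrable on a finite measure.\<close>

lemma potential_tendsto:
  fixes u :: "nat \<Rightarrow> real^'n \<Rightarrow> real"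
  assumes m: "\<And>n. u n \<in> borel_measurable M" "v \<in> borel_measurable M"
    and lim: "AE x in M. (\<lambda>n. u n x) \<longlonglongrightarrow> v x"
    and int: "\<And>n. integrable M (\<lambda>x. \<bar>u n x\<bar> powr q)" "\<And>n. (\<integral>x. \<bar>u n x\<bar> powr q \<partial>M) \<le> K"
    and vint: "integrable M (\<lambda>x. \<bar>v x\<bar> powr q)"
  shows "(\<lambda>n. potential (u n)) \<longlonglongrightarrow> potential v"
proof -
  define f where "f = (\<lambda>n x. \<bar>primitive g x (u n x) - primitive g x (v x)\<bar>)"
  note pm = primitive_measurable[OF m(1)] primitive_measurable[OF m(2)]
  note pint = primitive_integrable[OF m(1) int(1)] primitive_integrable[OF m(2) vint]
  have "(\<lambda>n. \<integral>x. f n x \<partial>M) \<longlonglongrightarrow> 0"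
  proof (rule tendsto_integral_zero_truncated_dominated[where k = "\<lambda>n x. \<bar>u n x\<bar> powr q" and K = K])
    show "f n \<in> borel_measurable M" for n unfolding f_def using pm by auto
    show "AE x in M. (\<lambda>n. f n x) \<longlonglongrightarrow> 0"
      using lim cont
    proof eventually_elim
      case (elim x)
      have "isCont (primitive g x) (v x)"
        using primitive_has_real_derivative[of g x, OF elim(2)] DERIV_isCont by blast
      then have "(\<lambda>n. primitive g x (u n x)) \<longlonglongrightarrow> primitive g x (v x)"
        using elim(1) by (rule isCont_tendsto_compose)
      then have "(\<lambda>n. f n x) \<longlonglongrightarrow> \<bar>primitive g x (v x) - primitive g x (v x)\<bar>"
        unfolding f_def by (intro tendsto_intros)
      then show ?case by simp
    qed
    fix e :: real assume e: "e > 0"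
    obtain C where C: "C \<ge> 0" "AE x in M. \<forall>t. \<bar>primitive g x t\<bar> \<le> e * \<bar>t\<bar> powr q + C"
      using primitive_bound_infinity[OF e] by blast
    have "AE x in M. f n x \<le> e * \<bar>u n x\<bar> powr q + (C + \<bar>primitive g x (v x)\<bar>)" for n
      using C(2)
    proof eventually_elim
      case (elim x)
      then have "\<bar>primitive g x (u n x)\<bar> \<le> e * \<bar>u n x\<bar> powr q + C" by blast
      then show ?case unfolding f_def by linarith
    qed
    then show "\<exists>C. integrable M C \<and> (\<forall>n. AE x in M. f n x \<le> e * \<bar>u n x\<bar> powr q + C x)"
      by (intro exI[of _ "\<lambda>x. C + \<bar>primitive g x (v x)\<bar>"]) (use pint in auto)
  qed (use int in \<open>auto simp: f_def\<close>)
  have le: "\<bar>potential (u n) - potential v\<bar> \<le> (\<integral>x. f n x \<partial>M)" for n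
  proof -
    have "potential (u n) - potential v = (\<integral>x. primitive g x (u n x) - primitive g x (v x) \<partial>M)"
      using pint by (simp add: potential_def)
    then show ?thesis unfolding f_def by (simp add: integral_abs_bound)
  qed
  have "(\<lambda>n. \<bar>potential (u n) - potential v\<bar>) \<longlonglongrightarrow> 0"
    by (rule tendsto_sandwich[OF _ _ tendsto_const \<open>(\<lambda>n. \<integral>x. f n x \<partial>M) \<longlonglongrightarrow> 0\<close>]) (use le in auto)
  then show ?thesis by (simp add: tendsto_rabs_zero_iff LIM_zero_iff)
qed

text \<open>Differentiation under the integral sign. The mean value theorem bounds the difference
  quotients by one integrable \<open>W\<close> for all increments below 1. This is needed for the
  derivative condition in \<open>lambda0\<close>.\<close>

lemma potential_fiber_differentiable:
  assumes u [measurable]: "u \<in> borel_measurable M" and int: "integrable M (\<lambda>x. \<bar>u x\<bar> powr q)"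
  shows "\<exists>D. ((\<lambda>\<rho>. potential (\<lambda>x. \<rho> * u x)) has_real_derivative D) (at \<rho>)"
proof -
  define F where "F = (\<lambda>\<rho>. potential (\<lambda>x. \<rho> * u x))"
  define D where "D = (\<integral>x. g x (\<rho> * u x) * u x \<partial>M)"
  have ms: "(\<lambda>x. \<rho> * u x) \<in> borel_measurable M" for \<rho> by measurable
  have pint: "integrable M (\<lambda>x. primitive g x (\<rho> * u x))" for \<rho>
    by (rule primitive_integrable) (use int in \<open>auto simp: abs_mult powr_mult\<close>)
  \<comment> \<open>Accounts for intermediate points of size up to (|\<rho>| + 1)|u x| in the growth
    bound.\<close>
  define B where "B = (\<bar>\<rho>\<bar> + 1) powr (p - 1)"
  have B: "B \<ge> 0" by (simp add: B_def)
  obtain C1 where C1: "C1 \<ge> 0" "\<And>t. \<bar>t\<bar> powr 1 \<le> 1 * \<bar>t\<bar> powr q + C1"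
    using powr_subcritical_le[of 1 1 q] p by auto
  obtain C2 where C2: "C2 \<ge> 0" "\<And>t. \<bar>t\<bar> powr p \<le> 1 * \<bar>t\<bar> powr q + C2"
    using powr_subcritical_le[of 1 p q] p by auto
  define W where "W = (\<lambda>x. c * ((\<bar>u x\<bar> powr q + C1) + B * (\<bar>u x\<bar> powr q + C2)))"
  have "((\<lambda>h. (F (\<rho> + h) - F \<rho>) / h) \<longlongrightarrow> D) (at 0)"
    unfolding tendsto_at_iff_sequentially
  proof (intro allI impI)
    fix X :: "nat \<Rightarrow> real" assume X: "\<forall>i. X i \<in> UNIV - {0}" "X \<longlonglongrightarrow> 0"
    then obtain n0 where n0: "\<And>n. n \<ge> n0 \<Longrightarrow> \<bar>X n\<bar> < 1"
      using LIMSEQ_D[of X 0 1] by auto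
    \<comment> \<open>The shift drops finitely many terms, so that |H n| < 1 at every index, as
      dominated convergence requires.\<close>
    define H where "H = (\<lambda>n. X (n + n0))"
    have H: "H n \<noteq> 0" "\<bar>H n\<bar> < 1" for n using X(1) n0 by (auto simp: H_def)
    have H0: "H \<longlonglongrightarrow> 0" unfolding H_def by (rule LIMSEQ_ignore_initial_segment[OF X(2)])
    define Q where "Q = (\<lambda>n x. (primitive g x ((\<rho> + H n) * u x) - primitive g x (\<rho> * u x)) / H n)"
    have "(\<lambda>n. \<integral>x. Q n x \<partial>M) \<longlonglongrightarrow> D"
      unfolding D_def
    proof (rule integral_dominated_convergence)
      show "(\<lambda>x. g x (\<rho> * u x) * u x) \<in> borel_measurable M"
        using nemytskii_measurable[OF ms] by measurable
      show "Q n \<in> borel_measurable M" for n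
        using primitive_measurable[OF ms] unfolding Q_def by measurable
      show "integrable M W" unfolding W_def using int by simp
      show "AE x in M. (\<lambda>n. Q n x) \<longlonglongrightarrow> g x (\<rho> * u x) * u x"
        using cont
      proof eventually_elim
        case (elim x)
        have "((\<lambda>\<rho>. primitive g x (\<rho> * u x)) has_real_derivative g x (\<rho> * u x) * u x) (at \<rho>)"
          by (rule DERIV_chain2[OF primitive_has_real_derivative[of g x, OF elim]]) (auto intro!: derivative_eq_intros)
        then have "((\<lambda>h. (primitive g x ((\<rho> + h) * u x) - primitive g x (\<rho> * u x)) / h) \<longlongrightarrow> g x (\<rho> * u x) * u x) (at 0)"
          by (simp add: DERIV_def)
        then show ?case using H H0 unfolding tendsto_at_iff_sequentially Q_def by (auto simp: o_def)
      qed
      show "AE x in M. norm (Q n x) \<le> W x" for n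
        using cont growth
      proof eventually_elim
        case (elim x)
        have Wge: "c * (\<bar>u x\<bar> + B * \<bar>u x\<bar> powr p) \<le> W x"
          unfolding W_def using C1(2)[of "u x"] C2(2)[of "u x"] c B
          by (intro mult_left_mono add_mono) auto
        show ?case
        proof (cases "u x = 0")
          case False
          then have ne: "\<rho> * u x \<noteq> (\<rho> + H n) * u x" using H(1)[of n] by simp
          obtain \<theta> where \<theta>: "primitive g x ((\<rho> + H n) * u x) - primitive g x (\<rho> * u x) = ((\<rho> + H n) * u x - \<rho> * u x) * g x \<theta>"
            "min (\<rho> * u x) ((\<rho> + H n) * u x) < \<theta>" "\<theta> < max (\<rho> * u x) ((\<rho> + H n) * u x)"
            using primitive_increment[of g x, OF elim(1) ne] by metis
          have "\<bar>\<theta>\<bar> \<le> max \<bar>\<rho> * u x\<bar> \<bar>(\<rho> + H n) * u x\<bar>" using \<theta>(2,3) by linarith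
          also have "\<dots> \<le> (\<bar>\<rho>\<bar> + 1) * \<bar>u x\<bar>"
            unfolding abs_mult using H(2)[of n] by (intro max.boundedI mult_right_mono) auto
          finally have "\<bar>\<theta>\<bar> powr (p - 1) \<le> ((\<bar>\<rho>\<bar> + 1) * \<bar>u x\<bar>) powr (p - 1)"
            using p by (intro powr_mono2) auto
          also have "\<dots> = B * \<bar>u x\<bar> powr (p - 1)" by (simp add: B_def powr_mult)
          finally have "c * (1 + \<bar>\<theta>\<bar> powr (p - 1)) \<le> c * (1 + B * \<bar>u x\<bar> powr (p - 1))" using c by simp
          then have "\<bar>g x \<theta>\<bar> \<le> c * (1 + B * \<bar>u x\<bar> powr (p - 1))" using elim(2) order_trans by blast
          then have "\<bar>u x\<bar> * \<bar>g x \<theta>\<bar> \<le> \<bar>u x\<bar> * (c * (1 + B * \<bar>u x\<bar> powr (p - 1)))"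
            by (intro mult_left_mono) auto
          also have "\<dots> = c * (\<bar>u x\<bar> + B * \<bar>u x\<bar> powr p)"
            using False by (simp add: powr_diff field_simps)
          finally have "\<bar>u x * g x \<theta>\<bar> \<le> W x" using Wge by (simp add: abs_mult)
          moreover have "Q n x = u x * g x \<theta>"
            unfolding Q_def \<theta>(1) using H(1)[of n] by (simp add: field_simps)
          ultimately show ?thesis by simp
        next
          case True
          then show ?thesis using Wge by (simp add: Q_def)
        qed
      qed
    qed
    moreover have "(\<integral>x. Q n x \<partial>M) = (F (\<rho> + H n) - F \<rho>) / H n" for n
      unfolding Q_def F_def potential_def using pint by simp
    ultimately have "(\<lambda>n. ((\<lambda>h. (F (\<rho> + h) - F \<rho>) / h) \<circ> X) (n + n0)) \<longlonglongrightarrow> D"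
      by (simp add: o_def H_def)
    then show "((\<lambda>h. (F (\<rho> + h) - F \<rho>) / h) \<circ> X) \<longlonglongrightarrow> D" by (rule LIMSEQ_offset)
  qed
  then show ?thesis unfolding F_def[symmetric] by (auto simp: DERIV_def)
qed

end

section \<open>The space \<open>X0\<close>\<close>

lemma lebesgue_integral_cong_AE_complete:
  fixes f h :: "'a::euclidean_space \<Rightarrow> real"
  assumes "f \<in> borel_measurable lebesgue" "AE x in lebesgue. f x = h x"
  shows "(LINT x|lebesgue. f x) = (LINT x|lebesgue. h x)"
  using assms borel_measurable_AE[OF assms] by (intro integral_cong_AE) auto

lemma gagliardo_diff_le: "gagliardo s (\<lambda>x. u x - v x) z \<le> 2 * gagliardo s u z + 2 * gagliardo s v z"
proof (cases z)
  case (Pair x y)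
  have "(u x - v x - (u y - v y))^2 \<le> 2 * (u x - u y)^2 + 2 * (v x - v y)^2"
    using zero_le_power2[of "(u x - u y) + (v x - v y)"] by (simp add: power2_eq_square algebra_simps)
  then show ?thesis unfolding Pair gagliardo_apply
    by (simp add: add_divide_distrib[symmetric] divide_right_mono)
qed

lemma gagliardo_scale: "gagliardo s (\<lambda>x. \<rho> * u x) z = \<rho>^2 * gagliardo s u z"
  by (cases z) (simp add: gagliardo_apply power_mult_distrib flip: right_diff_distrib)

locale critical_space =
  fixes \<Omega> :: "(real^'n) set" and s :: real
  assumes s: "0 < s" "s < 1" and N: "real CARD('n) > 4 * s"
    and \<Omega>: "open \<Omega>" "\<Omega> \<noteq> {}" "bounded \<Omega>"
begin

definition q :: real where "q = crit_exp (real CARD('n)) s"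

text \<open>Borel representatives vanishing identically outside \<open>\<Omega>\<close>: every element of \<open>X0 \<Omega> s\<close> agrees
  almost everywhere with one of them, and for them the Gagliardo integral over \<open>Q_set \<Omega>\<close> is the integral over
  the whole space.\<close>

definition Y :: "(real^'n \<Rightarrow> real) set" where
  "Y = {v. v \<in> borel_measurable borel \<and> (\<forall>x. x \<notin> \<Omega> \<longrightarrow> v x = 0) \<and> gag_nn s v < \<infinity>}"

definition A :: "(real^'n \<Rightarrow> real) \<Rightarrow> real" where
  "A v = (\<integral>z. gagliardo s v z \<partial>lborel)"

definition Z :: "(real^'n \<Rightarrow> real) \<Rightarrow> real" where
  "Z v = (\<integral>x. \<bar>v x\<bar> powr q \<partial>lborel)"

text \<open>The upper bound is equivalent to N > 4s; it is the reason why the quartic term prevails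
  over the critical one at infinity.\<close>

lemma q: "2 < q" "q < 4"
  using s N by (auto simp: q_def crit_exp_def field_simps)

lemma Omega_borel [measurable]: "\<Omega> \<in> sets borel" using \<Omega> by simp

lemma Omega_lebesgue [measurable]: "\<Omega> \<in> sets lebesgue" using \<Omega> by auto

lemma Omega_finite: "emeasure lborel \<Omega> < \<infinity>"
  using emeasure_bounded_finite[OF \<Omega>(3)] by simp

lemma Omega_indicator_integrable: "integrable lborel (\<lambda>x. indicator \<Omega> x :: real)"
  using Omega_finite by simp

lemma Y_measurable: "v \<in> Y \<Longrightarrow> v \<in> borel_measurable borel"
  and Y_support: "v \<in> Y \<Longrightarrow> x \<notin> \<Omega> \<Longrightarrow> v x = 0"
  by (auto simp: Y_def)

lemma Y_gagliardo_integrable: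
  assumes "v \<in> Y" shows "integrable lborel (gagliardo s v)"
  by (rule integrableI_nonneg)
     (use assms gagliardo_measurable[OF Y_measurable] in \<open>auto simp: Y_def gag_nn_def gagliardo_nonneg\<close>)

lemma A_nonneg: "A v \<ge> 0" unfolding A_def by (simp add: gagliardo_nonneg)

lemma Z_nonneg: "Z v \<ge> 0" unfolding Z_def by simp

lemma gag_nn_eq_A: "v \<in> Y \<Longrightarrow> gag_nn s v = ennreal (A v)"
  unfolding gag_nn_def A_def
  by (rule nn_integral_eq_integral[OF Y_gagliardo_integrable]) (auto simp: gagliardo_nonneg)

lemma YI:
  assumes "v \<in> borel_measurable borel" "\<And>x. x \<notin> \<Omega> \<Longrightarrow> v x = 0" "integrable lborel (gagliardo s v)"
  shows "v \<in> Y"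
proof -
  have "gag_nn s v = ennreal (A v)" unfolding gag_nn_def A_def
    by (rule nn_integral_eq_integral[OF assms(3)]) (auto simp: gagliardo_nonneg)
  then show ?thesis using assms by (auto simp: Y_def)
qed

lemma Y_diff:
  assumes "u \<in> Y" "v \<in> Y" shows "(\<lambda>x. u x - v x) \<in> Y"
proof (rule YI)
  note [measurable] = Y_measurable[OF assms(1)] Y_measurable[OF assms(2)]
  show m: "(\<lambda>x. u x - v x) \<in> borel_measurable borel" by measurable
  show "integrable lborel (gagliardo s (\<lambda>x. u x - v x))"
  proof (rule Bochner_Integration.integrable_bound)
    show "integrable lborel (\<lambda>z. 2 * gagliardo s u z + 2 * gagliardo s v z)"
      using Y_gagliardo_integrable[OF assms(1)] Y_gagliardo_integrable[OF assms(2)] by simp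
    show "gagliardo s (\<lambda>x. u x - v x) \<in> borel_measurable lborel"
      using gagliardo_measurable[OF m] by simp
    have "norm (gagliardo s (\<lambda>x. u x - v x) z) \<le> norm (2 * gagliardo s u z + 2 * gagliardo s v z)" for z
      using gagliardo_diff_le[of s u v z] gagliardo_nonneg[of s "\<lambda>x. u x - v x" z] by simp
    then show "AE z in lborel. norm (gagliardo s (\<lambda>x. u x - v x) z) \<le> norm (2 * gagliardo s u z + 2 * gagliardo s v z)"
      by simp
  qed
qed (simp add: Y_support[OF assms(1)] Y_support[OF assms(2)])

lemma Y_scale:
  assumes "u \<in> Y" shows "(\<lambda>x. \<rho> * u x) \<in> Y"
proof (rule YI)
  note [measurable] = Y_measurable[OF assms]
  show "(\<lambda>x. \<rho> * u x) \<in> borel_measurable borel" by measurable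
  show "integrable lborel (gagliardo s (\<lambda>x. \<rho> * u x))"
    using Y_gagliardo_integrable[OF assms] by (simp add: gagliardo_scale[abs_def])
qed (use assms Y_support in auto)

lemma A_scale: "A (\<lambda>x. \<rho> * u x) = \<rho>^2 * A u"
  by (simp add: A_def gagliardo_scale)

lemma Z_scale: "Z (\<lambda>x. \<rho> * u x) = \<bar>\<rho>\<bar> powr q * Z u"
  by (simp add: Z_def abs_mult powr_mult)

lemma sobolev_Y:
  obtains C where "C > 0" "\<And>v. v \<in> Y \<Longrightarrow> integrable lborel (\<lambda>x. \<bar>v x\<bar> powr q)"
    "\<And>v. v \<in> Y \<Longrightarrow> Z v \<le> C * A v powr (q / 2)"
proof -
  obtain C where C: "C > 0"
    "\<And>(v :: real^'n \<Rightarrow> real) E. v \<in> borel_measurable borel \<Longrightarrow> bounded {x. v x \<noteq> 0} \<Longrightarrow>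
       gag_nn s v \<le> ennreal E \<Longrightarrow> E \<ge> 0 \<Longrightarrow>
       integrable lborel (\<lambda>x. \<bar>v x\<bar> powr q) \<and> (\<integral>x. \<bar>v x\<bar> powr q \<partial>lborel) \<le> C * E powr (q / 2)"
    using sobolev[of s, where 'n = 'n] s N unfolding q_def by auto
  have *: "integrable lborel (\<lambda>x. \<bar>v x\<bar> powr q) \<and> Z v \<le> C * A v powr (q / 2)" if "v \<in> Y" for v
    unfolding Z_def
  proof (rule C(2)[OF Y_measurable[OF that]])
    show "bounded {x. v x \<noteq> 0}" by (rule bounded_subset[OF \<Omega>(3)]) (use Y_support[OF that] in auto)
    show "gag_nn s v \<le> ennreal (A v)" using gag_nn_eq_A[OF that] by simp
  qed (rule A_nonneg)
  show ?thesis using that[OF C(1)] * by blast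
qed

lemma Y_integrable_powr: "v \<in> Y \<Longrightarrow> integrable lborel (\<lambda>x. \<bar>v x\<bar> powr q)"
  by (rule sobolev_Y) blast

lemma AE_zero_if_A_zero:
  assumes "v \<in> Y" "A v = 0" shows "AE x in lborel. v x = 0"
proof -
  obtain C where "Z v \<le> C * A v powr (q / 2)" using sobolev_Y assms by metis
  then have "Z v = 0" using Z_nonneg[of v] assms(2) by simp
  then have "AE x in lborel. \<bar>v x\<bar> powr q = 0"
    using integral_nonneg_eq_0_iff_AE[OF Y_integrable_powr[OF assms(1)]] by (simp add: Z_def)
  then show ?thesis by eventually_elim auto
qed

lemma A_zero_if_AE_zero:
  assumes "v \<in> Y" "AE x in lborel. v x = 0" shows "A v = 0"
proof -
  have "A v = (\<integral>z. 0 \<partial>(lborel :: ((real^'n) \<times> (real^'n)) measure))"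
    unfolding A_def
  proof (rule integral_cong_AE)
    show "AE z in lborel. gagliardo s v z = 0"
      using AE_lborel_pair[OF assms(2)] by eventually_elim (auto simp: gagliardo_def split_beta)
  qed (use gagliardo_measurable[OF Y_measurable[OF assms(1)]] in auto)
  then show ?thesis by simp
qed

lemma A_pos_iff: "v \<in> Y \<Longrightarrow> A v > 0 \<longleftrightarrow> \<not> (AE x in lborel. v x = 0)"
  using AE_zero_if_A_zero[of v] A_zero_if_AE_zero[of v] A_nonneg[of v] by (cases "A v = 0") auto

lemma Z_pos: assumes "v \<in> Y" "A v > 0" shows "Z v > 0"
proof (rule ccontr)
  assume "\<not> Z v > 0"
  then have "Z v = 0" using Z_nonneg[of v] by simp
  then have "AE x in lborel. \<bar>v x\<bar> powr q = 0"
    using integral_nonneg_eq_0_iff_AE[OF Y_integrable_powr[OF assms(1)]] by (simp add: Z_def)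
  then have "AE x in lborel. v x = 0" by eventually_elim auto
  then show False using assms A_pos_iff by blast
qed

text \<open>Since k <= 2 < q, |v|^k is at most 1 where |v| <= 1 and at most |v|^q elsewhere. The
  case k = 1 feeds compactness, k = 2 the Poincare inequality.\<close>

lemma Y_power_bound:
  assumes "v \<in> Y" "k = 1 \<or> k = 2"
  shows "integrable lborel (\<lambda>x. \<bar>v x\<bar> ^ k)" "(\<integral>x. \<bar>v x\<bar> ^ k \<partial>lborel) \<le> measure lborel \<Omega> + Z v"
proof -
  note [measurable] = Y_measurable[OF assms(1)]
  have le: "\<bar>v x\<bar> ^ k \<le> indicator \<Omega> x + \<bar>v x\<bar> powr q" for x
  proof (cases "v x = 0 \<or> \<bar>v x\<bar> \<le> 1")
    case True
    then show ?thesis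
    proof
      assume "\<bar>v x\<bar> \<le> 1"
      then have "\<bar>v x\<bar> ^ k \<le> 1" by (simp add: power_le_one)
      then show ?thesis using Y_support[OF assms(1), of x] assms(2)
        by (cases "x \<in> \<Omega>") (auto intro: order_trans)
    qed (use assms(2) in auto)
  next
    case False
    then have "\<bar>v x\<bar> ^ k = \<bar>v x\<bar> powr real k" by (simp add: powr_realpow)
    also have "\<dots> \<le> \<bar>v x\<bar> powr q" using False assms(2) q by (intro powr_mono) auto
    finally show ?thesis by (simp add: add_increasing)
  qed
  have int: "integrable lborel (\<lambda>x. indicator \<Omega> x + \<bar>v x\<bar> powr q)"
    using Omega_indicator_integrable Y_integrable_powr[OF assms(1)] by (rule Bochner_Integration.integrable_add)
  show i: "integrable lborel (\<lambda>x. \<bar>v x\<bar> ^ k)"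
    by (rule Bochner_Integration.integrable_bound[OF int]) (use le in \<open>auto intro: order_trans[OF _ abs_ge_self]\<close>)
  have "(\<integral>x. \<bar>v x\<bar> ^ k \<partial>lborel) \<le> (\<integral>x. indicator \<Omega> x + \<bar>v x\<bar> powr q \<partial>lborel)"
    by (rule integral_mono[OF i int le])
  also have "\<dots> = measure lborel \<Omega> + Z v"
    using Omega_indicator_integrable Y_integrable_powr[OF assms(1)] by (simp add: Z_def)
  finally show "(\<integral>x. \<bar>v x\<bar> ^ k \<partial>lborel) \<le> measure lborel \<Omega> + Z v" .
qed

text \<open>Normalizing to A w = 1 turns the inhomogeneous bound of \<open>Y_power_bound\<close>
  into a homogeneous one.\<close>

lemma poincare:
  obtains C where "C > 0" "\<And>v. v \<in> Y \<Longrightarrow> (\<integral>x. (v x)^2 \<partial>lborel) \<le> C * A v"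
proof -
  obtain C where C: "C > 0" "\<And>v. v \<in> Y \<Longrightarrow> Z v \<le> C * A v powr (q / 2)" using sobolev_Y by metis
  show ?thesis
  proof (rule that)
    show "measure lborel \<Omega> + C > 0" using C(1) by (simp add: add_nonneg_pos)
    fix v assume v: "v \<in> Y"
    show "(\<integral>x. (v x)^2 \<partial>lborel) \<le> (measure lborel \<Omega> + C) * A v"
    proof (cases "A v = 0")
      case True
      have "AE x in lborel. (v x)^2 = 0" using AE_zero_if_A_zero[OF v True] by eventually_elim simp
      then have "(\<integral>x. (v x)^2 \<partial>lborel) = (\<integral>x. 0 \<partial>(lborel :: (real^'n) measure))"
        using Y_measurable[OF v] by (intro integral_cong_AE) auto
      then show ?thesis using True by simp
    next
      case False
      then have Av: "A v > 0" using A_nonneg[of v] by simp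
      define w where "w = (\<lambda>x. 1 / sqrt (A v) * v x)"
      have w: "w \<in> Y" unfolding w_def by (rule Y_scale[OF v])
      have Aw: "A w = 1" using Av unfolding w_def A_scale by (simp add: power_divide)
      have "(\<integral>x. \<bar>w x\<bar>^2 \<partial>lborel) \<le> measure lborel \<Omega> + C"
        using Y_power_bound(2)[OF w, of 2] C(2)[OF w] Aw by simp
      moreover have "(\<integral>x. \<bar>w x\<bar>^2 \<partial>lborel) = (\<integral>x. (v x)^2 \<partial>lborel) / A v"
        using Av by (simp add: w_def power_mult_distrib power_divide)
      ultimately show ?thesis using Av by (simp add: divide_le_eq)
    qed
  qed
qed

section \<open>Transfer between \<open>X0\<close> and Borel representatives\<close>

lemma Q_set_open: "open (Q_set \<Omega>)"
proof -
  have "closed ((- \<Omega>) \<times> (- \<Omega>))" using \<Omega> by (intro closed_Times) auto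
  then show ?thesis unfolding Q_set_def by (simp add: open_Diff)
qed

lemma set_integral_Y:
  fixes f :: "'b::euclidean_space \<Rightarrow> real"
  assumes "open S" "f \<in> borel_measurable borel" "\<And>x. x \<notin> S \<Longrightarrow> f x = 0"
  shows "(LINT x:S|lebesgue. f x) = (\<integral>x. f x \<partial>lborel)"
    "set_integrable lebesgue S f \<longleftrightarrow> integrable lborel f"
proof -
  have "indicator S x *\<^sub>R f x = f x" for x using assms(3)[of x] by (cases "x \<in> S") auto
  then have "(\<lambda>x. indicator S x *\<^sub>R f x) = f" by (rule ext)
  then show "(LINT x:S|lebesgue. f x) = (\<integral>x. f x \<partial>lborel)" "set_integrable lebesgue S f \<longleftrightarrow> integrable lborel f"
    using assms(2) by (simp_all add: set_lebesgue_integral_def set_integrable_def integral_completion integrable_completion)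
qed

lemma gagliardo_outside_Q: "v \<in> Y \<Longrightarrow> z \<notin> Q_set \<Omega> \<Longrightarrow> gagliardo s v z = 0"
  by (cases z) (auto simp: Q_set_def gagliardo_apply Y_support)

lemma X0_norm_Y: assumes "v \<in> Y" shows "X0_norm \<Omega> s v = sqrt (A v)"
  unfolding X0_norm_def A_def
  using set_integral_Y(1)[OF Q_set_open gagliardo_measurable[OF Y_measurable[OF assms]] gagliardo_outside_Q[OF assms]]
  by simp

lemma Lq_norm_Y: assumes "v \<in> Y" shows "Lq_norm \<Omega> q v = Z v powr (1 / q)"
proof -
  have "(\<lambda>x. \<bar>v x\<bar> powr q) \<in> borel_measurable borel" using Y_measurable[OF assms] by measurable
  from set_integral_Y(1)[OF \<Omega>(1) this] show ?thesis
    using Y_support[OF assms] by (simp add: Lq_norm_def Z_def)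
qed

lemma Y_subset_X0: assumes v: "v \<in> Y" shows "v \<in> X0 \<Omega> s"
proof -
  note [measurable] = Y_measurable[OF v]
  have "(\<lambda>x. (v x)^2) \<in> borel_measurable borel" by measurable
  from set_integral_Y(2)[OF \<Omega>(1) this] have "set_integrable lebesgue \<Omega> (\<lambda>x. (v x)^2)"
    using Y_support[OF v] Y_power_bound(1)[OF v, of 2] by simp
  moreover have "set_integrable lebesgue (Q_set \<Omega>) (gagliardo s v)"
    using set_integral_Y(2)[OF Q_set_open gagliardo_measurable[OF Y_measurable[OF v]] gagliardo_outside_Q[OF v]]
      Y_gagliardo_integrable[OF v] by simp
  ultimately show ?thesis using Y_support[OF v] by (auto simp: X0_def measurable_completion)
qed

lemma gagliardo_cong_AE:
  fixes u v :: "real^'n \<Rightarrow> real"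
  assumes "AE x in lebesgue. u x = v x"
  shows "AE z in lebesgue. gagliardo s u z = gagliardo s v z"
proof -
  have "AE x in lborel. u x = v x" using assms by (simp add: AE_completion_iff)
  from AE_lborel_pair[OF this] have "AE z in lborel. gagliardo s u z = gagliardo s v z"
    by eventually_elim (simp add: gagliardo_def split_beta)
  then show ?thesis by (simp add: AE_completion_iff)
qed

lemma X0_representative:
  assumes u: "u \<in> X0 \<Omega> s"
  obtains v where "v \<in> Y" "AE x in lebesgue. v x = u x"
proof -
  have um: "u \<in> borel_measurable lebesgue" and ui: "set_integrable lebesgue (Q_set \<Omega>) (gagliardo s u)"
    and u0: "AE x in lebesgue. x \<notin> \<Omega> \<longrightarrow> u x = 0"
    using u by (auto simp: X0_def)
  obtain u' where u' [measurable]: "u' \<in> borel_measurable lborel" and ae: "AE x in lborel. u x = u' x"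
    using completion_ex_borel_measurable_real[OF um] by blast
  define v where "v = (\<lambda>x. indicator \<Omega> x * u' x)"
  have vm [measurable]: "v \<in> borel_measurable borel" unfolding v_def using u' by measurable
  have "AE x in lebesgue. u x = u' x" using ae by (simp add: AE_completion_iff)
  then have vu: "AE x in lebesgue. v x = u x" using u0 by eventually_elim (auto simp: v_def indicator_def)
  have off: "v x = 0" if "x \<notin> \<Omega>" for x using that by (simp add: v_def)
  have "AE z in lebesgue. indicator (Q_set \<Omega>) z *\<^sub>R gagliardo s u z = gagliardo s v z"
    using gagliardo_cong_AE[OF vu]
  proof eventually_elim
    case (elim z)
    show ?case
    proof (cases "z \<in> Q_set \<Omega>")
      case False
      then have "gagliardo s v z = 0" using off by (cases z) (auto simp: Q_set_def gagliardo_apply)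
      then show ?thesis using False by simp
    qed (use elim in simp)
  qed
  then have "integrable lebesgue (gagliardo s v)"
    using ui unfolding set_integrable_def
    by (rule integrable_cong_AE_imp[rotated 2]) (auto intro: measurable_completion)
  then have "integrable lborel (gagliardo s v)" by (subst (asm) integrable_completion) auto
  then have "v \<in> Y" using off by (intro YI) auto
  then show ?thesis using that vu by blast
qed

lemma X0_norm_cong_AE:
  assumes "v \<in> Y" "AE x in lebesgue. v x = u x"
  shows "X0_norm \<Omega> s u = X0_norm \<Omega> s v"
proof -
  have "gagliardo s v \<in> borel_measurable lebesgue"
    by (rule measurable_completion) (simp add: gagliardo_measurable[OF Y_measurable[OF assms(1)]])
  moreover have "indicator (Q_set \<Omega>) \<in> borel_measurable (lebesgue :: ((real^'n) \<times> (real^'n)) measure)"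
    using Q_set_open by (intro borel_measurable_indicator) auto
  ultimately have m: "(\<lambda>z. indicator (Q_set \<Omega>) z *\<^sub>R gagliardo s v z) \<in> borel_measurable lebesgue"
    unfolding real_scaleR_def by (intro borel_measurable_times)
  have "AE z in lebesgue. indicator (Q_set \<Omega>) z *\<^sub>R gagliardo s v z = indicator (Q_set \<Omega>) z *\<^sub>R gagliardo s u z"
    using gagliardo_cong_AE[OF assms(2)] by eventually_elim simp
  from lebesgue_integral_cong_AE_complete[OF m this] show ?thesis
    unfolding X0_norm_def set_lebesgue_integral_def by simp
qed

lemma Lq_norm_cong_AE:
  assumes "v \<in> Y" "AE x in lebesgue. v x = u x"
  shows "Lq_norm \<Omega> q u = Lq_norm \<Omega> q v"
proof -
  have m: "(\<lambda>x. indicator \<Omega> x *\<^sub>R (\<bar>v x\<bar> powr q)) \<in> borel_measurable lebesgue"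
    by (rule measurable_completion) (use Y_measurable[OF assms(1)] in measurable)
  have "AE x in lebesgue. indicator \<Omega> x *\<^sub>R (\<bar>v x\<bar> powr q) = indicator \<Omega> x *\<^sub>R (\<bar>u x\<bar> powr q)"
    using assms(2) by eventually_elim simp
  from lebesgue_integral_cong_AE_complete[OF m this] show ?thesis
    unfolding Lq_norm_def set_lebesgue_integral_def by simp
qed

lemma X0_nonzero_representative:
  assumes "u \<in> X0_nonzero \<Omega> s"
  obtains v where "v \<in> Y" "A v > 0" "AE x in lebesgue. v x = u x"
proof -
  have u: "u \<in> X0 \<Omega> s" "\<not> (AE x in lebesgue. u x = 0)" using assms by (auto simp: X0_nonzero_def)
  obtain v where v: "v \<in> Y" "AE x in lebesgue. v x = u x" using X0_representative[OF u(1)] by blast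
  have "\<not> (AE x in lebesgue. v x = 0)"
  proof
    assume "AE x in lebesgue. v x = 0"
    then have "AE x in lebesgue. u x = 0" using v(2) by eventually_elim simp
    then show False using u by simp
  qed
  then have "A v > 0" using A_pos_iff[OF v(1)] by (simp add: AE_completion_iff)
  then show ?thesis using that v by blast
qed

lemma Y_nonzero: "v \<in> Y \<Longrightarrow> A v > 0 \<Longrightarrow> v \<in> X0_nonzero \<Omega> s"
  using Y_subset_X0[of v] A_pos_iff[of v] by (simp add: X0_nonzero_def AE_completion_iff)

lemma Y_nontrivial: "\<exists>v\<in>Y. A v > 0"
proof -
  obtain v :: "real^'n \<Rightarrow> real" where "v \<in> borel_measurable borel" "\<And>x. x \<notin> \<Omega> \<Longrightarrow> v x = 0"
    "gag_nn s v < \<infinity>" "\<not> (AE x in lborel. v x = 0)"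
    using gagliardo_bump[OF s \<Omega>(1,2)] by blast
  then have "v \<in> Y" "\<not> (AE x in lborel. v x = 0)" by (auto simp: Y_def)
  then show ?thesis using A_pos_iff by blast
qed

text \<open>If Z v = 0, both quotients are divisions by zero and hence 0.\<close>

lemma sobolev_quotient_Y:
  assumes "v \<in> Y"
  shows "(X0_norm \<Omega> s v)^2 / (Lq_norm \<Omega> q v)^2 = A v / Z v powr (2 / q)"
  using Z_nonneg[of v] A_nonneg[of v]
  by (cases "Z v = 0") (simp_all add: X0_norm_Y[OF assms] Lq_norm_Y[OF assms] powr_power)

text \<open>\<open>sobolev_Y\<close> bounds all quotients below by a positive constant, and
  \<open>Y_nontrivial\<close> ensures that the infimum is over a nonempty set. Being a lower bound,
  the infimum then gives the inequality with its own constant.\<close>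

lemma S_const_pos: "S_const \<Omega> s > 0"
  and S_const_sobolev: "v \<in> Y \<Longrightarrow> Z v \<le> (A v / S_const \<Omega> s) powr (q / 2)"
proof -
  define R where "R = (\<lambda>u. (X0_norm \<Omega> s u)^2 / (Lq_norm \<Omega> q u)^2)"
  have S: "S_const \<Omega> s = (INF u\<in>X0_nonzero \<Omega> s. R u)" by (simp add: S_const_def R_def q_def)
  obtain C where C: "C > 0" "\<And>v. v \<in> Y \<Longrightarrow> Z v \<le> C * A v powr (q / 2)" using sobolev_Y by metis
  have low: "1 / C powr (2 / q) \<le> R u" if u: "u \<in> X0_nonzero \<Omega> s" for u
  proof -
    obtain v where v: "v \<in> Y" "A v > 0" "AE x in lebesgue. v x = u x"
      using X0_nonzero_representative[OF u] by blast
    have R: "R u = A v / Z v powr (2 / q)"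
      using sobolev_quotient_Y[OF v(1)] X0_norm_cong_AE[OF v(1,3)] Lq_norm_cong_AE[OF v(1,3)] by (simp add: R_def)
    have "Z v powr (2 / q) \<le> (C * A v powr (q / 2)) powr (2 / q)"
      using C(2)[OF v(1)] Z_nonneg[of v] q by (intro powr_mono2) auto
    also have "\<dots> = C powr (2 / q) * A v"
      using C(1) v(2) q by (simp add: powr_mult powr_powr)
    finally have "A v / (C powr (2 / q) * A v) \<le> A v / Z v powr (2 / q)"
      by (rule divide_left_mono) (use Z_pos[OF v(1,2)] v(2) C(1) in auto)
    then show ?thesis using v(2) by (simp add: R)
  qed
  have ne: "X0_nonzero \<Omega> s \<noteq> {}" using Y_nontrivial Y_nonzero by blast
  have "1 / C powr (2 / q) \<le> S_const \<Omega> s" unfolding S by (rule cINF_greatest[OF ne low])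
  moreover have "1 / C powr (2 / q) > 0" using C(1) by simp
  ultimately show S0: "S_const \<Omega> s > 0" by linarith
  assume v: "v \<in> Y"
  show "Z v \<le> (A v / S_const \<Omega> s) powr (q / 2)"
  proof (cases "A v = 0")
    case True
    then show ?thesis using C(2)[OF v] by simp
  next
    case False
    then have Av: "A v > 0" using A_nonneg[of v] by simp
    have "S_const \<Omega> s \<le> R v" unfolding S
      by (rule cINF_lower[OF bdd_belowI2[OF low] Y_nonzero[OF v Av]])
    then have "S_const \<Omega> s \<le> A v / Z v powr (2 / q)"
      using sobolev_quotient_Y[OF v] by (simp add: R_def)
    then have "Z v powr (2 / q) \<le> A v / S_const \<Omega> s"
      using S0 Z_pos[OF v Av] by (simp add: field_simps)
    then have "(Z v powr (2 / q)) powr (q / 2) \<le> (A v / S_const \<Omega> s) powr (q / 2)"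
      using q by (intro powr_mono2) auto
    then show ?thesis using Z_nonneg[of v] q by (simp add: powr_powr)
  qed
qed

text \<open>The Sobolev inequality bounds the L^q and, on a set of finite measure, the L^1 norms, as
  almost everywhere compactness requires. The two splittings are then instances of
  Brezis-Lieb.\<close>

lemma Y_compactness:
  fixes v :: "nat \<Rightarrow> real^'n \<Rightarrow> real"
  assumes v: "\<And>n. v n \<in> Y" and B: "\<And>n. A (v n) \<le> B"
  obtains r w where "strict_mono r" "w \<in> Y" "AE x in lborel. (\<lambda>n. v (r n) x) \<longlonglongrightarrow> w x"
    "(\<lambda>n. A (v (r n)) - A (\<lambda>x. v (r n) x - w x)) \<longlonglongrightarrow> A w"
    "(\<lambda>n. Z (v (r n)) - Z (\<lambda>x. v (r n) x - w x)) \<longlonglongrightarrow> Z w"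
proof -
  have B0: "B \<ge> 0" using B[of 0] A_nonneg[of "v 0"] by simp
  obtain C where C: "C > 0" "\<And>v. v \<in> Y \<Longrightarrow> Z v \<le> C * A v powr (q / 2)" using sobolev_Y by metis
  define K where "K = C * B powr (q / 2)"
  have ZK: "Z (v n) \<le> K" for n
  proof -
    have "C * A (v n) powr (q / 2) \<le> K" unfolding K_def
      using B[of n] A_nonneg q C(1) by (intro mult_left_mono powr_mono2) auto
    then show ?thesis using C(2)[OF v[of n]] by simp
  qed
  note vm = Y_measurable[OF v]
  have abs1: "integrable lborel (\<lambda>x. \<bar>v n x\<bar>)" "(\<integral>x. \<bar>v n x\<bar> \<partial>lborel) \<le> measure lborel \<Omega> + K" for n
    using Y_power_bound[OF v[of n], of 1] ZK[of n] by auto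
  have i1: "integrable lborel (v n)" for n
    using abs1(1)[of n] vm[of n] by (subst integrable_norm_iff[symmetric]) auto
  have nn: "gag_nn s (v n) \<le> ennreal B" for n
    unfolding gag_nn_eq_A[OF v] by (rule ennreal_leI[OF B])
  have supp: "v n x = 0" if "x \<notin> \<Omega>" for n x using Y_support[OF v that] .
  obtain r w where r: "strict_mono r" and w: "w \<in> borel_measurable borel" "\<And>x. x \<notin> \<Omega> \<Longrightarrow> w x = 0"
    "AE x in lborel. (\<lambda>n. v (r n) x) \<longlonglongrightarrow> w x" "gag_nn s w \<le> ennreal B"
    by (rule gagliardo_compactness[of s \<Omega> v "measure lborel \<Omega> + K" B, OF s(1) Omega_borel Omega_finite vm _ i1 abs1(2) nn B0])
       (erule supp, rule that)
  have wY: "w \<in> Y" using w(1,2) le_less_trans[OF w(4) ennreal_less_top] by (simp add: Y_def)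
  have Zlim: "(\<lambda>n. Z (v (r n)) - Z (\<lambda>x. v (r n) x - w x)) \<longlonglongrightarrow> Z w"
    unfolding Z_def
  proof (rule brezis_lieb(3))
    show "q > 0" using q by simp
    show "(\<integral>x. \<bar>v (r n) x\<bar> powr q \<partial>lborel) \<le> K" for n using ZK[of "r n"] by (simp add: Z_def)
  qed (use vm w Y_integrable_powr[OF v] in auto)
  \<comment> \<open>The signed difference quotient, whose square is the Gagliardo integrand. It is
    linear in u, so Brezis-Lieb with exponent 2 on the product space splits A; this takes the place
    of weak convergence in the Hilbert space.\<close>
  define F where "F = (\<lambda>u :: real^'n \<Rightarrow> real. \<lambda>z. (u (fst z) - u (snd z)) / sqrt (norm (fst z - snd z) powr (real CARD('n) + 2 * s)))"
  have Fg: "\<bar>F u z\<bar> powr 2 = gagliardo s u z" for u z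
    by (simp add: F_def gagliardo_def split_beta power_divide)
  have Fm: "F u \<in> borel_measurable borel" if [measurable]: "u \<in> borel_measurable borel" for u
  proof -
    have "F u \<in> borel_measurable (borel \<Otimes>\<^sub>M borel)" unfolding F_def by measurable
    then show ?thesis by (simp add: borel_prod)
  qed
  have Fd: "F u z - F w z = F (\<lambda>x. u x - w x) z" for u z
    unfolding F_def by (simp add: diff_divide_distrib[symmetric])
  have "(\<lambda>n. (\<integral>z. \<bar>F (v (r n)) z\<bar> powr 2 \<partial>lborel) - (\<integral>z. \<bar>F (v (r n)) z - F w z\<bar> powr 2 \<partial>lborel)) \<longlonglongrightarrow> (\<integral>z. \<bar>F w z\<bar> powr 2 \<partial>lborel)"
  proof (rule brezis_lieb(3))
    show "AE z in lborel. (\<lambda>n. F (v (r n)) z) \<longlonglongrightarrow> F w z"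
      using AE_lborel_pair[OF w(3)]
      by eventually_elim (auto simp: F_def divide_inverse intro!: tendsto_intros)
    show "integrable lborel (\<lambda>z. \<bar>F (v (r n)) z\<bar> powr 2)" for n
      unfolding Fg by (rule Y_gagliardo_integrable[OF v])
    show "(\<integral>z. \<bar>F (v (r n)) z\<bar> powr 2 \<partial>lborel) \<le> B" for n
      unfolding Fg A_def[symmetric] by (rule B)
  qed (use Fm[OF vm] Fm[OF w(1)] in auto)
  then have "(\<lambda>n. A (v (r n)) - A (\<lambda>x. v (r n) x - w x)) \<longlonglongrightarrow> A w"
    unfolding Fd Fg A_def[symmetric] .
  from that[OF r wY w(3) this Zlim] show ?thesis .
qed

end

section \<open>The variational problem\<close>

locale kirchhoff_problem = critical_space \<Omega> s
  for \<Omega> :: "(real^'n) set" and s :: real +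
  fixes g :: "real^'n \<Rightarrow> real \<Rightarrow> real" and a b c p :: real
  assumes H1: "caratheodory \<Omega> g"
    and H2: "AE x\<in>\<Omega> in lebesgue. (\<forall>t>0. g x t > 0) \<and> (\<forall>t<0. g x t < 0)"
    and H3: "c > 0" "2 < p" "p < crit_exp (real CARD('n)) s"
      "AE x\<in>\<Omega> in lebesgue. \<forall>t. \<bar>g x t\<bar> \<le> c * (1 + \<bar>t\<bar> powr (p - 1))"
    and H4: "uniform_limit \<Omega> (\<lambda>t x. g x t / \<bar>t\<bar>) (\<lambda>x. 0) (at 0)"
    and ab: "a > 0" "b > 0"
      "a powr ((real CARD('n) - 4 * s) / (2 * s)) * b > L_const \<Omega> s"
begin

lemma AE_lebesgue_on_Omega: "(AE x in lebesgue_on \<Omega>. P x) \<longleftrightarrow> (AE x\<in>\<Omega> in lebesgue. P x)"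
  using Omega_lebesgue by (simp add: AE_restrict_space_iff)

sublocale nl: subcritical_nonlinearity "lebesgue_on \<Omega>" g c p q
proof -
  interpret complete_measure "lebesgue_on \<Omega>" by (rule complete_measure_lebesgue_on[OF Omega_lebesgue])
  have "emeasure lebesgue \<Omega> < \<infinity>" using Omega_finite by simp
  then have fin: "finite_measure (lebesgue_on \<Omega>)"
    by (intro finite_measureI) (simp add: emeasure_restrict_space space_restrict_space)
  show "subcritical_nonlinearity (lebesgue_on \<Omega>) g c p q"
  proof (intro subcritical_nonlinearity.intro subcritical_nonlinearity_axioms.intro)
    show "finite_measure (lebesgue_on \<Omega>)" by (rule fin)
    show "complete_measure (lebesgue_on \<Omega>)" by (rule complete_measure_axioms)
    show "(\<lambda>x. g x t) \<in> borel_measurable (lebesgue_on \<Omega>)" for t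
      using H1 by (simp add: caratheodory_def)
    show "AE x in lebesgue_on \<Omega>. continuous_on UNIV (g x)"
      using H1 by (simp add: caratheodory_def AE_lebesgue_on_Omega)
    show "AE x in lebesgue_on \<Omega>. (\<forall>t>0. g x t > 0) \<and> (\<forall>t<0. g x t < 0)"
      unfolding AE_lebesgue_on_Omega by (rule H2)
    show "AE x in lebesgue_on \<Omega>. \<forall>t. \<bar>g x t\<bar> \<le> c * (1 + \<bar>t\<bar> powr (p - 1))"
      unfolding AE_lebesgue_on_Omega by (rule H3(4))
    show "c > 0" "2 < p" "p < q" using H3 by (auto simp: q_def)
    fix e :: real assume e: "e > 0"
    obtain d where d: "d > 0" "\<And>t x. t \<noteq> 0 \<Longrightarrow> \<bar>t\<bar> < d \<Longrightarrow> x \<in> \<Omega> \<Longrightarrow> \<bar>g x t / \<bar>t\<bar>\<bar> < e"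
      using H4 e unfolding uniform_limit_iff eventually_at by (auto simp: dist_real_def)
    have "\<bar>g x t\<bar> \<le> e * \<bar>t\<bar>" if "\<bar>t\<bar> < d" "t \<noteq> 0" "x \<in> \<Omega>" for x t
      using d(2)[OF that(2,1,3)] that(2) by (simp add: abs_divide divide_less_eq)
    then show "\<exists>d>0. AE x in lebesgue_on \<Omega>. \<forall>t. \<bar>t\<bar> < d \<longrightarrow> t \<noteq> 0 \<longrightarrow> \<bar>g x t\<bar> \<le> e * \<bar>t\<bar>"
      using d(1) by (intro exI[of _ d]) (auto intro!: AE_I2 simp: space_restrict_space)
  qed
qed

abbreviation \<Gamma> :: "(real^'n \<Rightarrow> real) \<Rightarrow> real" where "\<Gamma> \<equiv> nl.potential"

definition \<Phi> :: "(real^'n \<Rightarrow> real) \<Rightarrow> real" where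
  "\<Phi> v = a / 2 * A v + b / 4 * (A v)^2 - Z v / q"

lemma Y_measurable_on: "v \<in> Y \<Longrightarrow> v \<in> borel_measurable (lebesgue_on \<Omega>)"
  by (intro measurable_restrict_space1 measurable_completion) (simp add: Y_measurable)

lemma integral_on_Omega:
  fixes f :: "real^'n \<Rightarrow> real"
  assumes "f \<in> borel_measurable borel" "\<And>x. x \<notin> \<Omega> \<Longrightarrow> f x = 0"
  shows "(\<integral>x. f x \<partial>lebesgue_on \<Omega>) = (\<integral>x. f x \<partial>lborel)"
    "integrable (lebesgue_on \<Omega>) f \<longleftrightarrow> integrable lborel f"
  using set_integral_Y[OF \<Omega>(1) assms]
  by (simp_all add: set_lebesgue_integral_def set_integrable_def integral_restrict_space integrable_restrict_space)

lemma Y_powr_on_Omega: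
  assumes "v \<in> Y"
  shows "integrable (lebesgue_on \<Omega>) (\<lambda>x. \<bar>v x\<bar> powr q)" "(\<integral>x. \<bar>v x\<bar> powr q \<partial>lebesgue_on \<Omega>) = Z v"
proof -
  have "(\<lambda>x. \<bar>v x\<bar> powr q) \<in> borel_measurable borel" using Y_measurable[OF assms] by measurable
  note * = integral_on_Omega[OF this]
  show "integrable (lebesgue_on \<Omega>) (\<lambda>x. \<bar>v x\<bar> powr q)" "(\<integral>x. \<bar>v x\<bar> powr q \<partial>lebesgue_on \<Omega>) = Z v"
    using * Y_support[OF assms] Y_integrable_powr[OF assms] by (simp_all add: Z_def)
qed

lemma Y_square_on_Omega:
  assumes "v \<in> Y"
  shows "integrable (lebesgue_on \<Omega>) (\<lambda>x. (v x)^2)" "(\<integral>x. (v x)^2 \<partial>lebesgue_on \<Omega>) = (\<integral>x. (v x)^2 \<partial>lborel)"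
proof -
  have "(\<lambda>x. (v x)^2) \<in> borel_measurable borel" using Y_measurable[OF assms] by measurable
  note * = integral_on_Omega[OF this]
  show "integrable (lebesgue_on \<Omega>) (\<lambda>x. (v x)^2)" "(\<integral>x. (v x)^2 \<partial>lebesgue_on \<Omega>) = (\<integral>x. (v x)^2 \<partial>lborel)"
    using * Y_support[OF assms] Y_power_bound(1)[OF assms, of 2] by simp_all
qed

lemma energy_Y:
  assumes v: "v \<in> Y" shows "energy \<Omega> s g a b l v = \<Phi> v - l * \<Gamma> v"
proof -
  have "X0_norm \<Omega> s v ^ 2 = A v" using A_nonneg by (simp add: X0_norm_Y[OF v])
  moreover have "X0_norm \<Omega> s v ^ 4 = (A v)^2"
  proof -
    have "X0_norm \<Omega> s v ^ 4 = (X0_norm \<Omega> s v ^ 2)^2" by (simp flip: power_mult)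
    then show ?thesis using calculation by simp
  qed
  moreover have "Lq_norm \<Omega> q v powr q = Z v" using Z_nonneg[of v] q by (simp add: Lq_norm_Y[OF v] powr_powr)
  moreover have "(LINT x:\<Omega>|lebesgue. primitive g x (v x)) = \<Gamma> v"
    using Omega_lebesgue by (simp add: nl.potential_def set_lebesgue_integral_def integral_restrict_space)
  ultimately show ?thesis by (simp add: energy_def Let_def q_def[symmetric] \<Phi>_def)
qed

lemma energy_cong_AE:
  assumes v: "v \<in> Y" and uv: "AE x in lebesgue. v x = u x"
  shows "energy \<Omega> s g a b l u = energy \<Omega> s g a b l v"
proof -
  have "(\<lambda>x. indicator \<Omega> x *\<^sub>R primitive g x (v x)) \<in> borel_measurable lebesgue"
    using nl.primitive_measurable[OF Y_measurable_on[OF v]] Omega_lebesgue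
    by (simp add: borel_measurable_restrict_space_iff)
  moreover have "AE x in lebesgue. indicator \<Omega> x *\<^sub>R primitive g x (v x) = indicator \<Omega> x *\<^sub>R primitive g x (u x)"
    using uv by eventually_elim simp
  ultimately have "(LINT x:\<Omega>|lebesgue. primitive g x (v x)) = (LINT x:\<Omega>|lebesgue. primitive g x (u x))"
    unfolding set_lebesgue_integral_def by (rule lebesgue_integral_cong_AE_complete)
  then show ?thesis
    using X0_norm_cong_AE[OF v uv] Lq_norm_cong_AE[OF v uv] by (simp add: energy_def Let_def q_def)
qed

text \<open>A named predicate allows one fixed \<open>\<eta>\<close> to be chosen for the whole
  locale, where it serves as a parameter of \<open>constrained_minimization\<close>.\<close>

definition coercivity :: "real \<Rightarrow> bool" where
  "coercivity e \<longleftrightarrow> e > 0 \<and> (\<forall>\<alpha> \<beta>. \<alpha> \<ge> 0 \<longrightarrow> \<beta> \<le> (\<alpha> / S_const \<Omega> s) powr (q / 2) \<longrightarrow>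
     e * (\<alpha> + \<alpha>^2) \<le> a / 2 * \<alpha> + b / 4 * \<alpha>^2 - \<beta> / q)"

definition \<eta> :: real where "\<eta> = (SOME e. coercivity e)"

lemma coercivity_eta: "coercivity \<eta>"
proof -
  obtain e where "e > 0" "\<And>\<alpha> \<beta>. \<alpha> \<ge> 0 \<Longrightarrow> \<beta> \<le> (\<alpha> / S_const \<Omega> s) powr (q / 2) \<Longrightarrow>
       e * (\<alpha> + \<alpha>^2) \<le> a / 2 * \<alpha> + b / 4 * \<alpha>^2 - \<beta> / q"
    by (rule critical_quartic_coercive[OF s(1) N ab(1,2) S_const_pos ab(3)[unfolded L_const_def Let_def],
          folded q_def]) (rule that)
  then have "\<exists>e. coercivity e" unfolding coercivity_def by (intro exI[of _ e]) simp
  then show ?thesis unfolding \<eta>_def by (rule someI_ex)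
qed

lemma eta: "\<eta> > 0"
  and eta_bound: "\<alpha> \<ge> 0 \<Longrightarrow> \<beta> \<le> (\<alpha> / S_const \<Omega> s) powr (q / 2) \<Longrightarrow>
       \<eta> * (\<alpha> + \<alpha>^2) \<le> a / 2 * \<alpha> + b / 4 * \<alpha>^2 - \<beta> / q"
  using coercivity_eta by (simp_all add: coercivity_def)

lemma Phi_lower: "v \<in> Y \<Longrightarrow> \<eta> * (A v + (A v)^2) \<le> \<Phi> v"
  unfolding \<Phi>_def by (rule eta_bound[OF A_nonneg S_const_sobolev])

text \<open>Half of e goes to the quadratic part through the Poincare constant P, half to the
  critical part, which is at most a constant times A^(q/2) and hence o(A) since q > 2.\<close>

lemma Gamma_small:
  assumes e: "e > 0"
  shows "\<exists>\<rho>>0. \<forall>u\<in>Y. A u \<le> \<rho> \<longrightarrow> \<bar>\<Gamma> u\<bar> \<le> e * A u"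
proof -
  obtain C where C: "C > 0" "\<And>v. v \<in> Y \<Longrightarrow> Z v \<le> C * A v powr (q / 2)" using sobolev_Y by metis
  obtain P where P: "P > 0" "\<And>v. v \<in> Y \<Longrightarrow> (\<integral>x. (v x)^2 \<partial>lborel) \<le> P * A v" using poincare by metis
  have "e / (2 * P) > 0" using e P by simp
  from nl.potential_bound_zero[OF this] obtain K where K: "K \<ge> 0" "\<And>u. u \<in> borel_measurable (lebesgue_on \<Omega>) \<Longrightarrow>
    integrable (lebesgue_on \<Omega>) (\<lambda>x. \<bar>u x\<bar> powr q) \<Longrightarrow> integrable (lebesgue_on \<Omega>) (\<lambda>x. (u x)^2) \<Longrightarrow>
    \<bar>\<Gamma> u\<bar> \<le> e / (2 * P) * (\<integral>x. (u x)^2 \<partial>lebesgue_on \<Omega>) + K * (\<integral>x. \<bar>u x\<bar> powr q \<partial>lebesgue_on \<Omega>)"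
    by metis
  define \<gamma> where "\<gamma> = q / 2 - 1"
  have \<gamma>: "\<gamma> > 0" using q by (simp add: \<gamma>_def)
  \<comment> \<open>Solves \<rho>^\<gamma> = e/(2(KC + 1)), so that K C A^\<gamma> <= e/2 for A <=
    \<rho>; the added 1 covers K C = 0.\<close>
  define \<rho> where "\<rho> = (e / (2 * (K * C + 1))) powr (1 / \<gamma>)"
  have KC: "K * C \<ge> 0" using K C by simp
  have \<rho>: "\<rho> > 0" using e KC by (simp add: \<rho>_def)
  have \<rho>\<gamma>: "\<rho> powr \<gamma> = e / (2 * (K * C + 1))" using e KC \<gamma> by (simp add: \<rho>_def powr_powr)
  have "\<bar>\<Gamma> u\<bar> \<le> e * A u" if u: "u \<in> Y" "A u \<le> \<rho>" for u
  proof -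
    have "\<bar>\<Gamma> u\<bar> \<le> e / (2 * P) * (\<integral>x. (u x)^2 \<partial>lborel) + K * Z u"
      using K(2)[OF Y_measurable_on[OF u(1)] Y_powr_on_Omega(1)[OF u(1)] Y_square_on_Omega(1)[OF u(1)]]
        Y_powr_on_Omega(2)[OF u(1)] Y_square_on_Omega(2)[OF u(1)] by simp
    also have "\<dots> \<le> e / (2 * P) * (P * A u) + K * (C * A u powr (q / 2))"
      using C(2)[OF u(1)] P(2)[OF u(1)] K(1) e P(1) by (intro add_mono mult_left_mono) auto
    also have "A u powr (q / 2) = A u powr \<gamma> * A u"
    proof (cases "A u = 0")
      case False
      then have "A u > 0" using A_nonneg[of u] by simp
      then show ?thesis by (simp add: \<gamma>_def powr_diff)
    qed simp
    also have "K * (C * (A u powr \<gamma> * A u)) = (K * C * A u powr \<gamma>) * A u" by simp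
    also have "\<dots> \<le> (e / 2) * A u"
    proof (rule mult_right_mono[OF _ A_nonneg])
      have "A u powr \<gamma> \<le> \<rho> powr \<gamma>" using u(2) A_nonneg \<gamma> by (intro powr_mono2) auto
      then have "K * C * A u powr \<gamma> \<le> K * C * (e / (2 * (K * C + 1)))"
        unfolding \<rho>\<gamma> using KC by (intro mult_left_mono) auto
      also have "\<dots> \<le> e / 2" using KC e by (simp add: field_simps)
      finally show "K * C * A u powr \<gamma> \<le> e / 2" .
    qed
    also have "e / (2 * P) * (P * A u) = e / 2 * A u" using P(1) by simp
    finally show ?thesis by simp
  qed
  then show ?thesis using \<rho> by blast
qed

text \<open>The potential grows at most like A^(q/2) with q/2 < 2, so it is absorbed by half of the
  term \<eta> A^2 in \<open>Phi_lower\<close>. This is the only place where the quadratic part of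
  that bound in A is used; elsewhere the linear part suffices.\<close>

lemma Phi_coercive: "\<exists>B. \<forall>u\<in>Y. \<Phi> u \<le> L * \<bar>\<Gamma> u\<bar> + K \<longrightarrow> A u \<le> B"
proof -
  obtain C where C: "C > 0" "\<And>v. v \<in> Y \<Longrightarrow> Z v \<le> C * A v powr (q / 2)" using sobolev_Y by metis
  obtain C0 where C0: "C0 \<ge> 0" "\<And>u. u \<in> borel_measurable (lebesgue_on \<Omega>) \<Longrightarrow>
    integrable (lebesgue_on \<Omega>) (\<lambda>x. \<bar>u x\<bar> powr q) \<Longrightarrow> \<bar>\<Gamma> u\<bar> \<le> 1 * (\<integral>x. \<bar>u x\<bar> powr q \<partial>lebesgue_on \<Omega>) + C0"
    using nl.potential_bound_infinity[of 1] by (metis zero_less_one)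
  define e where "e = \<eta> / (2 * (\<bar>L\<bar> * C + 1))"
  have LC: "\<bar>L\<bar> * C \<ge> 0" using C by simp
  have e: "e > 0" using eta LC by (simp add: e_def)
  have LCe: "\<bar>L\<bar> * C * e \<le> \<eta> / 2" using eta LC by (simp add: e_def field_simps)
  obtain C1 where C1: "C1 \<ge> 0" "\<And>t. \<bar>t\<bar> powr (q / 2) \<le> e * \<bar>t\<bar> powr 2 + C1"
    using powr_subcritical_le[OF e, of "q / 2" 2] q by auto
  define M where "M = \<bar>L\<bar> * (C * C1 + C0) + \<bar>K\<bar>"
  have "A u \<le> 1 + 2 * M / \<eta>" if u: "u \<in> Y" "\<Phi> u \<le> L * \<bar>\<Gamma> u\<bar> + K" for u
  proof -
    have "\<bar>\<Gamma> u\<bar> \<le> Z u + C0"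
      using C0(2)[OF Y_measurable_on[OF u(1)] Y_powr_on_Omega(1)[OF u(1)]] Y_powr_on_Omega(2)[OF u(1)] by simp
    also have "Z u \<le> C * (e * (A u)^2 + C1)"
    proof -
      have "A u powr (q / 2) \<le> e * (A u)^2 + C1" using C1(2)[of "A u"] A_nonneg[of u] by simp
      then have "C * A u powr (q / 2) \<le> C * (e * (A u)^2 + C1)" using C(1) by simp
      then show ?thesis using C(2)[OF u(1)] by simp
    qed
    finally have G: "\<bar>\<Gamma> u\<bar> \<le> C * (e * (A u)^2 + C1) + C0" by simp
    have "L * \<bar>\<Gamma> u\<bar> \<le> \<bar>L\<bar> * \<bar>\<Gamma> u\<bar>" by (intro mult_right_mono) auto
    also have "\<dots> \<le> \<bar>L\<bar> * (C * (e * (A u)^2 + C1) + C0)" using G by (intro mult_left_mono) auto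
    finally have "\<Phi> u \<le> (\<bar>L\<bar> * C * e) * (A u)^2 + M"
      using u(2) by (simp add: M_def algebra_simps)
    moreover have "(\<bar>L\<bar> * C * e) * (A u)^2 \<le> \<eta> / 2 * (A u)^2" using LCe by (intro mult_right_mono) auto
    moreover have "\<eta> * (A u)^2 \<le> \<Phi> u"
    proof -
      have "\<eta> * A u \<ge> 0" using eta A_nonneg[of u] by simp
      then show ?thesis using Phi_lower[OF u(1)] by (simp add: distrib_left)
    qed
    ultimately have "\<eta> / 2 * (A u)^2 \<le> M" by simp
    then have "(A u)^2 \<le> 2 * M / \<eta>" using eta by (simp add: field_simps)
    moreover have "A u \<le> 1 + (A u)^2"
    proof -
      have "0 \<le> (A u - 1/2)^2" by simp
      then show ?thesis by (simp add: power2_eq_square algebra_simps)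
    qed
    ultimately show ?thesis by simp
  qed
  then show ?thesis by blast
qed

lemma Gamma_pos:
  assumes "u \<in> Y" "A u > 0" shows "\<Gamma> u > 0"
proof (rule nl.potential_pos[OF Y_measurable_on[OF assms(1)] Y_powr_on_Omega(1)[OF assms(1)]])
  have "AE x in lborel. u x = 0" if "AE x in lebesgue_on \<Omega>. u x = 0"
  proof -
    have "AE x in lebesgue. x \<in> \<Omega> \<longrightarrow> u x = 0" using that by (simp add: AE_lebesgue_on_Omega)
    then have "AE x in lborel. x \<in> \<Omega> \<longrightarrow> u x = 0" by (simp add: AE_completion_iff)
    then show ?thesis by eventually_elim (use Y_support[OF assms(1)] in blast)
  qed
  then show "\<not> (AE x in lebesgue_on \<Omega>. u x = 0)" using assms A_pos_iff by blast
qed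

text \<open>A and Z split additively up to o(1), while A^2 is superadditive. Hence the lost part
  contributes at least (a/2)\<alpha> + (b/4)\<alpha>^2 - \<beta>/q, which \<open>eta_bound\<close>
  with the Sobolev inequality makes at least \<eta> \<alpha>.\<close>

lemma Phi_compactness:
  fixes v :: "nat \<Rightarrow> real^'n \<Rightarrow> real"
  assumes v: "\<And>n. v n \<in> Y" and B: "\<And>n. A (v n) \<le> B"
  shows "\<exists>(r :: nat \<Rightarrow> nat) w \<alpha> e. strict_mono r \<and> w \<in> Y \<and> (\<forall>n. \<alpha> n \<ge> 0) \<and>
        (\<lambda>n. A (v (r n)) - \<alpha> n) \<longlonglongrightarrow> A w \<and> (\<lambda>n. \<Gamma> (v (r n))) \<longlonglongrightarrow> \<Gamma> w \<and>
        e \<longlonglongrightarrow> (0::real) \<and> (\<forall>n. \<Phi> (v (r n)) \<ge> \<Phi> w + \<eta> * \<alpha> n + e n)"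
proof -
  obtain r w where r: "strict_mono r" and w: "w \<in> Y" "AE x in lborel. (\<lambda>n. v (r n) x) \<longlonglongrightarrow> w x"
    and Al: "(\<lambda>n. A (v (r n)) - A (\<lambda>x. v (r n) x - w x)) \<longlonglongrightarrow> A w"
    and Zl: "(\<lambda>n. Z (v (r n)) - Z (\<lambda>x. v (r n) x - w x)) \<longlonglongrightarrow> Z w"
    by (rule Y_compactness[of v B, OF v B]) (rule that)
  define \<alpha> where "\<alpha> = (\<lambda>n. A (\<lambda>x. v (r n) x - w x))"
  define \<beta> where "\<beta> = (\<lambda>n. Z (\<lambda>x. v (r n) x - w x))"
  define dA where "dA = (\<lambda>n. A (v (r n)) - \<alpha> n - A w)"
  define dZ where "dZ = (\<lambda>n. Z (v (r n)) - \<beta> n - Z w)"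
  have dA0: "dA \<longlonglongrightarrow> 0" using Al unfolding dA_def \<alpha>_def by (rule LIM_zero)
  have dZ0: "dZ \<longlonglongrightarrow> 0" using Zl unfolding dZ_def \<beta>_def by (rule LIM_zero)
  \<comment> \<open>Collects the splitting errors. The middle term bounds the loss in the square
    when A (v (r n)) is replaced by A w + \<alpha> n, using A (v (r n)) <= B for the cross
    term.\<close>
  define e where "e = (\<lambda>n. a / 2 * dA n - b / 4 * (2 * B * \<bar>dA n\<bar> + 2 * (dA n)^2) - dZ n / q)"
  have "e \<longlonglongrightarrow> a / 2 * 0 - b / 4 * (2 * B * \<bar>0\<bar> + 2 * 0^2) - 0 / q"
    unfolding e_def using q by (intro tendsto_intros dA0 dZ0) auto
  then have e0: "e \<longlonglongrightarrow> 0" by simp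
  obtain C where C: "C > 0" "\<And>v. v \<in> Y \<Longrightarrow> Z v \<le> C * A v powr (q / 2)" using sobolev_Y by metis
  have Glim: "(\<lambda>n. \<Gamma> (v (r n))) \<longlonglongrightarrow> \<Gamma> w"
  proof (rule nl.potential_tendsto)
    have "AE x in lebesgue. (\<lambda>n. v (r n) x) \<longlonglongrightarrow> w x" using w(2) by (simp add: AE_completion_iff)
    then show "AE x in lebesgue_on \<Omega>. (\<lambda>n. v (r n) x) \<longlonglongrightarrow> w x"
      unfolding AE_lebesgue_on_Omega by eventually_elim simp
    show "(\<integral>x. \<bar>v (r n) x\<bar> powr q \<partial>lebesgue_on \<Omega>) \<le> C * B powr (q / 2)" for n
    proof -
      have "C * A (v (r n)) powr (q / 2) \<le> C * B powr (q / 2)"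
        using B[of "r n"] A_nonneg q C(1) by (intro mult_left_mono powr_mono2) auto
      then show ?thesis using C(2)[OF v[of "r n"]] Y_powr_on_Omega(2)[OF v[of "r n"]] by simp
    qed
  qed (use Y_measurable_on v w(1) Y_powr_on_Omega(1) in auto)
  have ge: "\<Phi> w + \<eta> * \<alpha> n + e n \<le> \<Phi> (v (r n))" for n
  proof -
    have vw: "(\<lambda>x. v (r n) x - w x) \<in> Y" by (rule Y_diff[OF v w(1)])
    have \<alpha>0: "\<alpha> n \<ge> 0" "A w \<ge> 0" "A (v (r n)) \<ge> 0" by (auto simp: \<alpha>_def A_nonneg)
    have "\<eta> * (\<alpha> n + (\<alpha> n)^2) \<le> a / 2 * \<alpha> n + b / 4 * (\<alpha> n)^2 - \<beta> n / q"
      by (rule eta_bound[OF \<alpha>0(1)]) (use S_const_sobolev[OF vw] in \<open>simp add: \<alpha>_def \<beta>_def\<close>)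
    moreover have "\<eta> * (\<alpha> n)^2 \<ge> 0" using eta by simp
    ultimately have 1: "\<eta> * \<alpha> n \<le> a / 2 * \<alpha> n + b / 4 * (\<alpha> n)^2 - \<beta> n / q"
      by (simp add: distrib_left)
    define V where "V = A (v (r n))"
    define d where "d = dA n"
    have Vd: "V = A w + \<alpha> n + d" by (simp add: V_def d_def dA_def)
    have "(A w)^2 + (\<alpha> n)^2 \<le> (A w + \<alpha> n)^2" using \<alpha>0 by (simp add: power2_sum)
    also have "A w + \<alpha> n = V - d" using Vd by simp
    also have "(V - d)^2 = V^2 - 2 * V * d + d^2" by (simp add: power2_diff)
    finally have 2: "(A w)^2 + (\<alpha> n)^2 + 2 * V * d - d^2 \<le> V^2" by simp
    have "- (2 * V * d) \<le> 2 * B * \<bar>d\<bar>"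
    proof -
      have "- (2 * V * d) \<le> \<bar>2 * V * d\<bar>" by simp
      also have "\<dots> = 2 * V * \<bar>d\<bar>" using \<alpha>0(3) by (simp add: abs_mult V_def)
      also have "\<dots> \<le> 2 * B * \<bar>d\<bar>" using B[of "r n"] by (intro mult_right_mono) (auto simp: V_def)
      finally show ?thesis .
    qed
    then have "(A w)^2 + (\<alpha> n)^2 - (2 * B * \<bar>d\<bar> + 2 * d^2) \<le> V^2"
      using 2 zero_le_power2[of d] by linarith
    then have "b / 4 * ((A w)^2 + (\<alpha> n)^2 - (2 * B * \<bar>d\<bar> + 2 * d^2)) \<le> b / 4 * V^2"
      using ab by (intro mult_left_mono) auto
    then have 3: "b / 4 * (A w)^2 + b / 4 * (\<alpha> n)^2 - b / 4 * (2 * B * \<bar>d\<bar> + 2 * d^2) \<le> b / 4 * V^2"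
      by (simp only: distrib_left right_diff_distrib)
    have "Z (v (r n)) = Z w + \<beta> n + dZ n" by (simp add: dZ_def)
    then have 4: "Z (v (r n)) / q = Z w / q + \<beta> n / q + dZ n / q" by (simp add: add_divide_distrib)
    have 5: "a / 2 * V = a / 2 * A w + a / 2 * \<alpha> n + a / 2 * d" by (simp only: Vd distrib_left)
    show ?thesis
      using 1 3 4 5 unfolding \<Phi>_def e_def V_def[symmetric] d_def[symmetric] by linarith
  qed
  show ?thesis
    by (rule exI[of _ r], rule exI[of _ w], rule exI[of _ \<alpha>], rule exI[of _ e])
       (use r w(1) Al Glim e0 ge in \<open>auto simp: \<alpha>_def A_nonneg\<close>)
qed

sublocale cm: constrained_minimization Y A \<Phi> \<Gamma> \<eta>
proof
  show "\<eta> * A u \<le> \<Phi> u" if "u \<in> Y" for u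
  proof -
    have "\<eta> * (A u)^2 \<ge> 0" using eta by simp
    then show ?thesis using Phi_lower[OF that] by (simp add: distrib_left)
  qed
qed (use A_nonneg eta Gamma_pos Y_nontrivial Gamma_small Phi_coercive Phi_compactness in blast)+

section \<open>Fibers and the extremal parameter\<close>

lemma fiber_Y:
  assumes "v \<in> Y"
  shows "fiber \<Omega> s g a b l v \<zeta> = \<Phi> (\<lambda>x. \<zeta> * v x) - l * \<Gamma> (\<lambda>x. \<zeta> * v x)"
  unfolding fiber_def by (rule energy_Y[OF Y_scale[OF assms]])

lemma fiber_cong_AE:
  assumes "v \<in> Y" "AE x in lebesgue. v x = u x"
  shows "fiber \<Omega> s g a b l u = fiber \<Omega> s g a b l v"
proof
  fix \<zeta>
  have "AE x in lebesgue. \<zeta> * v x = \<zeta> * u x" using assms(2) by eventually_elim simp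
  then show "fiber \<Omega> s g a b l u \<zeta> = fiber \<Omega> s g a b l v \<zeta>"
    unfolding fiber_def by (rule energy_cong_AE[OF Y_scale[OF assms(1)]])
qed

lemma Phi_fiber_differentiable:
  assumes "\<zeta> > 0"
  shows "\<exists>D. ((\<lambda>\<rho>. \<Phi> (\<lambda>x. \<rho> * v x)) has_real_derivative D) (at \<zeta>)"
proof -
  have "((\<lambda>\<rho>. \<rho> powr q) has_real_derivative q * \<zeta> powr (q - 1)) (at \<zeta>)"
    using assms by (rule has_real_derivative_powr)
  then have "((\<lambda>\<rho>. a / 2 * (\<rho>^2 * A v) + b / 4 * (\<rho>^2 * A v)^2 - \<rho> powr q * Z v / q) has_real_derivative
      a / 2 * (2 * \<zeta> * A v) + b / 4 * (2 * (\<zeta>^2 * A v) * (2 * \<zeta> * A v)) - q * \<zeta> powr (q - 1) * Z v / q) (at \<zeta>)"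
    using assms by (auto intro!: derivative_eq_intros simp: assms)
  then have "((\<lambda>\<rho>. \<Phi> (\<lambda>x. \<rho> * v x)) has_real_derivative
      a / 2 * (2 * \<zeta> * A v) + b / 4 * (2 * (\<zeta>^2 * A v) * (2 * \<zeta> * A v)) - q * \<zeta> powr (q - 1) * Z v / q) (at \<zeta>)"
    by (rule has_field_derivative_transform_within_open[where S = "{0<..}"])
       (use assms in \<open>auto simp: \<Phi>_def A_scale Z_scale\<close>)
  then show ?thesis by blast
qed

text \<open>The fiber at l factors as (R - l) G with G > 0. A zero that is also the infimum
  therefore forces l = min R, and conversely the minimum of R has all the required properties. It is
  attained because R exceeds R 1 near zero and near infinity.\<close>

lemma lambda0_eq_min:
  assumes v: "v \<in> Y" "A v > 0"
  obtains \<zeta> where "\<zeta> > 0" "lambda0 \<Omega> s g a b v = \<Phi> (\<lambda>x. \<zeta> * v x) / \<Gamma> (\<lambda>x. \<zeta> * v x)"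
    "\<And>\<rho>. \<rho> > 0 \<Longrightarrow> lambda0 \<Omega> s g a b v \<le> \<Phi> (\<lambda>x. \<rho> * v x) / \<Gamma> (\<lambda>x. \<rho> * v x)"
proof -
  define P where "P = (\<lambda>\<rho>. \<Phi> (\<lambda>x. \<rho> * v x))"
  define G where "G = (\<lambda>\<rho>. \<Gamma> (\<lambda>x. \<rho> * v x))"
  define R where "R = (\<lambda>\<rho>. P \<rho> / G \<rho>)"
  have Yr: "(\<lambda>x. \<rho> * v x) \<in> Y" for \<rho> by (rule Y_scale[OF v(1)])
  have Ar: "A (\<lambda>x. \<rho> * v x) > 0" if "\<rho> > 0" for \<rho> using v(2) that by (simp add: A_scale)
  have G0: "G \<rho> > 0" if "\<rho> > 0" for \<rho> unfolding G_def by (rule Gamma_pos[OF Yr Ar[OF that]])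
  have dP: "\<exists>D. (P has_real_derivative D) (at \<rho>)" if "\<rho> > 0" for \<rho>
    unfolding P_def by (rule Phi_fiber_differentiable[OF that])
  have dG: "\<exists>D. (G has_real_derivative D) (at \<rho>)" for \<rho>
    unfolding G_def
    by (rule nl.potential_fiber_differentiable[OF Y_measurable_on[OF v(1)] Y_powr_on_Omega(1)[OF v(1)]])
  have R0: "R \<rho> \<ge> 0" if "\<rho> > 0" for \<rho>
  proof -
    have "0 \<le> \<eta> * A (\<lambda>x. \<rho> * v x)" using eta Ar[OF that] by simp
    then have "P \<rho> \<ge> 0" using cm.lower[OF Yr[of \<rho>]] by (simp add: P_def)
    then show ?thesis using G0[OF that] by (simp add: R_def)
  qed
  have contR: "isCont R \<rho>" if "\<rho> > 0" for \<rho>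
  proof -
    have "isCont P \<rho>" "isCont G \<rho>" using dP[OF that] dG[of \<rho>] DERIV_isCont by blast+
    then show ?thesis unfolding R_def using G0[OF that] by (intro continuous_divide) auto
  qed
  \<comment> \<open>On this ball (R 1 + 1) \<Gamma> <= \<eta> A <= \<Phi>, so nonzero functions in
    it have quotient at least R 1 + 1.\<close>
  obtain \<rho>0 where \<rho>0: "\<rho>0 > 0" "\<And>u. u \<in> Y \<Longrightarrow> A u \<le> \<rho>0 \<Longrightarrow> \<bar>\<Gamma> u\<bar> \<le> \<eta> / (R 1 + 1) * A u"
    using Gamma_small[of "\<eta> / (R 1 + 1)"] eta R0[of 1] by auto
  obtain B where B: "\<And>u. u \<in> Y \<Longrightarrow> \<Phi> u \<le> R 1 * \<bar>\<Gamma> u\<bar> + 0 \<Longrightarrow> A u \<le> B"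
    using Phi_coercive[of "R 1" 0] by blast
  have low: "\<rho>0 < \<rho>^2 * A v" "\<rho>^2 * A v \<le> B" if \<rho>: "\<rho> > 0" "R \<rho> \<le> R 1" for \<rho>
  proof -
    have PR: "P \<rho> \<le> R 1 * \<bar>G \<rho>\<bar>" using \<rho>(2) G0[OF \<rho>(1)] by (simp add: R_def field_simps)
    show "\<rho>^2 * A v \<le> B" using B[OF Yr[of \<rho>]] PR by (simp add: P_def G_def A_scale)
    show "\<rho>0 < \<rho>^2 * A v"
    proof (rule ccontr)
      assume "\<not> \<rho>0 < \<rho>^2 * A v"
      then have "\<bar>G \<rho>\<bar> \<le> \<eta> / (R 1 + 1) * (\<rho>^2 * A v)"
        using \<rho>0(2)[OF Yr[of \<rho>]] by (simp add: G_def A_scale)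
      then have "(R 1 + 1) * \<bar>G \<rho>\<bar> \<le> (R 1 + 1) * (\<eta> / (R 1 + 1) * (\<rho>^2 * A v))"
        using R0[of 1] by (intro mult_left_mono) auto
      also have "\<dots> = \<eta> * (\<rho>^2 * A v)" using R0[of 1] by simp
      also have "\<dots> \<le> P \<rho>" using cm.lower[OF Yr[of \<rho>]] by (simp add: P_def A_scale)
      finally show False using PR G0[OF \<rho>(1)] by (simp add: distrib_right)
    qed
  qed
  \<comment> \<open>The bounds \<rho>0 and B for \<rho>^2 A v, solved for \<rho>: the sublevel set
    of R 1 lies in a compact interval of positive numbers.\<close>
  define \<rho>1 where "\<rho>1 = sqrt (\<rho>0 / A v)"
  define \<rho>2 where "\<rho>2 = sqrt (B / A v)"
  have \<rho>1: "\<rho>1 > 0" using \<rho>0 v by (simp add: \<rho>1_def)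
  have bracket: "\<rho>1 \<le> \<rho>" "\<rho> \<le> \<rho>2" if \<rho>: "\<rho> > 0" "R \<rho> \<le> R 1" for \<rho>
  proof -
    have "\<rho>0 / A v \<le> \<rho>^2" "\<rho>^2 \<le> B / A v" using low[OF \<rho>] v(2) by (auto simp: field_simps)
    then show "\<rho>1 \<le> \<rho>" "\<rho> \<le> \<rho>2"
      using \<rho>(1) unfolding \<rho>1_def \<rho>2_def by (auto intro: real_le_lsqrt real_le_rsqrt)
  qed
  have "1 \<in> {\<rho>1..\<rho>2}" using bracket[of 1] by simp
  then have ne: "{\<rho>1..\<rho>2} \<noteq> {}" by blast
  have "continuous_on {\<rho>1..\<rho>2} R"
    using contR \<rho>1 by (intro continuous_at_imp_continuous_on) auto
  then obtain \<zeta> where \<zeta>: "\<zeta> \<in> {\<rho>1..\<rho>2}" "\<And>\<rho>. \<rho> \<in> {\<rho>1..\<rho>2} \<Longrightarrow> R \<zeta> \<le> R \<rho>"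
    using continuous_attains_inf[OF compact_Icc ne] by metis
  have \<zeta>0: "\<zeta> > 0" using \<zeta>(1) \<rho>1 by simp
  have min: "R \<zeta> \<le> R \<rho>" if "\<rho> > 0" for \<rho>
  proof (cases "R \<rho> \<le> R 1")
    case True
    then show ?thesis using bracket[OF that True] \<zeta>(2) by simp
  next
    case False
    then show ?thesis using \<zeta>(2)[OF \<open>1 \<in> {\<rho>1..\<rho>2}\<close>] by simp
  qed
  define f where "f = (\<lambda>l. fiber \<Omega> s g a b l v)"
  have fib: "fiber \<Omega> s g a b l v = f l" for l by (simp add: f_def)
  have f: "f l \<rho> = P \<rho> - l * G \<rho>" for l \<rho> by (simp add: f_def fiber_Y[OF v(1)] P_def G_def)
  have f_eq: "f l \<rho> = (R \<rho> - l) * G \<rho>" if "\<rho> > 0" for l \<rho>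
    using G0[OF that] by (simp add: f R_def field_simps)
  have "lambda0 \<Omega> s g a b v = R \<zeta>"
    unfolding lambda0_def fib
  proof (rule the_equality)
    have fmin: "f (R \<zeta>) \<rho> \<ge> 0" if "\<rho> > 0" for \<rho>
      unfolding f_eq[OF that] using min[OF that] G0[OF that] by simp
    have fz: "f (R \<zeta>) \<zeta> = 0" by (simp add: f_eq[OF \<zeta>0])
    obtain DP DG where "(P has_real_derivative DP) (at \<zeta>)" "(G has_real_derivative DG) (at \<zeta>)"
      using dP[OF \<zeta>0] dG[of \<zeta>] by blast
    then have D: "(f (R \<zeta>) has_real_derivative (DP - R \<zeta> * DG)) (at \<zeta>)"
      unfolding f[abs_def] by (auto intro!: derivative_eq_intros)
    \<comment> \<open>The neighbourhood of radius \<zeta> stays inside the positive half-line, where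
      \<open>fmin\<close> applies.\<close>
    have "DP - R \<zeta> * DG = 0"
      by (rule DERIV_local_min[OF D \<zeta>0]) (use fmin fz in auto)
    then have D0: "(f (R \<zeta>) has_real_derivative 0) (at \<zeta>)" using D by simp
    have "(INF \<rho>\<in>{0<..}. ereal (f (R \<zeta>) \<rho>)) = 0"
    proof (rule antisym)
      show "(INF \<rho>\<in>{0<..}. ereal (f (R \<zeta>) \<rho>)) \<le> 0" using \<zeta>0 fz by (intro INF_lower2[of \<zeta>]) auto
      show "0 \<le> (INF \<rho>\<in>{0<..}. ereal (f (R \<zeta>) \<rho>))" using fmin by (intro INF_greatest) auto
    qed
    then show "0 \<le> R \<zeta> \<and> (\<exists>\<zeta>'>0. f (R \<zeta>) \<zeta>' = 0 \<and> (f (R \<zeta>) has_real_derivative 0) (at \<zeta>') \<and>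
        ereal (f (R \<zeta>) \<zeta>') = (INF \<rho>\<in>{0<..}. ereal (f (R \<zeta>) \<rho>)))"
      using \<zeta>0 fz D0 R0[OF \<zeta>0] by (auto intro!: exI[of _ \<zeta>])
    fix l assume "0 \<le> l \<and> (\<exists>\<zeta>'>0. f l \<zeta>' = 0 \<and> (f l has_real_derivative 0) (at \<zeta>') \<and>
        ereal (f l \<zeta>') = (INF \<rho>\<in>{0<..}. ereal (f l \<rho>)))"
    then obtain \<zeta>' where z: "\<zeta>' > 0" "f l \<zeta>' = 0" "ereal (f l \<zeta>') = (INF \<rho>\<in>{0<..}. ereal (f l \<rho>))"
      by blast
    have "l = R \<zeta>'" using z(2) G0[OF z(1)] by (simp add: f_eq[OF z(1)])
    moreover have "f l \<zeta> \<ge> 0"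
    proof -
      have "ereal (f l \<zeta>') \<le> ereal (f l \<zeta>)" unfolding z(3) by (rule INF_lower) (use \<zeta>0 in simp)
      then show ?thesis using z(2) by simp
    qed
    then have "l \<le> R \<zeta>" using G0[OF \<zeta>0] by (simp add: f_eq[OF \<zeta>0] zero_le_mult_iff)
    ultimately show "l = R \<zeta>" using min[OF z(1)] by simp
  qed
  then show ?thesis using that[of \<zeta>] \<zeta>0 min by (simp add: R_def P_def G_def)
qed

text \<open>Each \<open>lambda0\<close> is a value of the quotient at some multiple of the function,
  hence at least the minimum. At \<open>u0\<close> it is also at most the quotient of
  \<open>u0\<close> itself, the multiple 1 being admissible.\<close>

lemma lambda0_bar_eq:
  assumes u0: "u0 \<in> Y" "A u0 > 0"
    and min: "\<And>u. u \<in> Y \<Longrightarrow> A u > 0 \<Longrightarrow> \<Phi> u0 / \<Gamma> u0 \<le> \<Phi> u / \<Gamma> u"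
  shows "lambda0_bar \<Omega> s g a b = \<Phi> u0 / \<Gamma> u0"
proof -
  have ge: "\<Phi> u0 / \<Gamma> u0 \<le> lambda0 \<Omega> s g a b v" if v: "v \<in> Y" "A v > 0" for v
  proof -
    obtain \<zeta> where "\<zeta> > 0" "lambda0 \<Omega> s g a b v = \<Phi> (\<lambda>x. \<zeta> * v x) / \<Gamma> (\<lambda>x. \<zeta> * v x)"
      using lambda0_eq_min[OF v] by metis
    then show ?thesis using min[OF Y_scale[OF v(1)], of \<zeta>] v(2) by (simp add: A_scale)
  qed
  have le: "lambda0 \<Omega> s g a b u0 \<le> \<Phi> u0 / \<Gamma> u0"
  proof -
    have "lambda0 \<Omega> s g a b u0 \<le> \<Phi> (\<lambda>x. 1 * u0 x) / \<Gamma> (\<lambda>x. 1 * u0 x)"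
      by (rule lambda0_eq_min[OF u0]) (metis zero_less_one)
    then show ?thesis by simp
  qed
  show ?thesis unfolding lambda0_bar_def
  proof (rule cInf_eq_minimum)
    show "\<Phi> u0 / \<Gamma> u0 \<in> lambda0 \<Omega> s g a b ` X0_nonzero \<Omega> s"
      using le ge[OF u0] Y_nonzero[OF u0] by (intro image_eqI[of _ _ u0]) auto
    fix y assume "y \<in> lambda0 \<Omega> s g a b ` X0_nonzero \<Omega> s"
    then obtain u where u: "u \<in> X0_nonzero \<Omega> s" "y = lambda0 \<Omega> s g a b u" by blast
    obtain v where v: "v \<in> Y" "A v > 0" "AE x in lebesgue. v x = u x"
      using X0_nonzero_representative[OF u(1)] by blast
    \<comment> \<open>Fibers of almost everywhere equal functions coincide, so
      \<open>lambda0\<close> depends only on the class.\<close>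
    have "lambda0 \<Omega> s g a b u = lambda0 \<Omega> s g a b v"
      unfolding lambda0_def fiber_cong_AE[OF v(1,3)] ..
    then show "\<Phi> u0 / \<Gamma> u0 \<le> y" using ge[OF v(1,2)] u(2) by simp
  qed
qed

lemma local_minimizer_below_lambda0_bar:
  "\<exists>\<delta>>0. \<exists>r>0. \<forall>l. lambda0_bar \<Omega> s g a b - \<delta> < l \<and> l < lambda0_bar \<Omega> s g a b \<longrightarrow>
    (\<exists>w\<in>X0 \<Omega> s. ereal (energy \<Omega> s g a b l w) = iota_hat \<Omega> s g a b r l \<and> X0_norm \<Omega> s w > r)"
proof -
  obtain u0 where u0: "u0 \<in> Y" "A u0 > 0"
    "\<And>u. u \<in> Y \<Longrightarrow> A u > 0 \<Longrightarrow> \<Phi> u0 / \<Gamma> u0 \<le> \<Phi> u / \<Gamma> u"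
    using cm.rayleigh_minimizer by blast
  have bar: "lambda0_bar \<Omega> s g a b = \<Phi> u0 / \<Gamma> u0" by (rule lambda0_bar_eq[OF u0])
  obtain \<delta> t where \<delta>: "\<delta> > 0" "t > 0" and ex: "\<And>l. \<Phi> u0 / \<Gamma> u0 - \<delta> < l \<and> l < \<Phi> u0 / \<Gamma> u0 \<Longrightarrow>
    \<exists>w\<in>Y. A w > t \<and> (\<forall>u\<in>Y. A u \<ge> t \<longrightarrow> \<Phi> w - l * \<Gamma> w \<le> \<Phi> u - l * \<Gamma> u)"
    using cm.local_minimizer_away_from_zero[OF u0] by metis
  \<comment> \<open>The radius is sqrt t because A is the squared norm. Arbitrary competitors in
    \<open>X0\<close> are compared through their representatives, which have the same norm and
    energy.\<close>
  have "\<exists>w\<in>X0 \<Omega> s. ereal (energy \<Omega> s g a b l w) = iota_hat \<Omega> s g a b (sqrt t) l \<and> X0_norm \<Omega> s w > sqrt t"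
    if l: "\<Phi> u0 / \<Gamma> u0 - \<delta> < l \<and> l < \<Phi> u0 / \<Gamma> u0" for l
  proof -
    obtain w where w: "w \<in> Y" "A w > t" "\<And>u. u \<in> Y \<Longrightarrow> A u \<ge> t \<Longrightarrow> \<Phi> w - l * \<Gamma> w \<le> \<Phi> u - l * \<Gamma> u"
      using ex[OF l] by blast
    have n: "X0_norm \<Omega> s w > sqrt t" using w(2) by (simp add: X0_norm_Y[OF w(1)])
    have "ereal (energy \<Omega> s g a b l w) = iota_hat \<Omega> s g a b (sqrt t) l"
      unfolding iota_hat_def
    proof (rule antisym)
      show "(INF u\<in>{u \<in> X0 \<Omega> s. sqrt t \<le> X0_norm \<Omega> s u}. ereal (energy \<Omega> s g a b l u)) \<le> ereal (energy \<Omega> s g a b l w)"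
        by (rule INF_lower) (use Y_subset_X0[OF w(1)] n in simp)
      show "ereal (energy \<Omega> s g a b l w) \<le> (INF u\<in>{u \<in> X0 \<Omega> s. sqrt t \<le> X0_norm \<Omega> s u}. ereal (energy \<Omega> s g a b l u))"
      proof (rule INF_greatest)
        fix u assume "u \<in> {u \<in> X0 \<Omega> s. sqrt t \<le> X0_norm \<Omega> s u}"
        then have u: "u \<in> X0 \<Omega> s" "sqrt t \<le> X0_norm \<Omega> s u" by auto
        obtain v where v: "v \<in> Y" "AE x in lebesgue. v x = u x" using X0_representative[OF u(1)] by blast
        have "A v \<ge> t" using u(2) X0_norm_cong_AE[OF v] by (simp add: X0_norm_Y[OF v(1)])
        then show "ereal (energy \<Omega> s g a b l w) \<le> ereal (energy \<Omega> s g a b l u)"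
          using w(3)[OF v(1)] energy_cong_AE[OF v] by (simp add: energy_Y[OF v(1)] energy_Y[OF w(1)])
      qed
    qed
    then show ?thesis using n Y_subset_X0[OF w(1)] by blast
  qed
  then show ?thesis using \<delta> unfolding bar by (intro exI[of _ \<delta>] conjI exI[of _ "sqrt t"]) auto
qed

end

theorem theorem1p6:
  fixes \<Omega> :: "(real^'n) set"
    and g :: "real^'n \<Rightarrow> real \<Rightarrow> real"
    and s a b c p :: real
  assumes s: "0 < s" "s < 1"
    and N: "real CARD('n) > 4 * s"
    and \<Omega>: "open \<Omega>" "connected \<Omega>" "\<Omega> \<noteq> {}" "bounded \<Omega>" "lipschitz_boundary \<Omega>"
    and H1: "caratheodory \<Omega> g" "AE x\<in>\<Omega> in lebesgue. g x 0 = 0"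
    and H2: "AE x\<in>\<Omega> in lebesgue. (\<forall>t>0. g x t > 0) \<and> (\<forall>t<0. g x t < 0)"
      "\<exists>\<mu>>0. \<exists>I. open I \<and> is_interval I \<and> I \<noteq> {} \<and> I \<subseteq> {0<..} \<and>
         (AE x\<in>\<Omega> in lebesgue. \<forall>t\<in>I. g x t \<ge> \<mu>)"
    and H3: "c > 0" "2 < p" "p < crit_exp (real CARD('n)) s"
      "AE x\<in>\<Omega> in lebesgue. \<forall>t. \<bar>g x t\<bar> \<le> c * (1 + \<bar>t\<bar> powr (p - 1))"
    and H4: "uniform_limit \<Omega> (\<lambda>t x. g x t / \<bar>t\<bar>) (\<lambda>x. 0) (at 0)"
    and ab: "a > 0" "b > 0"
      "a powr ((real CARD('n) - 4 * s) / (2 * s)) * b > L_const \<Omega> s"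
  shows "\<exists>\<delta>>0. \<exists>r>0. \<forall>l. lambda0_bar \<Omega> s g a b - \<delta> < l \<and> l < lambda0_bar \<Omega> s g a b \<longrightarrow>
    (\<exists>w\<in>X0 \<Omega> s. ereal (energy \<Omega> s g a b l w) = iota_hat \<Omega> s g a b r l \<and> X0_norm \<Omega> s w > r)"
proof -
  interpret kirchhoff_problem \<Omega> s g a b c p
    by unfold_locales (use assms in auto)
  show ?thesis by (rule local_minimizer_below_lambda0_bar)
qed

end
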